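(* Let $S$ be a smooth manifold, $G$ a Lie group with Lie algebra $\mathfrak g$, and $\alpha:\mathfrak g\to\mathfrak g^*$ a Lie algebra 1-cocycle for the coadjoint action, with symmetric part $p$ and skew-symmetric part $\omega$ ($\alpha(x)y=p(x,y)+\omega(x,y)$). Let $$\sigma_N(u,v)=p(u,dv)-p(du,v)+d(\omega(u,v))\in\Omega^1(S),\qquad u,v\in C^\infty(S,\mathfrak g).$$ If $\alpha$ can be integrated to a group 1-cocycle $a:G\to\mathfrak g^*$, then $$c(g_1,g_2)=a(g_1)(dg_2\,g_2^{-1})\in\Omega^1(S),\qquad g_1,g_2\in C^\infty(S,G),$$ is a group 2-cocycle on the current group $C^\infty(S,G)$ with values in the trivial module $\Omega^1(S)$, integrating the Lie algebra cocycle $\sigma_N$ on $C^\infty(S,\mathfrak g)$.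
   Context: The Lie algebra 1-cocycle condition is $\alpha([x,y])z=\alpha(x)[y,z]-\alpha(y)[x,z]$ for $x,y,z\in\mathfrak g$. A group 1-cocycle $a:G\to\mathfrak g^*$ for the coadjoint action is a smooth map with $a(gh)=a(h)+a(g)\circ\mathrm{Ad}_h$ for all $g,h\in G$; it integrates $\alpha$ if its derivative at the identity is $\alpha$. The groups $C^\infty(S,G)$ and Lie algebra $C^\infty(S,\mathfrak g)$ have pointwise operations; $dg\,g^{-1}\in\Omega^1(S,\mathfrak g)$ is the right logarithmic derivative of $g\in C^\infty(S,G)$, and $a(g_1)(dg_2\,g_2^{-1})$ is the 1-form on $S$ obtained by the pointwise pairing of $\mathfrak g^*$ and $\mathfrak g$. A group 2-cocycle with values in a trivial module satisfies $c(g_1,g_2)+c(g_1g_2,g_3)=c(g_2,g_3)+c(g_1,g_2g_3)$. It integrates the Lie algebra 2-cocycle $\sigma$ if $\sigma(u,v)=\frac{\partial^2}{\partial t\,\partial s}\big|_{t=s=0}\big(c(e^{tu},e^{sv})-c(e^{sv},e^{tu})\big)$. For $u=f\otimes x$, $v=f'\otimes x'$: $p(u,dv)=p(x,x')f\,df'$, $p(du,v)=p(x,x')f'\,df$, $\omega(u,v)=\omega(x,x')ff'$. *)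

theory Defs
  imports "HOL-Analysis.Analysis" "HOL-Algebra.Group" "HOL-Library.Function_Algebras"
begin

section \<open>Smooth manifolds\<close>

text \<open>
  The model space of a manifold is a linear subspace \<open>E\<close> of a Euclidean space rather than a
  Euclidean type itself, because the latter always has positive dimension. A function on a
  relatively open subset \<open>U\<close> of \<open>E\<close> has a derivative within \<open>U\<close> that is unique on \<open>E\<close>.
\<close>

primrec Ck_on :: "nat \<Rightarrow> 'e::real_normed_vector set \<Rightarrow> 'e set \<Rightarrow> ('e \<Rightarrow> 'f::real_normed_vector) \<Rightarrow> bool"
where
  "Ck_on 0 E U f \<longleftrightarrow> continuous_on U f"
| "Ck_on (Suc k) E U f \<longleftrightarrow>
     (\<exists>D. (\<forall>x\<in>U. (f has_derivative D x) (at x within U)) \<and> (\<forall>v\<in>E. Ck_on k E U (\<lambda>x. D x v)))"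

definition smooth_on :: "'e::real_normed_vector set \<Rightarrow> 'e set \<Rightarrow> ('e \<Rightarrow> 'f::real_normed_vector) \<Rightarrow> bool"
where
  "smooth_on E U f \<longleftrightarrow> (\<forall>k. Ck_on k E U f)"

record ('a, 'e) manifold =
  model :: "'e set"
  atlas :: "('a set \<times> ('a \<Rightarrow> 'e)) set"

text \<open>
  The underlying space is a whole type; the Hausdorff property and second countability are the
  sort constraint. The atlas need not be maximal.
\<close>

definition smooth_manifold ::
  "('a::{t2_space,second_countable_topology}, 'e::euclidean_space) manifold \<Rightarrow> bool"
where
  "smooth_manifold M \<longleftrightarrow>
     subspace (model M) \<and>
     (\<Union>(U, \<phi>)\<in>atlas M. U) = UNIV \<and>
     (\<forall>(U, \<phi>)\<in>atlas M. open U \<and> openin (top_of_set (model M)) (\<phi> ` U) \<and>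
        homeomorphism U (\<phi> ` U) \<phi> (inv_into U \<phi>)) \<and>
     (\<forall>(U, \<phi>)\<in>atlas M. \<forall>(V, \<psi>)\<in>atlas M.
        smooth_on (model M) (\<phi> ` (U \<inter> V)) (\<psi> \<circ> inv_into U \<phi>))"

definition real_line :: "(real, real) manifold"
where
  "real_line = \<lparr> model = UNIV, atlas = {(UNIV, \<lambda>x. x)} \<rparr>"

definition prod_manifold ::
  "('a, 'e) manifold \<Rightarrow> ('b, 'f) manifold \<Rightarrow> ('a \<times> 'b, 'e \<times> 'f) manifold"
where
  "prod_manifold M N =
     \<lparr> model = model M \<times> model N,
       atlas = {(U \<times> V, map_prod \<phi> \<psi>) | U \<phi> V \<psi>. (U, \<phi>) \<in> atlas M \<and> (V, \<psi>) \<in> atlas N} \<rparr>"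

definition smooth_map_on ::
  "('a::topological_space, 'e::real_normed_vector) manifold \<Rightarrow>
   ('b::topological_space, 'f::real_normed_vector) manifold \<Rightarrow> 'a set \<Rightarrow> ('a \<Rightarrow> 'b) \<Rightarrow> bool"
where
  "smooth_map_on M N U f \<longleftrightarrow>
     open U \<and> continuous_on U f \<and>
     (\<forall>(V, \<phi>)\<in>atlas M. \<forall>(W, \<psi>)\<in>atlas N.
        smooth_on (model M) (\<phi> ` (U \<inter> V \<inter> f -` W)) (\<psi> \<circ> f \<circ> inv_into V \<phi>))"

definition smooth_maps ::
  "('a::topological_space, 'e::real_normed_vector) manifold \<Rightarrow>
   ('b::topological_space, 'f::real_normed_vector) manifold \<Rightarrow> ('a \<Rightarrow> 'b) set"
where
  "smooth_maps M N = {f. smooth_map_on M N UNIV f}"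

definition smooth_near ::
  "('a::topological_space, 'e::real_normed_vector) manifold \<Rightarrow> 'a \<Rightarrow> ('a \<Rightarrow> real) \<Rightarrow> bool"
where
  "smooth_near M p f \<longleftrightarrow> (\<exists>U. p \<in> U \<and> smooth_map_on M real_line U f)"


section \<open>Tangent vectors\<close>

text \<open>
  A tangent vector at \<open>p\<close> is an equivalence class of smooth curves through \<open>p\<close>, two curves being
  equivalent if they have the same derivative along every real function that is smooth near \<open>p\<close>.
  The class is represented by the resulting operator \<open>f \<mapsto> (f \<circ> \<gamma>)'(0)\<close> on functions smooth near
  \<open>p\<close>, extended by \<open>0\<close> to all other functions so that it is determined by the class. The vector
  space operations are then pointwise.
\<close>

type_synonym 'a tvec = "('a \<Rightarrow> real) \<Rightarrow> real"

definition velocity ::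
  "('a::topological_space, 'e::real_normed_vector) manifold \<Rightarrow> (real \<Rightarrow> 'a) \<Rightarrow> real \<Rightarrow> 'a tvec"
where
  "velocity M \<gamma> t = (\<lambda>f. if smooth_near M (\<gamma> t) f then deriv (\<lambda>s. f (\<gamma> s)) t else 0)"

definition tangent_space ::
  "('a::topological_space, 'e::real_normed_vector) manifold \<Rightarrow> 'a \<Rightarrow> 'a tvec set"
where
  "tangent_space M p =
     {velocity M \<gamma> 0 | \<gamma>. \<gamma> 0 = p \<and> (\<exists>\<epsilon>>0. smooth_map_on real_line M {-\<epsilon><..<\<epsilon>} \<gamma>)}"

text \<open>The image of the tangent vector \<open>X\<close> at \<open>p\<close> under the differential of \<open>F\<close> at \<open>p\<close>.\<close>

definition pushforward ::
  "('b::topological_space, 'f::real_normed_vector) manifold \<Rightarrow> ('a \<Rightarrow> 'b) \<Rightarrow> 'a \<Rightarrow> 'a tvec \<Rightarrow> 'b tvec"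
where
  "pushforward N F p X = (\<lambda>f. if smooth_near N (F p) f then X (\<lambda>x. f (F x)) else 0)"

definition scale :: "real \<Rightarrow> ('x \<Rightarrow> real) \<Rightarrow> ('x \<Rightarrow> real)"
where
  "scale r X = (\<lambda>f. r * X f)"

definition linear_functional :: "'a tvec set \<Rightarrow> ('a tvec \<Rightarrow> real) \<Rightarrow> bool"
where
  "linear_functional V \<beta> \<longleftrightarrow>
     (\<forall>X\<in>V. \<forall>Y\<in>V. \<beta> (X + Y) = \<beta> X + \<beta> Y) \<and> (\<forall>r. \<forall>X\<in>V. \<beta> (scale r X) = r * \<beta> X)"


section \<open>Differential 1-forms\<close>

definition coord_vector ::
  "('a::topological_space, 'e::real_normed_vector) manifold \<Rightarrow> 'a set \<times> ('a \<Rightarrow> 'e) \<Rightarrow> 'e \<Rightarrow> 'a \<Rightarrow> 'a tvec"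
where
  "coord_vector M = (\<lambda>(U, \<phi>) v q. velocity M (\<lambda>t. inv_into U \<phi> (\<phi> q + t *\<^sub>R v)) 0)"

text \<open>
  A 1-form takes a point and a tangent vector at that point. It is given the value \<open>0\<close> on
  everything that is not a tangent vector at the point, so that equality of 1-forms is
  equality of functions.
\<close>

type_synonym 'a form = "'a \<Rightarrow> 'a tvec \<Rightarrow> real"

definition one_forms ::
  "('a::topological_space, 'e::real_normed_vector) manifold \<Rightarrow> 'a form set"
where
  "one_forms M =
     {\<beta>. (\<forall>q. linear_functional (tangent_space M q) (\<beta> q)) \<and>
         (\<forall>q. \<forall>X. X \<notin> tangent_space M q \<longrightarrow> \<beta> q X = 0) \<and>
         (\<forall>(U, \<phi>)\<in>atlas M. \<forall>v\<in>model M.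
            smooth_map_on M real_line U (\<lambda>q. \<beta> q (coord_vector M (U, \<phi>) v q)))}"


section \<open>Lie groups\<close>

definition lie_group ::
  "'g::{t2_space,second_countable_topology} monoid \<Rightarrow> ('g, 'e::euclidean_space) manifold \<Rightarrow> bool"
where
  "lie_group G M \<longleftrightarrow>
     smooth_manifold M \<and> group G \<and> carrier G = UNIV \<and>
     (\<lambda>(g, h). g \<otimes>\<^bsub>G\<^esub> h) \<in> smooth_maps (prod_manifold M M) M \<and>
     (\<lambda>g. inv\<^bsub>G\<^esub> g) \<in> smooth_maps M M"

definition lie_alg ::
  "'g::topological_space monoid \<Rightarrow> ('g, 'e::real_normed_vector) manifold \<Rightarrow> 'g tvec set"
where
  "lie_alg G M = tangent_space M \<one>\<^bsub>G\<^esub>"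

text \<open>
  The commutator at the identity of the left-invariant vector fields extending \<open>x\<close> and \<open>y\<close>: the
  left-invariant field of \<open>y\<close> sends \<open>f\<close> to \<open>h \<mapsto> y (f \<circ> L_h)\<close>, where \<open>L_h\<close> is left translation.
\<close>

definition lie_bracket ::
  "'g::topological_space monoid \<Rightarrow> ('g, 'e::real_normed_vector) manifold \<Rightarrow>
   'g tvec \<Rightarrow> 'g tvec \<Rightarrow> 'g tvec"
where
  "lie_bracket G M x y =
     (\<lambda>f. if smooth_near M \<one>\<^bsub>G\<^esub> f
          then x (\<lambda>h. y (\<lambda>k. f (h \<otimes>\<^bsub>G\<^esub> k))) - y (\<lambda>h. x (\<lambda>k. f (h \<otimes>\<^bsub>G\<^esub> k)))
          else 0)"

definition Ad ::
  "'g::topological_space monoid \<Rightarrow> ('g, 'e::real_normed_vector) manifold \<Rightarrow> 'g \<Rightarrow> 'g tvec \<Rightarrow> 'g tvec"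
where
  "Ad G M h = pushforward M (\<lambda>k. h \<otimes>\<^bsub>G\<^esub> k \<otimes>\<^bsub>G\<^esub> inv\<^bsub>G\<^esub> h) \<one>\<^bsub>G\<^esub>"

definition lie_exp ::
  "'g::topological_space monoid \<Rightarrow> ('g, 'e::real_normed_vector) manifold \<Rightarrow> 'g tvec \<Rightarrow> 'g"
where
  "lie_exp G M x =
     (THE \<gamma>. \<gamma> \<in> smooth_maps real_line M \<and> (\<forall>s t. \<gamma> (s + t) = \<gamma> s \<otimes>\<^bsub>G\<^esub> \<gamma> t) \<and>
             velocity M \<gamma> 0 = x) 1"


section \<open>1-cocycles for the coadjoint action\<close>

definition lie_one_cocycle ::
  "'g::topological_space monoid \<Rightarrow> ('g, 'e::real_normed_vector) manifold \<Rightarrow>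
   ('g tvec \<Rightarrow> 'g tvec \<Rightarrow> real) \<Rightarrow> bool"
where
  "lie_one_cocycle G M \<alpha> \<longleftrightarrow>
     (\<forall>x\<in>lie_alg G M. linear_functional (lie_alg G M) (\<alpha> x)) \<and>
     (\<forall>y\<in>lie_alg G M. linear_functional (lie_alg G M) (\<lambda>x. \<alpha> x y)) \<and>
     (\<forall>x\<in>lie_alg G M. \<forall>y\<in>lie_alg G M. \<forall>z\<in>lie_alg G M.
        \<alpha> (lie_bracket G M x y) z
          = \<alpha> x (lie_bracket G M y z) - \<alpha> y (lie_bracket G M x z))"

text \<open>
  The evaluations at elements of the Lie algebra are the linear coordinates on its
  (finite-dimensional) dual, so smoothness of \<open>a\<close> is smoothness of all \<open>h \<mapsto> a h x\<close>.
\<close>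

definition group_one_cocycle ::
  "'g::topological_space monoid \<Rightarrow> ('g, 'e::real_normed_vector) manifold \<Rightarrow>
   ('g \<Rightarrow> 'g tvec \<Rightarrow> real) \<Rightarrow> bool"
where
  "group_one_cocycle G M a \<longleftrightarrow>
     (\<forall>h. linear_functional (lie_alg G M) (a h)) \<and>
     (\<forall>x\<in>lie_alg G M. (\<lambda>h. a h x) \<in> smooth_maps M real_line) \<and>
     (\<forall>g h. \<forall>x\<in>lie_alg G M. a (g \<otimes>\<^bsub>G\<^esub> h) x = a h x + a g (Ad G M h x))"

definition integrates_one_cocycle ::
  "'g::topological_space monoid \<Rightarrow> ('g, 'e::real_normed_vector) manifold \<Rightarrow>
   ('g \<Rightarrow> 'g tvec \<Rightarrow> real) \<Rightarrow> ('g tvec \<Rightarrow> 'g tvec \<Rightarrow> real) \<Rightarrow> bool"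
where
  "integrates_one_cocycle G M a \<alpha> \<longleftrightarrow>
     (\<forall>x\<in>lie_alg G M. \<forall>y\<in>lie_alg G M. x (\<lambda>h. a h y) = \<alpha> x y)"


section \<open>The current group and the current algebra\<close>

definition current_group ::
  "('s::topological_space, 'd::real_normed_vector) manifold \<Rightarrow> 'g::topological_space monoid \<Rightarrow>
   ('g, 'e::real_normed_vector) manifold \<Rightarrow> ('s \<Rightarrow> 'g) monoid"
where
  "current_group S G M =
     \<lparr> carrier = smooth_maps S M, mult = (\<lambda>g h q. g q \<otimes>\<^bsub>G\<^esub> h q), one = (\<lambda>q. \<one>\<^bsub>G\<^esub>) \<rparr>"

text \<open>
  A map into the finite-dimensional Lie algebra is smooth if its linear coordinates are, that
  is, if its composition with every linear functional is smooth.
\<close>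

definition current_alg ::
  "('s::topological_space, 'd::real_normed_vector) manifold \<Rightarrow> 'g::topological_space monoid \<Rightarrow>
   ('g, 'e::real_normed_vector) manifold \<Rightarrow> ('s \<Rightarrow> 'g tvec) set"
where
  "current_alg S G M =
     {u. (\<forall>q. u q \<in> lie_alg G M) \<and>
         (\<forall>\<beta>. linear_functional (lie_alg G M) \<beta> \<longrightarrow> (\<lambda>q. \<beta> (u q)) \<in> smooth_maps S real_line)}"

definition current_bracket ::
  "'g::topological_space monoid \<Rightarrow> ('g, 'e::real_normed_vector) manifold \<Rightarrow>
   ('s \<Rightarrow> 'g tvec) \<Rightarrow> ('s \<Rightarrow> 'g tvec) \<Rightarrow> ('s \<Rightarrow> 'g tvec)"
where
  "current_bracket G M u v = (\<lambda>q. lie_bracket G M (u q) (v q))"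

text \<open>
  \<open>du\<close> for \<open>u\<close> with values in the Lie algebra: the derivative along \<open>X\<close> is taken coordinatewise,
  and \<open>f \<mapsto> u q f\<close> are linear coordinates of \<open>u q\<close>.
\<close>

definition alg_diff :: "('s \<Rightarrow> 'g tvec) \<Rightarrow> 's tvec \<Rightarrow> 'g tvec"
where
  "alg_diff u X = (\<lambda>f. X (\<lambda>q. u q f))"

text \<open>
  \<open>dg g\<^sup>-\<^sup>1\<close> at \<open>q\<close>: the differential at \<open>q\<close> of \<open>g\<close> followed by right translation by the constant
  \<open>g(q)\<^sup>-\<^sup>1\<close>.
\<close>

definition right_log_deriv ::
  "'g::topological_space monoid \<Rightarrow> ('g, 'e::real_normed_vector) manifold \<Rightarrow>
   ('s \<Rightarrow> 'g) \<Rightarrow> 's \<Rightarrow> 's tvec \<Rightarrow> 'g tvec"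
where
  "right_log_deriv G M g q = pushforward M (\<lambda>q'. g q' \<otimes>\<^bsub>G\<^esub> inv\<^bsub>G\<^esub> (g q)) q"

definition sigma_N ::
  "('s::topological_space, 'd::real_normed_vector) manifold \<Rightarrow>
   ('g tvec \<Rightarrow> 'g tvec \<Rightarrow> real) \<Rightarrow> ('g tvec \<Rightarrow> 'g tvec \<Rightarrow> real) \<Rightarrow>
   ('s \<Rightarrow> 'g tvec) \<Rightarrow> ('s \<Rightarrow> 'g tvec) \<Rightarrow> 's form"
where
  "sigma_N S p \<omega> u v = (\<lambda>q X.
     if X \<in> tangent_space S q
     then p (u q) (alg_diff v X) - p (alg_diff u X) (v q) + X (\<lambda>q'. \<omega> (u q') (v q'))
     else 0)"

definition current_cocycle ::
  "('s::topological_space, 'd::real_normed_vector) manifold \<Rightarrow> 'g::topological_space monoid \<Rightarrow>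
   ('g, 'e::real_normed_vector) manifold \<Rightarrow> ('g \<Rightarrow> 'g tvec \<Rightarrow> real) \<Rightarrow>
   ('s \<Rightarrow> 'g) \<Rightarrow> ('s \<Rightarrow> 'g) \<Rightarrow> 's form"
where
  "current_cocycle S G M a g1 g2 = (\<lambda>q X.
     if X \<in> tangent_space S q then a (g1 q) (right_log_deriv G M g2 q X) else 0)"


section \<open>2-cocycles with values in a trivial module\<close>

definition group_two_cocycle ::
  "'h monoid \<Rightarrow> 'm::ab_group_add set \<Rightarrow> ('h \<Rightarrow> 'h \<Rightarrow> 'm) \<Rightarrow> bool"
where
  "group_two_cocycle H A c \<longleftrightarrow>
     group H \<and>
     (\<forall>g\<in>carrier H. \<forall>h\<in>carrier H. c g h \<in> A) \<and>
     (\<forall>g1\<in>carrier H. \<forall>g2\<in>carrier H. \<forall>g3\<in>carrier H.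
        c g1 g2 + c (g1 \<otimes>\<^bsub>H\<^esub> g2) g3 = c g2 g3 + c g1 (g2 \<otimes>\<^bsub>H\<^esub> g3))"

definition lie_two_cocycle ::
  "('s \<Rightarrow> 'g tvec) set \<Rightarrow> (('s \<Rightarrow> 'g tvec) \<Rightarrow> ('s \<Rightarrow> 'g tvec) \<Rightarrow> ('s \<Rightarrow> 'g tvec)) \<Rightarrow> 's form set \<Rightarrow>
   (('s \<Rightarrow> 'g tvec) \<Rightarrow> ('s \<Rightarrow> 'g tvec) \<Rightarrow> 's form) \<Rightarrow> bool"
where
  "lie_two_cocycle L br A \<sigma> \<longleftrightarrow>
     (\<forall>u\<in>L. \<forall>v\<in>L. \<sigma> u v \<in> A) \<and>
     (\<forall>u\<in>L. \<forall>v\<in>L. \<forall>w\<in>L. \<sigma> (u + v) w = \<sigma> u w + \<sigma> v w \<and> \<sigma> w (u + v) = \<sigma> w u + \<sigma> w v) \<and>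
     (\<forall>r. \<forall>u\<in>L. \<forall>v\<in>L. \<sigma> (\<lambda>q. scale r (u q)) v = (\<lambda>q. scale r (\<sigma> u v q)) \<and>
                       \<sigma> u (\<lambda>q. scale r (v q)) = (\<lambda>q. scale r (\<sigma> u v q))) \<and>
     (\<forall>u\<in>L. \<sigma> u u = 0) \<and>
     (\<forall>u\<in>L. \<forall>v\<in>L. \<forall>w\<in>L. \<sigma> (br u v) w + \<sigma> (br v w) u + \<sigma> (br w u) v = 0)"

text \<open>The iterated partial derivative of \<open>F\<close> at \<open>(0, 0)\<close>, first in \<open>s\<close> and then in \<open>t\<close>.\<close>

definition has_mixed_derivative :: "(real \<Rightarrow> real \<Rightarrow> real) \<Rightarrow> real \<Rightarrow> bool"
where
  "has_mixed_derivative F L \<longleftrightarrow>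
     (\<exists>D. (\<forall>t. ((\<lambda>s. F t s) has_real_derivative D t) (at 0)) \<and> (D has_real_derivative L) (at 0))"

text \<open>
  Derivatives of curves of 1-forms are taken pointwise, after evaluation at a tangent vector.
\<close>

definition integrates_two_cocycle ::
  "('s::topological_space, 'd::real_normed_vector) manifold \<Rightarrow> 'g::topological_space monoid \<Rightarrow>
   ('g, 'e::real_normed_vector) manifold \<Rightarrow> (('s \<Rightarrow> 'g) \<Rightarrow> ('s \<Rightarrow> 'g) \<Rightarrow> 's form) \<Rightarrow>
   (('s \<Rightarrow> 'g tvec) \<Rightarrow> ('s \<Rightarrow> 'g tvec) \<Rightarrow> 's form) \<Rightarrow> bool"
where
  "integrates_two_cocycle S G M c \<sigma> \<longleftrightarrow>
     (let E = (\<lambda>t u q. lie_exp G M (scale t (u q))) in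
      \<forall>u\<in>current_alg S G M. \<forall>v\<in>current_alg S G M. \<forall>q. \<forall>X\<in>tangent_space S q.
        has_mixed_derivative (\<lambda>t s. c (E t u) (E s v) q X - c (E s v) (E t u) q X) (\<sigma> u v q X))"

end

theory Submission
  imports Defs
begin

text \<open>
  Write \<open>\<delta>g = dg g\<^sup>-\<^sup>1\<close>. The product rule \<open>\<delta>(gh) = \<delta>g + Ad\<^sub>g \<delta>h\<close> (\<open>rld_mult\<close>) and the cocycle
  identity \<open>a(gh) = a(h) + a(g) \<circ> Ad\<^sub>h\<close> are made for each other: both sides of the identity for
  \<open>c(g\<^sub>1, g\<^sub>2) = a(g\<^sub>1)(\<delta>g\<^sub>2)\<close> are equal to
  \<open>a(g\<^sub>1)(\<delta>g\<^sub>2) + a(g\<^sub>2)(\<delta>g\<^sub>3) + a(g\<^sub>1)(Ad\<^bsub>g\<^sub>2\<^esub> \<delta>g\<^sub>3)\<close>.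

  On the infinitesimal side, \<open>d(\<omega>(u, v)) = \<omega>(u, dv) + \<omega>(du, v)\<close> turns \<open>\<sigma>\<^sub>N\<close> into
  \<open>\<alpha>(u)(dv) - \<alpha>(v)(du)\<close> (\<open>sigma_N_eq\<close>). With \<open>d[u, v] = [u, dv] + [du, v]\<close>, the cocycle identity of
  \<open>\<alpha>\<close> and the antisymmetry of the bracket, the terms of the cyclic sum of \<open>\<sigma>\<^sub>N([u, v], w)\<close> cancel in pairs.
  The same formula is the mixed derivative of \<open>c(e\<^bsup>tu\<^esup>, e\<^bsup>sv\<^esup>) - c(e\<^bsup>sv\<^esup>, e\<^bsup>tu\<^esup>)\<close>, because \<open>a(e\<^bsup>tu\<^esup>)\<close> has
  derivative \<open>\<alpha>(u)\<close> and \<open>\<delta>(e\<^bsup>sv\<^esup>)\<close> has derivative \<open>dv\<close> at \<open>0\<close> (\<open>rld_expc_derivative\<close>).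

  Two things give these computations a meaning. A tangent vector is an operator on functions, and
  its rules are those of the calculus of real functions along a curve: the product rule for
  \<open>f(g, h)\<close> (\<open>tangent_product_rule\<close>) and the exchange of derivatives in two variables
  (\<open>tangent_commute\<close>) become statements about one function on \<open>\<real>\<^sup>2\<close>. A chart is needed only to see
  that tangent spaces are finite-dimensional vector spaces, in which derivatives of curves stay
  (\<open>tangent_curve_derivative_in\<close>). In particular \<open>[x, y]\<close> is a tangent vector because it is the
  derivative of \<open>Ad\<^bsub>\<gamma>(t)\<^esub> y\<close> for a curve \<open>\<gamma>\<close> with velocity \<open>x\<close>.

  The exponential map has to exist and to be smooth, since a tangent vector of \<open>S\<close> can
  differentiate \<open>f(e\<^bsup>v\<^esup>)\<close> only if this function is smooth. It is obtained without differential equations, from \<open>e\<^bsup>2x\<^esup> = (e\<^bsup>x\<^esup>)\<^sup>2\<close>.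
  In a chart at the identity, squaring is a map \<open>F\<close> that fixes the origin with derivative \<open>2 id\<close>, and
  the exponential map is its linearisation \<open>h(x) = lim F\<^sup>n(x/2\<^sup>n)\<close> (\<open>doubling_map_linearisation\<close>). Its
  derivative satisfies a linear equation \<open>w(x) = B(x) w(x/2) + c(x)\<close> in which \<open>B\<close> and \<open>c\<close> are as smooth
  as \<open>h\<close>, and solutions of such an equation are as smooth as its coefficients
  (\<open>linear_equation_Ck\<close>); hence \<open>h\<close> gains one derivative after the other. Conversely, curves that
  satisfy \<open>\<gamma>(2t) = \<gamma>(t)\<^sup>2\<close> are determined by their velocity at \<open>0\<close> (\<open>squaring_curves_eq\<close>). Comparing
  \<open>e\<^bsup>ktx\<^esup>\<close> with \<open>(e\<^bsup>tx\<^esup>)\<^sup>k\<close> for integers \<open>k\<close>, this shows that \<open>t \<mapsto> e\<^bsup>tx\<^esup>\<close> is a one-parameter group, and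
  that it is the only one with velocity \<open>x\<close>.
\<close>

section \<open>Calculus of smooth functions\<close>

lemma Ck_on_subset:
  assumes "Ck_on k E U f" "U' \<subseteq> U" "E' \<subseteq> E"
  shows "Ck_on k E' U' f"
  using assms
proof (induction k arbitrary: f)
  case 0
  then show ?case by (auto intro: continuous_on_subset)
next
  case (Suc k)
  then obtain D where D: "\<forall>x\<in>U. (f has_derivative D x) (at x within U)"
    "\<forall>v\<in>E. Ck_on k E U (\<lambda>x. D x v)" by auto
  show ?case
    unfolding Ck_on.simps
    using D Suc.prems Suc.IH by (intro exI[of _ D]) (meson has_derivative_subset subsetD)
qed

lemma Ck_on_cong:
  assumes "Ck_on k E U f" "\<And>x. x \<in> U \<Longrightarrow> g x = f x"
  shows "Ck_on k E U g"
proof (cases k)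
  case 0
  then show ?thesis using assms by (simp cong: continuous_on_cong)
next
  case (Suc l)
  then obtain D where D: "\<forall>x\<in>U. (f has_derivative D x) (at x within U)"
    "\<forall>v\<in>E. Ck_on l E U (\<lambda>x. D x v)" using assms(1) by auto
  have "(g has_derivative D x) (at x within U)" if "x \<in> U" for x
    using D(1) assms(2) that by (metis has_derivative_transform)
  with D(2) show ?thesis unfolding Suc Ck_on.simps by blast
qed

lemma Ck_on_Suc_imp: "Ck_on (Suc k) E U f \<Longrightarrow> Ck_on k E U f"
proof (induction k arbitrary: f)
  case 0
  then show ?case
    by (auto simp: continuous_on_eq_continuous_within intro: has_derivative_continuous)
next
  case (Suc k)
  from Suc.prems obtain D where "\<forall>x\<in>U. (f has_derivative D x) (at x within U)"
    and D: "\<forall>v\<in>E. Ck_on (Suc k) E U (\<lambda>x. D x v)" by (metis Ck_on.simps(2))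
  moreover have "\<forall>v\<in>E. Ck_on k E U (\<lambda>x. D x v)" using D Suc.IH by blast
  ultimately show ?case unfolding Ck_on.simps by blast
qed

lemma Ck_on_le: "Ck_on k E U f \<Longrightarrow> l \<le> k \<Longrightarrow> Ck_on l E U f"
  by (induction k) (auto simp: le_Suc_eq simp del: Ck_on.simps dest: Ck_on_Suc_imp)

lemma Ck_on_imp_continuous: "Ck_on k E U f \<Longrightarrow> continuous_on U f"
  using Ck_on_le[of k E U f 0] by simp

lemma Ck_on_const [simp]: "Ck_on k E U (\<lambda>x. c)"
proof (induction k arbitrary: c)
  case (Suc k)
  show ?case unfolding Ck_on.simps
    by (intro exI[of _ "\<lambda>_ _. 0"]) (auto intro: Suc derivative_eq_intros)
qed auto

lemma Ck_on_bounded_linear: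
  assumes "bounded_linear L" "Ck_on k E U f"
  shows "Ck_on k E U (\<lambda>x. L (f x))"
  using assms(2)
proof (induction k arbitrary: f)
  case 0
  then show ?case using assms(1) by (simp add: bounded_linear.continuous_on)
next
  case (Suc k)
  then obtain D where D: "\<forall>x\<in>U. (f has_derivative D x) (at x within U)"
    "\<forall>v\<in>E. Ck_on k E U (\<lambda>x. D x v)" by auto
  show ?case unfolding Ck_on.simps
    using D Suc.IH by (intro exI[of _ "\<lambda>x v. L (D x v)"])
       (auto intro: bounded_linear.has_derivative[OF assms(1)])
qed

lemma Ck_on_add:
  assumes "Ck_on k E U f" "Ck_on k E U g"
  shows "Ck_on k E U (\<lambda>x. f x + g x)"
  using assms
proof (induction k arbitrary: f g)
  case 0
  then show ?case by (auto intro: continuous_intros)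
next
  case (Suc k)
  then obtain D D' where D: "\<forall>x\<in>U. (f has_derivative D x) (at x within U)"
    "\<forall>v\<in>E. Ck_on k E U (\<lambda>x. D x v)" "\<forall>x\<in>U. (g has_derivative D' x) (at x within U)"
    "\<forall>v\<in>E. Ck_on k E U (\<lambda>x. D' x v)" by auto
  show ?case unfolding Ck_on.simps
    using D Suc.IH by (intro exI[of _ "\<lambda>x v. D x v + D' x v"])
       (auto intro: has_derivative_add)
qed

lemma Ck_on_sum:
  assumes "\<And>i. i \<in> I \<Longrightarrow> Ck_on k E U (f i)"
  shows "Ck_on k E U (\<lambda>x. \<Sum>i\<in>I. f i x)"
  using assms by (induction I rule: infinite_finite_induct) (auto intro: Ck_on_add)

lemma Ck_on_Pair:
  assumes "Ck_on k E U f" "Ck_on k E U g"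
  shows "Ck_on k E U (\<lambda>x. (f x, g x))"
proof -
  have "Ck_on k E U (\<lambda>x. (f x, 0) + (0, g x))"
    by (intro Ck_on_add Ck_on_bounded_linear[of "\<lambda>x. (x, 0)"] Ck_on_bounded_linear[of "\<lambda>x. (0, x)"]
        assms bounded_linear_intros)
  then show ?thesis by simp
qed

lemma Ck_on_diff:
  assumes "Ck_on k E U f" "Ck_on k E U g"
  shows "Ck_on k E U (\<lambda>x. f x - g x)"
  using Ck_on_add[OF assms(1) Ck_on_bounded_linear[OF bounded_linear_minus[OF bounded_linear_ident] assms(2)]]
  by simp

lemma Ck_on_bounded_bilinear:
  assumes B: "bounded_bilinear B" and "Ck_on k E U f" "Ck_on k E U g"
  shows "Ck_on k E U (\<lambda>x. B (f x) (g x))"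
  using assms(2,3)
proof (induction k arbitrary: f g)
  case 0
  then show ?case using bounded_bilinear.continuous_on[OF B] by auto
next
  case (Suc k)
  then obtain D D' where D: "\<forall>x\<in>U. (f has_derivative D x) (at x within U)"
    "\<forall>v\<in>E. Ck_on k E U (\<lambda>x. D x v)" "\<forall>x\<in>U. (g has_derivative D' x) (at x within U)"
    "\<forall>v\<in>E. Ck_on k E U (\<lambda>x. D' x v)" by auto
  show ?case unfolding Ck_on.simps
    using D Suc.IH Suc.prems[THEN Ck_on_Suc_imp]
    by (intro exI[of _ "\<lambda>x v. B (f x) (D' x v) + B (D x v) (g x)"])
       (auto intro: bounded_bilinear.FDERIV[OF B] Ck_on_add)
qed

lemmas Ck_on_scaleR = Ck_on_bounded_bilinear[OF bounded_bilinear_scaleR]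

lemma Ck_on_ident [simp]: "Ck_on k E U (\<lambda>x. x)"
proof (cases k)
  case (Suc l)
  then show ?thesis unfolding Suc Ck_on.simps
    by (intro exI[of _ "\<lambda>x v. v"]) auto
qed auto

lemma Ck_on_linear_precomp:
  assumes L: "bounded_linear L" and f: "Ck_on k E U f" and V: "L ` V \<subseteq> U" "L ` F \<subseteq> E"
  shows "Ck_on k F V (\<lambda>x. f (L x))"
  using f
proof (induction k arbitrary: f)
  case 0
  then show ?case using V L
    by (simp add: continuous_on_compose2[of U f V L] linear_continuous_on)
next
  case (Suc k)
  then obtain D where D: "\<forall>x\<in>U. (f has_derivative D x) (at x within U)"
    "\<forall>v\<in>E. Ck_on k E U (\<lambda>x. D x v)" by auto
  have "((\<lambda>x. f (L x)) has_derivative (\<lambda>v. D (L x) (L v))) (at x within V)" if "x \<in> V" for x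
    using D(1) by (intro has_derivative_in_compose2[OF _ V(1) that bounded_linear_imp_has_derivative[OF L]]) blast
  moreover have "\<forall>v\<in>F. Ck_on k F V (\<lambda>x. D (L x) (L v))"
  proof
    fix v assume "v \<in> F"
    then have "Ck_on k E U (\<lambda>x. D x (L v))" using D(2) V(2) by blast
    then show "Ck_on k F V (\<lambda>x. D (L x) (L v))" by (rule Suc.IH)
  qed
  ultimately show ?case unfolding Ck_on.simps
    by (intro exI[of _ "\<lambda>x v. D (L x) (L v)"]) blast
qed

lemma Ck_on_Suc_open:
  assumes "open U"
  shows "Ck_on (Suc k) UNIV U f \<longleftrightarrow>
    (\<forall>x\<in>U. f differentiable (at x)) \<and> (\<forall>v. Ck_on k UNIV U (\<lambda>x. frechet_derivative f (at x) v))"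
    (is "?L \<longleftrightarrow> ?R")
proof
  assume ?L
  then obtain D where D: "\<forall>x\<in>U. (f has_derivative D x) (at x within U)"
    "\<forall>v. Ck_on k UNIV U (\<lambda>x. D x v)" by auto
  have D': "(f has_derivative D x) (at x)" if "x \<in> U" for x
    using D(1) that assms at_within_open by metis
  then have "frechet_derivative f (at x) = D x" if "x \<in> U" for x
    using that by (metis frechet_derivative_at)
  then show ?R using D' D(2) by (auto simp: differentiable_def intro: Ck_on_cong)
next
  assume ?R
  then show ?L unfolding Ck_on.simps
    by (intro exI[of _ "\<lambda>x. frechet_derivative f (at x)"])
       (auto simp: frechet_derivative_works intro: has_derivative_at_withinI)
qed

lemma Ck_on_SucI:
  assumes "\<And>x. x \<in> U \<Longrightarrow> (f has_derivative D x) (at x)" "\<And>v. Ck_on k UNIV U (\<lambda>x. D x v)"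
  shows "Ck_on (Suc k) UNIV U f"
  unfolding Ck_on.simps using assms by (blast intro: has_derivative_at_withinI)

lemma Ck_on_local:
  assumes "open U" "\<And>x. x \<in> U \<Longrightarrow> \<exists>V. open V \<and> x \<in> V \<and> Ck_on k UNIV (U \<inter> V) f"
  shows "Ck_on k UNIV U f"
  using assms(2)
proof (induction k arbitrary: f)
  case 0
  show ?case
    unfolding Ck_on.simps
  proof (rule continuous_at_imp_continuous_on, rule ballI)
    fix x assume "x \<in> U"
    then obtain V where V: "open V" "x \<in> V" "continuous_on (U \<inter> V) f" using 0 by auto
    then show "isCont f x" using assms(1) \<open>x \<in> U\<close>
      by (auto simp: continuous_on_eq_continuous_at open_Int)
  qed
next
  case (Suc k)
  have *: "\<exists>V. open V \<and> x \<in> V \<and> (\<forall>y\<in>U \<inter> V. f differentiable (at y)) \<and>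
     (\<forall>v. Ck_on k UNIV (U \<inter> V) (\<lambda>x. frechet_derivative f (at x) v))" if "x \<in> U" for x
    using Suc.prems[OF that] Ck_on_Suc_open assms(1) by (metis open_Int)
  show ?case
    unfolding Ck_on_Suc_open[OF assms(1)]
    using * by (intro conjI allI ballI Suc.IH) (blast, metis)
qed

text \<open>
  Expanding the inner derivative in the standard basis gives
  \<open>D(g \<circ> f)(x) v = \<Sum>\<^sub>b (Df(x) v \<bullet> b) (Dg(f x) b)\<close>, a sum of products of functions to which the
  induction hypothesis applies.
\<close>

lemma Ck_on_comp:
  fixes f :: "'a::real_normed_vector \<Rightarrow> 'b::euclidean_space" and g :: "'b \<Rightarrow> 'c::real_normed_vector"
  assumes U: "open U" and V: "open V"
  assumes "Ck_on k UNIV U f" "Ck_on k UNIV V g" and sub: "f ` U \<subseteq> V"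
  shows "Ck_on k UNIV U (\<lambda>x. g (f x))"
  using assms(3,4)
proof (induction k arbitrary: g)
  case 0
  then show ?case using sub by (auto intro: continuous_on_compose2)
next
  case (Suc k)
  define Df where "Df = (\<lambda>x. frechet_derivative f (at x))"
  define Dg where "Dg = (\<lambda>x. frechet_derivative g (at x))"
  have f: "(f has_derivative Df x) (at x)" "Ck_on k UNIV U (\<lambda>x. Df x v)" if "x \<in> U" for x v
    using Suc.prems(1) that unfolding Ck_on_Suc_open[OF U] Df_def
    by (auto simp: frechet_derivative_works)
  have g: "(g has_derivative Dg x) (at x)" "Ck_on k UNIV V (\<lambda>x. Dg x v)" if "x \<in> V" for x v
    using Suc.prems(2) that unfolding Ck_on_Suc_open[OF V] Dg_def
    by (auto simp: frechet_derivative_works)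
  have comp: "((\<lambda>x. g (f x)) has_derivative (\<lambda>v. Dg (f x) (Df x v))) (at x)" if "x \<in> U" for x
    using has_derivative_compose[OF f(1)[OF that], of g "Dg (f x)"] g(1) sub that by blast
  have *: "Dg (f x) (Df x v) = (\<Sum>b\<in>Basis. (Df x v \<bullet> b) *\<^sub>R Dg (f x) b)" if "x \<in> U" for x v
  proof -
    interpret linear "Dg (f x)" using g(1) sub that by (meson has_derivative_linear image_subset_iff)
    have "Dg (f x) (\<Sum>b\<in>Basis. (Df x v \<bullet> b) *\<^sub>R b) = (\<Sum>b\<in>Basis. (Df x v \<bullet> b) *\<^sub>R Dg (f x) b)"
      by (simp add: sum scaleR)
    then show ?thesis by (simp add: euclidean_representation)
  qed
  have "Ck_on k UNIV U (\<lambda>x. Dg (f x) (Df x v))" for v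
  proof (cases "U = {}")
    case True
    then show ?thesis using Ck_on_cong[OF Ck_on_const] by blast
  next
    case False
    then have VF: "V \<noteq> {}" using sub by auto
    have "Ck_on k UNIV U (\<lambda>x. \<Sum>b\<in>Basis. (Df x v \<bullet> b) *\<^sub>R Dg (f x) b)"
      using False VF f(2) g(2) Suc.prems(1) 
      by (intro Ck_on_sum Ck_on_scaleR Suc.IH Ck_on_bounded_linear[OF bounded_linear_inner_left])
         (auto simp del: Ck_on.simps dest: Ck_on_Suc_imp)
    then show ?thesis by (rule Ck_on_cong) (use * in auto)
  qed
  with comp show ?case by (rule Ck_on_SucI)
qed

lemma smooth_on_subset:
  "smooth_on E U f \<Longrightarrow> U' \<subseteq> U \<Longrightarrow> E' \<subseteq> E \<Longrightarrow> smooth_on E' U' f"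
  unfolding smooth_on_def using Ck_on_subset by blast

lemma smooth_on_cong:
  "smooth_on E U f \<Longrightarrow> (\<And>x. x \<in> U \<Longrightarrow> g x = f x) \<Longrightarrow> smooth_on E U g"
  unfolding smooth_on_def using Ck_on_cong by blast

lemma smooth_on_imp_continuous: "smooth_on E U f \<Longrightarrow> continuous_on U f"
  unfolding smooth_on_def using Ck_on_imp_continuous by blast

lemma smooth_on_const [simp]: "smooth_on E U (\<lambda>x. c)"
  and smooth_on_ident [simp]: "smooth_on E U (\<lambda>x. x)"
  unfolding smooth_on_def by auto

lemma smooth_on_local:
  assumes "open U" "\<And>x. x \<in> U \<Longrightarrow> \<exists>V. open V \<and> x \<in> V \<and> smooth_on UNIV (U \<inter> V) f"
  shows "smooth_on UNIV U f"
  using assms unfolding smooth_on_def by (metis Ck_on_local)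

lemma smooth_on_comp:
  fixes f :: "'a::real_normed_vector \<Rightarrow> 'b::euclidean_space"
  assumes "open U" "open V" "smooth_on UNIV U f" "smooth_on UNIV V g" "f ` U \<subseteq> V"
  shows "smooth_on UNIV U (\<lambda>x. g (f x))"
  using assms unfolding smooth_on_def by (metis Ck_on_comp)

lemma smooth_on_Pair:
  "smooth_on E U f \<Longrightarrow> smooth_on E U g \<Longrightarrow> smooth_on E U (\<lambda>x. (f x, g x))"
  unfolding smooth_on_def using Ck_on_Pair by blast

lemma smooth_on_bounded_linear:
  "bounded_linear L \<Longrightarrow> smooth_on E U f \<Longrightarrow> smooth_on E U (\<lambda>x. L (f x))"
  unfolding smooth_on_def using Ck_on_bounded_linear by blast

lemma smooth_on_linear:
  "bounded_linear L \<Longrightarrow> smooth_on E U L"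
  using smooth_on_bounded_linear[of L E U "\<lambda>x. x"] by simp

lemma smooth_on_add:
  "smooth_on E U f \<Longrightarrow> smooth_on E U g \<Longrightarrow> smooth_on E U (\<lambda>x. f x + g x)"
  unfolding smooth_on_def using Ck_on_add by blast

lemma smooth_on_diff:
  "smooth_on E U f \<Longrightarrow> smooth_on E U g \<Longrightarrow> smooth_on E U (\<lambda>x. f x - g x)"
  unfolding smooth_on_def using Ck_on_diff by blast

lemma smooth_on_bounded_bilinear:
  "bounded_bilinear B \<Longrightarrow> smooth_on E U f \<Longrightarrow> smooth_on E U g \<Longrightarrow> smooth_on E U (\<lambda>x. B (f x) (g x))"
  unfolding smooth_on_def using Ck_on_bounded_bilinear by blast

lemma smooth_on_linear_precomp:
  "bounded_linear L \<Longrightarrow> smooth_on E U f \<Longrightarrow> L ` V \<subseteq> U \<Longrightarrow> L ` F \<subseteq> E \<Longrightarrow>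
   smooth_on F V (\<lambda>x. f (L x))"
  unfolding smooth_on_def using Ck_on_linear_precomp[of L _ E U f V F] by blast

lemma smooth_on_has_derivative:
  assumes "open U" "smooth_on UNIV U f" "x \<in> U"
  shows "(f has_derivative frechet_derivative f (at x)) (at x)"
proof -
  have "Ck_on (Suc 0) UNIV U f" using assms(2) unfolding smooth_on_def by blast
  then show ?thesis
    using assms by (simp add: Ck_on_Suc_open frechet_derivative_works del: Ck_on.simps(2))
qed

lemma smooth_on_frechet_derivative:
  assumes "open U" "smooth_on UNIV U f"
  shows "smooth_on UNIV U (\<lambda>x. frechet_derivative f (at x) v)"
  unfolding smooth_on_def
proof
  fix k
  have "Ck_on (Suc k) UNIV U f" using assms(2) unfolding smooth_on_def by blast
  then show "Ck_on k UNIV U (\<lambda>x. frechet_derivative f (at x) v)"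
    using assms(1) by (simp add: Ck_on_Suc_open del: Ck_on.simps(2))
qed

lemma smooth_on_real_derivative:
  fixes f :: "'a::real_normed_vector \<Rightarrow> real"
  assumes "open U" "smooth_on UNIV U f" "x \<in> U" "(\<gamma> has_vector_derivative w) (at t)" "\<gamma> t = x"
  shows "((\<lambda>s. f (\<gamma> s)) has_real_derivative frechet_derivative f (at x) w) (at t)"
proof -
  have f: "(f has_derivative frechet_derivative f (at x)) (at (\<gamma> t))"
    using smooth_on_has_derivative[OF assms(1-3)] assms(5) by simp
  have "((\<lambda>s. f (\<gamma> s)) has_derivative (\<lambda>s. frechet_derivative f (at x) (s *\<^sub>R w))) (at t)"
    using assms(4) f unfolding has_vector_derivative_def
    by (rule has_derivative_compose[where g = f])
  moreover have "frechet_derivative f (at x) (s *\<^sub>R w) = frechet_derivative f (at x) w * s" for s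
    using linear_cmul[OF has_derivative_linear[OF f]] by simp
  ultimately show ?thesis by (simp add: has_field_derivative_def)
qed

subsection \<open>Equality of mixed partial derivatives\<close>

lemma mixed_difference_quotient:
  fixes F :: "real \<Rightarrow> real \<Rightarrow> real"
  assumes h: "0 < h"
    and dF: "\<And>s r. \<bar>s\<bar> \<le> h \<Longrightarrow> \<bar>r\<bar> \<le> h \<Longrightarrow> ((\<lambda>s. F s r) has_real_derivative F1 s r) (at s)"
    and dF1: "\<And>s r. \<bar>s\<bar> \<le> h \<Longrightarrow> \<bar>r\<bar> \<le> h \<Longrightarrow> ((\<lambda>r. F1 s r) has_real_derivative F12 s r) (at r)"
  shows "\<exists>s r. 0 < s \<and> s < h \<and> 0 < r \<and> r < h \<and> F h h - F h 0 - F 0 h + F 0 0 = h * h * F12 s r"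
proof -
  have "\<exists>s. s > 0 \<and> s < h \<and> (F h h - F h 0) - (F 0 h - F 0 0) = (h - 0) * (F1 s h - F1 s 0)"
    by (rule MVT2[OF h]) (use h in \<open>auto intro!: derivative_eq_intros dF\<close>)
  then obtain s where s: "s > 0" "s < h" "(F h h - F h 0) - (F 0 h - F 0 0) = h * (F1 s h - F1 s 0)"
    by auto
  have "\<exists>r. r > 0 \<and> r < h \<and> F1 s h - F1 s 0 = (h - 0) * F12 s r"
    by (rule MVT2[OF h]) (use h s in \<open>auto intro!: dF1\<close>)
  then obtain r where r: "r > 0" "r < h" "F1 s h - F1 s 0 = h * F12 s r" by auto
  show ?thesis using s r by (intro exI[of _ s] exI[of _ r]) (auto simp: algebra_simps)
qed

text \<open>Both mixed derivatives are limits of the same second difference quotient over small squares.\<close>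

lemma mixed_partials_eq:
  fixes F :: "real \<times> real \<Rightarrow> real"
  assumes U: "open U" "(0, 0) \<in> U" and F: "smooth_on UNIV U F"
  defines "D \<equiv> \<lambda>f v z. frechet_derivative f (at z) v"
  shows "D (D F (1, 0)) (0, 1) (0, 0) = D (D F (0, 1)) (1, 0) (0, 0)"
proof -
  define A where "A = D (D F (1, 0)) (0, 1)"
  define B where "B = D (D F (0, 1)) (1, 0)"
  have sm: "smooth_on UNIV U (D F v)" for v
    unfolding D_def by (rule smooth_on_frechet_derivative[OF U(1) F])
  have smA: "smooth_on UNIV U A" and smB: "smooth_on UNIV U B"
    unfolding A_def B_def by (subst D_def, rule smooth_on_frechet_derivative[OF U(1) sm])+
  have dfst: "((\<lambda>s. f (s, r)) has_real_derivative D f (1, 0) (s, r)) (at s)"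
    if "smooth_on UNIV U f" "(s, r) \<in> U" for f s r
    unfolding D_def
    by (rule smooth_on_real_derivative[OF U(1) that])
       (use has_vector_derivative_Pair[OF has_vector_derivative_id has_vector_derivative_const] in auto)
  have dsnd: "((\<lambda>r. f (s, r)) has_real_derivative D f (0, 1) (s, r)) (at r)"
    if "smooth_on UNIV U f" "(s, r) \<in> U" for f s r
    unfolding D_def
    by (rule smooth_on_real_derivative[OF U(1) that])
       (use has_vector_derivative_Pair[OF has_vector_derivative_const has_vector_derivative_id] in auto)
  have "A (0, 0) = B (0, 0)"
  proof (rule ccontr)
    assume ne: "A (0, 0) \<noteq> B (0, 0)"
    define e where "e = \<bar>A (0, 0) - B (0, 0)\<bar> / 2"
    have e: "e > 0" using ne by (simp add: e_def)
    have cont: "isCont A (0, 0)" "isCont B (0, 0)"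
      using smA smB U smooth_on_imp_continuous continuous_on_eq_continuous_at by blast+
    obtain d1 where d1: "d1 > 0" "\<And>z. dist z (0, 0) < d1 \<Longrightarrow> dist (A z) (A (0, 0)) < e"
      using cont(1) e unfolding continuous_at_eps_delta by blast
    obtain d2 where d2: "d2 > 0" "\<And>z. dist z (0, 0) < d2 \<Longrightarrow> dist (B z) (B (0, 0)) < e"
      using cont(2) e unfolding continuous_at_eps_delta by blast
    obtain d3 where d3: "d3 > 0" "\<And>z. dist z (0, 0) < d3 \<Longrightarrow> z \<in> U"
      using U by (metis open_dist)
    define h where "h = min d1 (min d2 d3) / 4"
    have h: "h > 0" using d1(1) d2(1) d3(1) by (simp add: h_def)
    have small: "dist (s, r) (0, 0) < min d1 (min d2 d3)" if "\<bar>s\<bar> \<le> h" "\<bar>r\<bar> \<le> h" for s r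
    proof -
      have "dist (s, r) (0, 0) \<le> \<bar>s\<bar> + \<bar>r\<bar>"
        by (simp add: dist_prod_def dist_real_def sqrt_sum_squares_le_sum_abs)
      also have "\<dots> \<le> 2 * h" using that by simp
      also have "\<dots> < min d1 (min d2 d3)" using d1(1) d2(1) d3(1) unfolding h_def by linarith
      finally show ?thesis .
    qed
    have inU: "(s, r) \<in> U" if "\<bar>s\<bar> \<le> h" "\<bar>r\<bar> \<le> h" for s r
      using d3(2) small[OF that] by simp
    have "\<exists>s r. 0 < s \<and> s < h \<and> 0 < r \<and> r < h \<and>
        F (h, h) - F (h, 0) - F (0, h) + F (0, 0) = h * h * A (s, r)"
      by (rule mixed_difference_quotient[OF h, where ?F1.0 = "\<lambda>s r. D F (1, 0) (s, r)"
            and ?F = "\<lambda>s r. F (s, r)" and ?F12.0 = "\<lambda>s r. A (s, r)"])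
         (auto simp: A_def intro: dfst[OF F inU] dsnd[OF sm inU])
    then obtain s r where sr: "0 < s" "s < h" "0 < r" "r < h"
      "F (h, h) - F (h, 0) - F (0, h) + F (0, 0) = h * h * A (s, r)" by blast
    have "\<exists>s r. 0 < s \<and> s < h \<and> 0 < r \<and> r < h \<and>
        F (h, h) - F (0, h) - F (h, 0) + F (0, 0) = h * h * B (r, s)"
      by (rule mixed_difference_quotient[OF h, where ?F1.0 = "\<lambda>s r. D F (0, 1) (r, s)"
            and ?F = "\<lambda>s r. F (r, s)" and ?F12.0 = "\<lambda>s r. B (r, s)"])
         (auto simp: B_def intro: dsnd[OF F inU] dfst[OF sm inU])
    then obtain s' r' where sr': "0 < s'" "s' < h" "0 < r'" "r' < h"
      "F (h, h) - F (0, h) - F (h, 0) + F (0, 0) = h * h * B (r', s')" by blast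
    have "h * h * A (s, r) = h * h * B (r', s')" using sr(5) sr'(5) by linarith
    then have "A (s, r) = B (r', s')" using h by simp
    moreover have "dist (A (s, r)) (A (0, 0)) < e" using small[of s r] sr by (intro d1(2)) auto
    moreover have "dist (B (r', s')) (B (0, 0)) < e" using small[of r' s'] sr' by (intro d2(2)) auto
    ultimately have "dist (A (0, 0)) (B (0, 0)) < 2 * e"
      by (metis dist_triangle_half_r nonzero_mult_div_cancel_left zero_neq_numeral)
    then show False unfolding e_def dist_real_def by simp
  qed
  then show ?thesis unfolding A_def B_def .
qed

subsection \<open>Reduction of relatively open sets to open sets\<close>

text \<open>
  Composition with a linear projection onto \<open>E\<close> makes a function on a relatively open subset of \<open>E\<close>
  into one on an open set, where derivatives are unique.
\<close>

definition proj :: "'e::euclidean_space set \<Rightarrow> 'e \<Rightarrow> 'e" where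
  "proj E = (SOME P. linear P \<and> range P \<subseteq> E \<and> (\<forall>v\<in>E. P v = v))"

lemma
  assumes "subspace E"
  shows linear_proj: "linear (proj E)" and proj_in: "proj E x \<in> E"
    and proj_id: "v \<in> E \<Longrightarrow> proj E v = v"
proof -
  have "\<exists>P. range P \<subseteq> E \<and> linear P \<and> (\<forall>v\<in>E. P (id v) = v)"
    using linear_exists_left_inverse_on[of id E] assms linear_id by auto
  then have "\<exists>P. linear P \<and> range P \<subseteq> E \<and> (\<forall>v\<in>E. P v = v)" by auto
  from someI_ex[OF this, folded proj_def]
  show "linear (proj E)" "proj E x \<in> E" "v \<in> E \<Longrightarrow> proj E v = v" by auto
qed

lemma proj_UNIV [simp]: "proj UNIV = (\<lambda>x. x)"
  using proj_id[of UNIV] by auto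

lemma bounded_linear_proj: "subspace E \<Longrightarrow> bounded_linear (proj E)"
  using linear_proj linear_conv_bounded_linear by blast

lemma smooth_on_proj:
  assumes E: "subspace E" and U: "U \<subseteq> E"
  shows "smooth_on E U f \<longleftrightarrow> smooth_on UNIV (proj E -` U) (\<lambda>x. f (proj E x))"
proof
  assume "smooth_on E U f"
  then show "smooth_on UNIV (proj E -` U) (\<lambda>x. f (proj E x))"
    by (rule smooth_on_linear_precomp[OF bounded_linear_proj[OF E]]) (auto simp: proj_in[OF E])
next
  assume "smooth_on UNIV (proj E -` U) (\<lambda>x. f (proj E x))"
  then have "smooth_on E U (\<lambda>x. f (proj E x))"
    by (rule smooth_on_subset) (use U proj_id[OF E] in auto)
  then show "smooth_on E U f" by (rule smooth_on_cong) (use U proj_id[OF E] in auto)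
qed

section \<open>Linearisation of a map with derivative two\<close>

lemma geometric_Cauchy_limit:
  fixes a :: "nat \<Rightarrow> 'a::banach"
  assumes step: "\<And>n. norm (a (Suc n) - a n) \<le> C * p ^ n" and p: "0 \<le> p" "p < 1"
  shows "\<exists>l. a \<longlonglongrightarrow> l \<and> (\<forall>n. norm (a n - l) \<le> C * p ^ n / (1 - p))"
proof -
  have tail: "norm (a (n + k) - a n) \<le> C * p ^ n * (\<Sum>i<k. p ^ i)" for n k
  proof (induction k)
    case (Suc k)
    have "norm (a (n + Suc k) - a n) \<le> norm (a (Suc (n + k)) - a (n + k)) + norm (a (n + k) - a n)"
      using norm_triangle_ineq[of "a (Suc (n + k)) - a (n + k)" "a (n + k) - a n"] by simp
    also have "\<dots> \<le> C * p ^ (n + k) + C * p ^ n * (\<Sum>i<k. p ^ i)"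
      using step[of "n + k"] Suc by linarith
    finally show ?case by (simp add: power_add algebra_simps)
  qed simp
  have "C \<ge> 0" using order_trans[OF norm_ge_zero step[of 0]] by simp
  have tail': "norm (a (n + k) - a n) \<le> C * p ^ n / (1 - p)" for n k
  proof -
    have "(\<Sum>i<k. p ^ i) \<le> 1 / (1 - p)"
      using sum_le_suminf[of "\<lambda>i. p ^ i" "{..<k}"] suminf_geometric[of p] summable_geometric[of p] p by simp
    then have "C * p ^ n * (\<Sum>i<k. p ^ i) \<le> C * p ^ n * (1 / (1 - p))"
      using \<open>C \<ge> 0\<close> p by (intro mult_left_mono) auto
    then show ?thesis using tail[of n k] by simp
  qed
  have "(\<lambda>n. C * p ^ n / (1 - p)) \<longlonglongrightarrow> C * 0 / (1 - p)"
    by (intro tendsto_intros) (use p in auto)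
  then have lim0: "(\<lambda>n. C * p ^ n / (1 - p)) \<longlonglongrightarrow> 0" by simp
  have "Cauchy a"
  proof (unfold Cauchy_altdef, intro allI impI)
    fix e :: real assume "e > 0"
    then obtain N where N: "C * p ^ N / (1 - p) < e / 2"
      using order_tendstoD(2)[OF lim0, of "e / 2"] by (auto simp: eventually_sequentially)
    show "\<exists>M. \<forall>m\<ge>M. \<forall>n>m. dist (a m) (a n) < e"
    proof (intro exI allI impI)
      fix m n assume mn: "m \<ge> N" "m < n"
      have "norm (a m - a N) \<le> C * p ^ N / (1 - p)" using tail'[of N "m - N"] mn by simp
      moreover have "norm (a n - a N) \<le> C * p ^ N / (1 - p)" using tail'[of N "n - N"] mn by simp
      ultimately show "dist (a m) (a n) < e" unfolding dist_norm
        using N norm_triangle_ineq4[of "a m - a N" "a n - a N", simplified] by linarith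
    qed
  qed
  then obtain l where l: "a \<longlonglongrightarrow> l" using Cauchy_convergent convergent_def by blast
  have "norm (a n - l) \<le> C * p ^ n / (1 - p)" for n
  proof (rule tendsto_upperbound[OF _ _ trivial_limit_sequentially])
    have "(\<lambda>k. a (n + k)) \<longlonglongrightarrow> l"
      using LIMSEQ_ignore_initial_segment[OF l, of n] by (simp add: add.commute)
    then show "(\<lambda>k. norm (a n - a (n + k))) \<longlonglongrightarrow> norm (a n - l)"
      by (intro tendsto_intros)
    show "\<forall>\<^sub>F k in sequentially. norm (a n - a (n + k)) \<le> C * p ^ n / (1 - p)"
      using tail' by (simp add: norm_minus_commute)
  qed
  with l show ?thesis by blast
qed

text \<open>
  This serves iterations whose increments contract: the geometric rate makes values and derivatives
  uniformly Cauchy, so that limit and differentiation can be exchanged.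
\<close>

lemma C1_limit:
  fixes f :: "nat \<Rightarrow> 'a::real_normed_vector \<Rightarrow> 'b::banach"
  assumes r: "r > 0"
    and df: "\<And>n x. x \<in> ball 0 r \<Longrightarrow> (f n has_derivative f' n x) (at x)"
    and cont: "\<And>n u. continuous_on (ball 0 r) (\<lambda>x. f' n x u)"
    and step: "\<And>n x. x \<in> ball 0 r \<Longrightarrow> norm (f (Suc n) x - f n x) \<le> C * p ^ n"
    and step': "\<And>n x u. x \<in> ball 0 r \<Longrightarrow> norm (f' (Suc n) x u - f' n x u) \<le> C * p ^ n * norm u"
    and p: "0 \<le> p" "p < 1"
  obtains g g' where "\<And>x. x \<in> ball 0 r \<Longrightarrow> (g has_derivative g' x) (at x)"
    "\<And>x. x \<in> ball 0 r \<Longrightarrow> (\<lambda>n. f n x) \<longlonglongrightarrow> g x"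
    "\<And>x u. x \<in> ball 0 r \<Longrightarrow> (\<lambda>n. f' n x u) \<longlonglongrightarrow> g' x u"
    "\<And>u. continuous_on (ball 0 r) (\<lambda>x. g' x u)"
proof -
  have "\<exists>l. (\<lambda>n. f' n x u) \<longlonglongrightarrow> l \<and> (\<forall>n. norm (f' n x u - l) \<le> C * norm u * p ^ n / (1 - p))"
    if "x \<in> ball 0 r" for x u
    by (rule geometric_Cauchy_limit[OF _ p]) (use step'[OF that] in \<open>simp add: mult_ac\<close>)
  then obtain g' where g': "\<And>x u. x \<in> ball 0 r \<Longrightarrow> (\<lambda>n. f' n x u) \<longlonglongrightarrow> g' x u"
    and g'b: "\<And>x u n. x \<in> ball 0 r \<Longrightarrow> norm (f' n x u - g' x u) \<le> C * norm u * p ^ n / (1 - p)"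
    by metis
  have 0: "0 \<in> ball (0::'a) r" using r by simp
  have "(\<lambda>n. C * p ^ n / (1 - p)) \<longlonglongrightarrow> C * 0 / (1 - p)"
    by (intro tendsto_intros) (use p in auto)
  then have lim0: "(\<lambda>n. C * p ^ n / (1 - p)) \<longlonglongrightarrow> 0" by simp
  have ev: "\<forall>\<^sub>F n in sequentially. \<forall>x\<in>ball 0 r. \<forall>u. norm (f' n x u - g' x u) \<le> e * norm u" if "e > 0" for e
  proof -
    have "\<forall>\<^sub>F n in sequentially. C * p ^ n / (1 - p) < e"
      using order_tendstoD(2)[OF lim0 that] .
    then show ?thesis
    proof (rule eventually_mono, intro ballI allI)
      fix n x and u :: 'a assume *: "C * p ^ n / (1 - p) < e" "x \<in> ball (0::'a) r"
      have "C * norm u * p ^ n / (1 - p) = (C * p ^ n / (1 - p)) * norm u" by simp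
      also have "\<dots> \<le> e * norm u" using * by (intro mult_right_mono) auto
      finally show "norm (f' n x u - g' x u) \<le> e * norm u" using g'b[OF *(2), of n u] by linarith
    qed
  qed
  obtain l where l: "(\<lambda>n. f n 0) \<longlonglongrightarrow> l"
    using geometric_Cauchy_limit[OF step[OF 0] p] by blast
  have "\<exists>g. \<forall>x\<in>ball 0 r. (\<lambda>n. f n x) \<longlonglongrightarrow> g x \<and> (g has_derivative g' x) (at x within ball 0 r)"
    by (rule has_derivative_sequence[where f = f and f' = f', OF convex_ball _ ev 0 l]) (use df in \<open>auto intro: has_derivative_at_withinI\<close>)
  then obtain g where g: "\<And>x. x \<in> ball 0 r \<Longrightarrow> (\<lambda>n. f n x) \<longlonglongrightarrow> g x"
    "\<And>x. x \<in> ball 0 r \<Longrightarrow> (g has_derivative g' x) (at x)"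
    by (metis at_within_open open_ball)
  have "continuous_on (ball 0 r) (\<lambda>x. g' x u)" for u
  proof (rule uniform_limit_theorem[OF _ _ trivial_limit_sequentially])
    show "\<forall>\<^sub>F n in sequentially. continuous_on (ball 0 r) (\<lambda>x. f' n x u)" using cont by simp
    show "uniform_limit (ball 0 r) (\<lambda>n x. f' n x u) (\<lambda>x. g' x u) sequentially"
    proof (rule uniform_limitI)
      fix e :: real assume e: "e > 0"
      have "e / (norm u + 1) > 0" using e by (simp add: add_nonneg_pos)
      from ev[OF this] show "\<forall>\<^sub>F n in sequentially. \<forall>x\<in>ball 0 r. dist (f' n x u) (g' x u) < e"
      proof (rule eventually_mono, intro ballI)
        fix n x assume *: "\<forall>x\<in>ball 0 r. \<forall>v. norm (f' n x v - g' x v) \<le> e / (norm u + 1) * norm v"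
          "x \<in> ball (0::'a) r"
        have "norm u + 1 > 0" by (simp add: add_nonneg_pos)
        then have "e / (norm u + 1) * norm u < e" using e by (simp add: pos_divide_less_eq)
        moreover have "norm (f' n x u - g' x u) \<le> e / (norm u + 1) * norm u" using * by blast
        ultimately show "dist (f' n x u) (g' x u) < e" unfolding dist_norm by linarith
      qed
    qed
  qed
  with g g' show ?thesis using that by blast
qed

lemma Ck_Suc_bounded_derivative:
  fixes f :: "'a::euclidean_space \<Rightarrow> 'b::real_normed_vector"
  assumes W: "open W" and f: "Ck_on (Suc k) UNIV W f" and C: "compact C" "C \<subseteq> W"
  obtains L where "L \<ge> 0" "\<And>x v. x \<in> C \<Longrightarrow> norm (frechet_derivative f (at x) v) \<le> L * norm v"
proof -
  define D where "D = (\<lambda>x. frechet_derivative f (at x))"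
  have f1: "Ck_on 1 UNIV W f" by (rule Ck_on_le[OF f]) simp
  then have Dc: "continuous_on W (\<lambda>x. D x v)" and Dl: "x \<in> W \<Longrightarrow> linear (D x)" for x v
    unfolding One_nat_def Ck_on_Suc_open[OF W] D_def Ck_on.simps(1) frechet_derivative_works
    by (auto dest: has_derivative_linear)
  have "\<exists>M. \<forall>x\<in>C. norm (D x b) \<le> M" for b
    using compact_imp_bounded[OF compact_continuous_image[OF continuous_on_subset[OF Dc C(2)] C(1)]]
    unfolding bounded_iff by auto
  then obtain M where M: "\<And>b x. x \<in> C \<Longrightarrow> norm (D x b) \<le> M b" by metis
  have "norm (D x v) \<le> (\<Sum>b\<in>Basis. \<bar>M b\<bar>) * norm v" if "x \<in> C" for x v
  proof -
    interpret linear "D x" using Dl C that by blast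
    have "D x v = D x (\<Sum>b\<in>Basis. (v \<bullet> b) *\<^sub>R b)" by (simp add: euclidean_representation)
    also have "\<dots> = (\<Sum>b\<in>Basis. (v \<bullet> b) *\<^sub>R D x b)" by (simp add: sum scaleR)
    also have "norm \<dots> \<le> (\<Sum>b\<in>Basis. norm v * \<bar>M b\<bar>)"
    proof (rule sum_norm_le)
      fix b :: 'a assume "b \<in> Basis"
      then show "norm ((v \<bullet> b) *\<^sub>R D x b) \<le> norm v * \<bar>M b\<bar>"
        using M[OF that, of b] by (auto intro!: mult_mono simp: Basis_le_norm)
    qed
    finally show ?thesis by (simp add: sum_distrib_left mult.commute)
  qed
  then show ?thesis using that[of "\<Sum>b\<in>Basis. \<bar>M b\<bar>"] unfolding D_def by (auto simp: sum_nonneg)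
qed

text \<open>
  On a smaller ball continuous functions are bounded, by compactness.
\<close>

lemma Ck_ball_shrink:
  assumes "\<And>r'. 0 < r' \<Longrightarrow> r' < r \<Longrightarrow> Ck_on k UNIV (ball 0 r') f"
  shows "Ck_on k UNIV (ball 0 r) f"
proof (rule Ck_on_local[OF open_ball])
  fix x :: 'a assume x: "x \<in> ball 0 r"
  then obtain r' where r': "norm x < r'" "r' < r" using dense[of "norm x" r] by auto
  then have "0 < r'" using norm_ge_zero[of x] by linarith
  moreover have "ball 0 r \<inter> ball 0 r' = ball (0::'a) r'" using r' by auto
  ultimately show "\<exists>V. open V \<and> x \<in> V \<and> Ck_on k UNIV (ball 0 r \<inter> V) f"
    using r' assms[of r'] by (intro exI[of _ "ball 0 r'"]) auto
qed

lemma has_derivative_half: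
  fixes f :: "'a::real_normed_vector \<Rightarrow> 'b::real_normed_vector"
  assumes "(f has_derivative f') (at (x /\<^sub>R 2))"
  shows "((\<lambda>x. f (x /\<^sub>R 2)) has_derivative (\<lambda>u. f' (u /\<^sub>R 2))) (at x)"
  by (rule has_derivative_compose[where f = "\<lambda>x. x /\<^sub>R 2" and g = f, OF _ assms])
     (auto intro: derivative_intros)

lemma half_in_ball:
  fixes x :: "'a::real_normed_vector"
  assumes "x \<in> ball 0 r"
  shows "x /\<^sub>R 2 \<in> ball 0 r"
proof -
  have "norm x < r" using assms by simp
  then have "norm x / 2 < r" using norm_ge_zero[of x] by linarith
  then show ?thesis by simp
qed

lemma continuous_on_half:
  fixes f :: "'a::real_normed_vector \<Rightarrow> 'b::topological_space"
  assumes "continuous_on (ball 0 r) f"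
  shows "continuous_on (ball 0 r) (\<lambda>x. f (x /\<^sub>R 2))"
proof (rule continuous_on_compose2[OF assms])
  show "continuous_on (ball 0 r) (\<lambda>x::'a. x /\<^sub>R 2)" by (intro continuous_intros)
qed (use half_in_ball in blast)

lemma Ck_on_half:
  fixes f :: "'a::real_normed_vector \<Rightarrow> 'b::real_normed_vector"
  assumes "Ck_on k UNIV (ball 0 r) f"
  shows "Ck_on k UNIV (ball 0 r) (\<lambda>x. f (x /\<^sub>R 2))"
  by (rule Ck_on_linear_precomp[where f = f and L = "\<lambda>x. x /\<^sub>R 2", OF _ assms])
     (use half_in_ball in \<open>blast intro: bounded_linear_scaleR_right\<close>)+

text \<open>
  The solution is the limit of \<open>f\<^sub>n\<^sub>+\<^sub>1(x) = B(x) f\<^sub>n(x/2) + c(x)\<close>, \<open>f\<^sub>0 = 0\<close>. The weight \<open>\<rho>\<close> makes this a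
  contraction in two situations: \<open>\<rho> = 1\<close> if \<open>B\<close> has norm at most \<open>3/4\<close>, and \<open>\<rho>(x) = \<bar>x\<bar>\<close> if the norm
  is only at most \<open>3/2\<close>, where the halved argument contributes the missing factor. In the derivative
  of the iteration the chain rule contributes a factor \<open>1/2\<close> in either case.
\<close>

lemma linear_equation_C1:
  fixes B :: "'a::real_normed_vector \<Rightarrow> 'b::banach \<Rightarrow>\<^sub>L 'b" and c w :: "'a \<Rightarrow> 'b"
  assumes r: "r > 0"
    and dB: "\<And>x. x \<in> ball 0 r \<Longrightarrow> (B has_derivative DB x) (at x)"
    and dc: "\<And>x. x \<in> ball 0 r \<Longrightarrow> (c has_derivative Dc x) (at x)"
    and cB: "\<And>u. continuous_on (ball 0 r) (\<lambda>x. DB x u)"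
    and cc: "\<And>u. continuous_on (ball 0 r) (\<lambda>x. Dc x u)"
    and bB: "\<And>x u. x \<in> ball 0 r \<Longrightarrow> norm (DB x u) \<le> M * norm u"
    and bc: "\<And>x u. x \<in> ball 0 r \<Longrightarrow> norm (Dc x u) \<le> M * norm u"
    and B: "\<And>x. x \<in> ball 0 r \<Longrightarrow> norm (B x) \<le> 3/2"
    and B\<rho>: "\<And>x. x \<in> ball 0 r \<Longrightarrow> norm (B x) * \<rho> (x /\<^sub>R 2) \<le> 3/4 * \<rho> x"
    and \<rho>: "\<And>x. x \<in> ball 0 r \<Longrightarrow> 0 \<le> \<rho> x \<and> \<rho> x \<le> 1"
    and c: "\<And>x. x \<in> ball 0 r \<Longrightarrow> norm (c x) \<le> M * \<rho> x"
    and w: "\<And>x. x \<in> ball 0 r \<Longrightarrow> norm (w x) \<le> M * \<rho> x"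
    and eq: "\<And>x. x \<in> ball 0 r \<Longrightarrow> w x = B x (w (x /\<^sub>R 2)) + c x"
    and M: "M \<ge> 0"
  shows "Ck_on 1 UNIV (ball 0 r) w"
proof -
  define f where "f = rec_nat (\<lambda>x. 0) (\<lambda>n g x. B x (g (x /\<^sub>R 2)) + c x)"
  have f0: "f 0 = (\<lambda>x. 0)" and fS: "f (Suc n) = (\<lambda>x. B x (f n (x /\<^sub>R 2)) + c x)" for n
    by (auto simp: f_def)
  define f' where "f' = rec_nat (\<lambda>x u. 0) (\<lambda>n g x u. B x (g (x /\<^sub>R 2) (u /\<^sub>R 2)) + DB x u (f n (x /\<^sub>R 2)) + Dc x u)"
  have f'0: "f' 0 = (\<lambda>x u. 0)"
    and f'S: "f' (Suc n) = (\<lambda>x u. B x (f' n (x /\<^sub>R 2) (u /\<^sub>R 2)) + DB x u (f n (x /\<^sub>R 2)) + Dc x u)" for n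
    by (auto simp: f'_def)
  have Bstep: "norm (B x z) \<le> K * (3/4 * \<rho> x)" if "x \<in> ball 0 r" "norm z \<le> K * \<rho> (x /\<^sub>R 2)" "K \<ge> 0" for x z K
  proof -
    have "norm (B x z) \<le> norm (B x) * (K * \<rho> (x /\<^sub>R 2))"
      using norm_blinfun[of "B x" z] that mult_left_mono[OF that(2) norm_ge_zero[of "B x"]] by linarith
    also have "\<dots> = K * (norm (B x) * \<rho> (x /\<^sub>R 2))" by simp
    also have "\<dots> \<le> K * (3/4 * \<rho> x)" using B\<rho>[OF that(1)] that(3) by (rule mult_left_mono)
    finally show ?thesis .
  qed
  have step: "norm (f (Suc n) x - f n x) \<le> M * (3/4) ^ n * \<rho> x" if "x \<in> ball 0 r" for n x
    using that
  proof (induction n arbitrary: x)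
    case 0
    then show ?case using c by (simp add: f0 fS)
  next
    case (Suc n)
    have "norm (f (Suc (Suc n)) x - f (Suc n) x) = norm (B x (f (Suc n) (x /\<^sub>R 2) - f n (x /\<^sub>R 2)))"
      by (simp add: fS[of "Suc n"] fS[of n] blinfun.diff_right)
    also have "\<dots> \<le> (M * (3/4) ^ n) * (3/4 * \<rho> x)"
      using Suc.IH[OF half_in_ball[OF Suc.prems]] Suc.prems M by (intro Bstep) auto
    finally show ?case by simp
  qed
  have near: "norm (f n x - w x) \<le> M * (3/4) ^ n * \<rho> x" if "x \<in> ball 0 r" for n x
    using that
  proof (induction n arbitrary: x)
    case 0
    then show ?case using w by (simp add: f0)
  next
    case (Suc n)
    have "norm (f (Suc n) x - w x) = norm (B x (f n (x /\<^sub>R 2) - w (x /\<^sub>R 2)))"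
      by (simp add: fS[of n] eq[OF Suc.prems] blinfun.diff_right)
    also have "\<dots> \<le> (M * (3/4) ^ n) * (3/4 * \<rho> x)"
      using Suc.IH[OF half_in_ball[OF Suc.prems]] Suc.prems M by (intro Bstep) auto
    finally show ?case by simp
  qed
  have le\<rho>: "a * (3/4) ^ n * \<rho> x \<le> a * (3/4) ^ n" if "x \<in> ball 0 r" "a \<ge> 0" for a n x
    using \<rho>[OF that(1)] that(2) by (simp add: mult_left_le)
  have df: "(f n has_derivative f' n x) (at x)" if "x \<in> ball 0 r" for n x
    using that
  proof (induction n arbitrary: x)
    case (Suc n)
    have "((\<lambda>x. B x (f n (x /\<^sub>R 2))) has_derivative
        (\<lambda>u. B x (f' n (x /\<^sub>R 2) (u /\<^sub>R 2)) + DB x u (f n (x /\<^sub>R 2)))) (at x)"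
      by (rule bounded_bilinear.FDERIV[OF bounded_bilinear_blinfun_apply dB[OF Suc.prems]
            has_derivative_half[OF Suc.IH[OF half_in_ball[OF Suc.prems]]]])
    from has_derivative_add[OF this dc[OF Suc.prems]] show ?case by (simp add: fS f'S)
  qed (simp add: f0 f'0)
  have cf: "continuous_on (ball 0 r) (f n)" for n
    using df by (intro continuous_at_imp_continuous_on ballI has_derivative_continuous) blast
  have cB0: "continuous_on (ball 0 r) B"
    using dB by (intro continuous_at_imp_continuous_on ballI has_derivative_continuous) blast
  have cf': "continuous_on (ball 0 r) (\<lambda>x. f' n x u)" for n u
  proof (induction n arbitrary: u)
    case (Suc n)
    show ?case unfolding f'S
      by (intro continuous_intros cB0 cB cc continuous_on_half[OF cf] continuous_on_half[OF Suc])
  qed (simp add: f'0)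
  \<comment> \<open>The derivatives are taken to converge at the rate \<open>7/8\<close>, so that the gap \<open>7/8 - 3/4 = 1/8\<close> absorbs the term \<open>M\<^sup>2 (3/4)\<^sup>n\<close> from the error of \<open>f\<^sub>n\<close>.\<close>
  define C where "C = 8 * M * M + M"
  have C: "C \<ge> 0" "M \<le> C" "M * M \<le> C / 8" using M by (auto simp: C_def)
  have pow: "(3/4) ^ n \<le> ((7/8) ^ n :: real)" for n by (intro power_mono) auto
  have step': "norm (f' (Suc n) x u - f' n x u) \<le> C * (7/8) ^ n * norm u" if "x \<in> ball 0 r" for n x u
    using that
  proof (induction n arbitrary: x u)
    case 0
    then show ?case using bc[of x u] C(2) mult_right_mono[OF C(2) norm_ge_zero[of u]]
      by (simp add: f0 f'0 f'S)
  next
    case (Suc n)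
    let ?y = "x /\<^sub>R 2" and ?v = "u /\<^sub>R 2"
    have y: "?y \<in> ball 0 r" using Suc.prems by (rule half_in_ball)
    have "f' (Suc (Suc n)) x u - f' (Suc n) x u
        = B x (f' (Suc n) ?y ?v - f' n ?y ?v) + DB x u (f (Suc n) ?y - f n ?y)"
      by (simp add: f'S[of "Suc n"] f'S[of n] blinfun.diff_right)
    also have "norm \<dots> \<le> norm (B x) * norm (f' (Suc n) ?y ?v - f' n ?y ?v)
        + norm (DB x u) * norm (f (Suc n) ?y - f n ?y)"
      by (intro norm_triangle_mono norm_blinfun)
    also have "\<dots> \<le> 3/2 * (C * (7/8) ^ n * norm ?v) + (M * norm u) * (M * (3/4) ^ n)"
      using B[OF Suc.prems] Suc.IH[OF y, of ?v] bB[OF Suc.prems, of u] step[OF y, of n] le\<rho>[OF y M, of n] M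
      by (intro add_mono mult_mono) auto
    also have "\<dots> = (3/4 * C * (7/8) ^ n + M * M * (3/4) ^ n) * norm u" by (simp add: algebra_simps)
    also have "\<dots> \<le> (3/4 * C * (7/8) ^ n + C / 8 * (7/8) ^ n) * norm u"
      using C pow[of n] M by (intro mult_right_mono add_left_mono mult_mono) auto
    finally show ?case by (simp add: algebra_simps)
  qed
  have step2: "norm (f (Suc n) x - f n x) \<le> C * (7/8) ^ n" if "x \<in> ball 0 r" for n x
  proof -
    have "M * (3/4) ^ n \<le> C * (7/8) ^ n" using C pow[of n] M by (intro mult_mono) auto
    then show ?thesis using step[OF that, of n] le\<rho>[OF that M, of n] by linarith
  qed
  obtain g g' where g: "\<And>x. x \<in> ball 0 r \<Longrightarrow> (g has_derivative g' x) (at x)"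
    "\<And>x. x \<in> ball 0 r \<Longrightarrow> (\<lambda>n. f n x) \<longlonglongrightarrow> g x"
    "\<And>u. continuous_on (ball 0 r) (\<lambda>x. g' x u)"
    by (rule C1_limit[where f = f and f' = f' and C = C and p = "7/8" and r = r, OF r df cf' step2 step']) auto
  have "g x = w x" if "x \<in> ball 0 r" for x
  proof (rule LIMSEQ_unique[OF g(2)[OF that]])
    have "(\<lambda>n. M * (3/4) ^ n * \<rho> x) \<longlonglongrightarrow> M * 0 * \<rho> x"
      by (intro tendsto_intros) auto
    then have "(\<lambda>n. M * (3/4) ^ n * \<rho> x) \<longlonglongrightarrow> 0" by simp
    then have "(\<lambda>n. f n x - w x) \<longlonglongrightarrow> 0"
      by (rule Lim_null_comparison[rotated]) (simp add: near[OF that])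
    then show "(\<lambda>n. f n x) \<longlonglongrightarrow> w x" by (simp add: LIM_zero_iff)
  qed
  moreover have "Ck_on 1 UNIV (ball 0 r) g"
    unfolding One_nat_def by (rule Ck_on_SucI[OF g(1)]) (simp_all add: g(3))
  ultimately show ?thesis using Ck_on_cong[of 1 UNIV "ball 0 r" g w] by simp
qed

text \<open>
  Every directional derivative of a solution solves an equation of the same kind with \<open>B/2\<close> in place
  of \<open>B\<close>, for which the weight \<open>1\<close> will do. Its inhomogeneous term contains \<open>w\<close>, but not the derivative
  of \<open>w\<close>; so an induction on the order of differentiability closes.
\<close>

lemma linear_equation_Ck:
  fixes B :: "'a::euclidean_space \<Rightarrow> 'b::euclidean_space \<Rightarrow>\<^sub>L 'b" and c w :: "'a \<Rightarrow> 'b"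
  assumes "r > 0"
    and "Ck_on (Suc k) UNIV (ball 0 r) B" "Ck_on (Suc k) UNIV (ball 0 r) c"
    and "\<And>x. x \<in> ball 0 r \<Longrightarrow> norm (B x) \<le> 3/2"
    and "\<And>x. x \<in> ball 0 r \<Longrightarrow> norm (B x) * \<rho> (x /\<^sub>R 2) \<le> 3/4 * \<rho> x"
    and "\<And>x. x \<in> ball 0 r \<Longrightarrow> 0 \<le> \<rho> x \<and> \<rho> x \<le> 1"
    and "\<And>x. x \<in> ball 0 r \<Longrightarrow> norm (c x) \<le> M * \<rho> x"
    and "\<And>x. x \<in> ball 0 r \<Longrightarrow> norm (w x) \<le> M * \<rho> x"
    and "\<And>x. x \<in> ball 0 r \<Longrightarrow> w x = B x (w (x /\<^sub>R 2)) + c x"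
  shows "Ck_on (Suc k) UNIV (ball 0 r) w"
  using assms
proof (induction k arbitrary: B c w \<rho> M r)
  case (0 B c w \<rho> M r)
  show ?case
  proof (rule Ck_ball_shrink)
    fix r' assume r': "0 < r'" "r' < r"
    have sub: "cball 0 r' \<subseteq> ball (0::'a) r" "ball 0 r' \<subseteq> ball (0::'a) r" using r' by auto
    define DB where "DB = (\<lambda>x. frechet_derivative B (at x))"
    define Dc where "Dc = (\<lambda>x. frechet_derivative c (at x))"
    obtain L1 where L1: "L1 \<ge> 0" "\<And>x v. x \<in> cball 0 r' \<Longrightarrow> norm (DB x v) \<le> L1 * norm v"
      using Ck_Suc_bounded_derivative[OF open_ball 0(2) compact_cball sub(1)] unfolding DB_def by blast
    obtain L2 where L2: "L2 \<ge> 0" "\<And>x v. x \<in> cball 0 r' \<Longrightarrow> norm (Dc x v) \<le> L2 * norm v"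
      using Ck_Suc_bounded_derivative[OF open_ball 0(3) compact_cball sub(1)] unfolding Dc_def by blast
    define N where "N = max (max L1 L2) M"
    have N: "L1 \<le> N" "L2 \<le> N" "M \<le> N" "N \<ge> 0" using L1(1) by (auto simp: N_def)
    have up: "M * \<rho> x \<le> N * \<rho> x" if "x \<in> ball 0 r" for x using 0(6)[OF that] N by (intro mult_right_mono) auto
    have "Ck_on 1 UNIV (ball 0 r') w"
    proof (rule linear_equation_C1[where B = B and c = c and \<rho> = \<rho> and M = N and DB = DB and Dc = Dc])
      fix x :: 'a assume x: "x \<in> ball 0 r'"
      then have x': "x \<in> ball 0 r" and xc: "x \<in> cball 0 r'" using r' by auto
      show "(B has_derivative DB x) (at x)" "(c has_derivative Dc x) (at x)"
        using 0(2,3) x' unfolding Ck_on_Suc_open[OF open_ball] DB_def Dc_def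
        by (auto simp: frechet_derivative_works)
      show "norm (B x) \<le> 3/2" "norm (B x) * \<rho> (x /\<^sub>R 2) \<le> 3/4 * \<rho> x" "0 \<le> \<rho> x \<and> \<rho> x \<le> 1"
        "w x = B x (w (x /\<^sub>R 2)) + c x"
        by (fact 0(4)[OF x'] 0(5)[OF x'] 0(6)[OF x'] 0(9)[OF x'])+
      show "norm (c x) \<le> N * \<rho> x" "norm (w x) \<le> N * \<rho> x"
        using 0(7,8)[OF x'] up[OF x'] by linarith+
      fix u show "norm (DB x u) \<le> N * norm u" "norm (Dc x u) \<le> N * norm u"
        using L1(2)[OF xc, of u] L2(2)[OF xc, of u] mult_right_mono[OF N(1) norm_ge_zero[of u]]
          mult_right_mono[OF N(2) norm_ge_zero[of u]] by linarith+
    next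
      fix u show "continuous_on (ball 0 r') (\<lambda>x. DB x u)" "continuous_on (ball 0 r') (\<lambda>x. Dc x u)"
        using 0(2,3) continuous_on_subset[OF _ sub(2)] 
        unfolding Ck_on_Suc_open[OF open_ball] DB_def Dc_def Ck_on.simps(1) by blast+
    qed (use N r' in auto)
    then show "Ck_on (Suc 0) UNIV (ball 0 r') w" by simp
  qed
next
  case (Suc k B c w \<rho> M r)
  note Bk = Suc.prems(2) and ck = Suc.prems(3)
  define DB where "DB = (\<lambda>x. frechet_derivative B (at x))"
  define Dc where "Dc = (\<lambda>x. frechet_derivative c (at x))"
  define Dw where "Dw = (\<lambda>x. frechet_derivative w (at x))"
  have w1: "Ck_on (Suc k) UNIV (ball 0 r) w"
    by (rule Suc.IH[of r B c \<rho> M w]) (use Suc.prems Ck_on_Suc_imp in blast)+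
  have w0: "Ck_on (Suc 0) UNIV (ball 0 r) w" by (rule Ck_on_le[OF w1]) simp
  have DB: "(B has_derivative DB x) (at x)" "Ck_on (Suc k) UNIV (ball 0 r) (\<lambda>x. DB x u)"
    and Dc: "(c has_derivative Dc x) (at x)" "Ck_on (Suc k) UNIV (ball 0 r) (\<lambda>x. Dc x u)"
    and Dw: "(w has_derivative Dw x) (at x)" "continuous_on (ball 0 r) (\<lambda>x. Dw x u)"
    if "x \<in> ball 0 r" for x u
    using iffD1[OF Ck_on_Suc_open[OF open_ball] Bk] iffD1[OF Ck_on_Suc_open[OF open_ball] ck]
      iffD1[OF Ck_on_Suc_open[OF open_ball] w0] that
    unfolding DB_def Dc_def Dw_def frechet_derivative_works Ck_on.simps(1) by blast+
  have Dwk: "Ck_on (Suc k) UNIV (ball 0 r) (\<lambda>x. Dw x u)" for u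
  proof (rule Ck_ball_shrink)
    fix r' assume r': "0 < r'" "r' < r"
    have sub: "cball 0 r' \<subseteq> ball (0::'a) r" "ball 0 r' \<subseteq> ball (0::'a) r" using r' by auto
    define c' where "c' = (\<lambda>x. DB x u (w (x /\<^sub>R 2)) + Dc x u)"
    have z: "0 \<in> ball (0::'a) r" using Suc.prems(1) by simp
    have c': "Ck_on (Suc k) UNIV (ball 0 r) c'"
      unfolding c'_def
      by (intro Ck_on_add Ck_on_bounded_bilinear[OF bounded_bilinear_blinfun_apply] DB(2)[OF z] Dc(2)[OF z]
          Ck_on_half[OF w1])
    obtain M1 where M1: "\<And>x. x \<in> cball 0 r' \<Longrightarrow> norm (Dw x u) \<le> M1"
      using compact_imp_bounded[OF compact_continuous_image[OF continuous_on_subset[OF Dw(2)[OF z] sub(1)] compact_cball]]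
      unfolding bounded_iff by blast
    obtain M2 where M2: "\<And>x. x \<in> cball 0 r' \<Longrightarrow> norm (c' x) \<le> M2"
      using compact_imp_bounded[OF compact_continuous_image[OF continuous_on_subset[OF Ck_on_imp_continuous[OF c'] sub(1)] compact_cball]]
      unfolding bounded_iff by blast
    show "Ck_on (Suc k) UNIV (ball 0 r') (\<lambda>x. Dw x u)"
    proof (rule Suc.IH[where B = "\<lambda>x. B x /\<^sub>R 2" and c = c' and \<rho> = "\<lambda>x. 1" and M = "max M1 M2"])
      show "Ck_on (Suc k) UNIV (ball 0 r') (\<lambda>x. B x /\<^sub>R 2)"
        by (intro Ck_on_bounded_linear[OF bounded_linear_scaleR_right] Ck_on_subset[OF Ck_on_Suc_imp[OF Bk]] sub) simp
      show "Ck_on (Suc k) UNIV (ball 0 r') c'" by (rule Ck_on_subset[OF c' sub(2)]) simp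
    next
      fix x :: 'a assume x: "x \<in> ball 0 r'"
      then have x': "x \<in> ball 0 r" and xc: "x \<in> cball 0 r'" using r' by auto
      show "norm (B x /\<^sub>R 2) \<le> 3/2" "norm (B x /\<^sub>R 2) * 1 \<le> 3/4 * 1" using Suc.prems(4)[OF x'] by auto
      show "norm (c' x) \<le> max M1 M2 * 1" "norm (Dw x u) \<le> max M1 M2 * 1"
        using M1[OF xc] M2[OF xc] by auto
      have "((\<lambda>x. B x (w (x /\<^sub>R 2)) + c x) has_derivative
          (\<lambda>u. B x (Dw (x /\<^sub>R 2) (u /\<^sub>R 2)) + DB x u (w (x /\<^sub>R 2)) + Dc x u)) (at x)"
        by (intro has_derivative_add Dc[OF x'] bounded_bilinear.FDERIV[OF bounded_bilinear_blinfun_apply]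
            DB[OF x'] has_derivative_half Dw half_in_ball[OF x'])
      then have Dw': "(w has_derivative
          (\<lambda>u. B x (Dw (x /\<^sub>R 2) (u /\<^sub>R 2)) + DB x u (w (x /\<^sub>R 2)) + Dc x u)) (at x)"
        by (rule has_derivative_transform_within_open[OF _ open_ball x']) (simp add: Suc.prems(9))
      have "Dw x u = B x (Dw (x /\<^sub>R 2) (u /\<^sub>R 2)) + DB x u (w (x /\<^sub>R 2)) + Dc x u"
        by (rule fun_cong[OF has_derivative_unique[OF Dw(1)[OF x'] Dw']])
      moreover have "Dw (x /\<^sub>R 2) (u /\<^sub>R 2) = Dw (x /\<^sub>R 2) u /\<^sub>R 2"
        by (rule linear_cmul[OF has_derivative_linear[OF Dw(1)[OF half_in_ball[OF x']]]])
      ultimately show "Dw x u = (B x /\<^sub>R 2) (Dw (x /\<^sub>R 2) u) + c' x"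
        by (simp add: c'_def blinfun.scaleR_left blinfun.scaleR_right)
    qed (use r' in auto)
  qed
  show ?case by (rule Ck_on_SucI[OF Dw(1) Dwk])
qed

lemma smooth_derivative_bounds:
  fixes F :: "'a::euclidean_space \<Rightarrow> 'b::real_normed_vector"
  assumes W: "open W" "0 \<in> W" and F: "smooth_on UNIV W F"
  defines "D \<equiv> \<lambda>x. frechet_derivative F (at x)"
  obtains \<rho> K where "\<rho> > 0" "K \<ge> 1" "cball 0 \<rho> \<subseteq> W"
    "\<And>y z u. y \<in> cball 0 \<rho> \<Longrightarrow> z \<in> cball 0 \<rho> \<Longrightarrow> norm (D y u - D z u) \<le> K * norm (y - z) * norm u"
proof -
  obtain \<rho> where \<rho>: "\<rho> > 0" "cball 0 \<rho> \<subseteq> W" using W open_contains_cball by blast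
  have lin: "linear (D x)" if "x \<in> W" for x
    unfolding D_def using smooth_on_has_derivative[OF W(1) F that] by (rule has_derivative_linear)
  have Db: "smooth_on UNIV W (\<lambda>x. D x b)" for b
    unfolding D_def by (rule smooth_on_frechet_derivative[OF W(1) F])
  have "\<exists>L\<ge>0. \<forall>y\<in>cball 0 \<rho>. \<forall>z\<in>cball 0 \<rho>. norm (D y b - D z b) \<le> L * norm (y - z)" for b
  proof -
    have "Ck_on (Suc 0) UNIV W (\<lambda>x. D x b)" using Db unfolding smooth_on_def by blast
    from Ck_Suc_bounded_derivative[OF W(1) this compact_cball \<rho>(2)]
    obtain L where L: "L \<ge> 0" "\<And>x v. x \<in> cball 0 \<rho> \<Longrightarrow>
        norm (frechet_derivative (\<lambda>x. D x b) (at x) v) \<le> L * norm v" by blast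
    have "norm (D y b - D z b) \<le> L * norm (y - z)" if "y \<in> cball 0 \<rho>" "z \<in> cball 0 \<rho>" for y z
    proof (rule differentiable_bound[OF convex_cball _ _ that])
      fix x :: 'a assume x: "x \<in> cball 0 \<rho>"
      have "((\<lambda>x. D x b) has_derivative frechet_derivative (\<lambda>x. D x b) (at x)) (at x)"
        using smooth_on_has_derivative[OF W(1) Db] x \<rho>(2) by blast
      then show "((\<lambda>x. D x b) has_derivative frechet_derivative (\<lambda>x. D x b) (at x)) (at x within cball 0 \<rho>)"
        by (rule has_derivative_at_withinI)
      show "onorm (frechet_derivative (\<lambda>x. D x b) (at x)) \<le> L"
        by (rule onorm_bound[OF L(1) L(2)[OF x]])
    qed
    with L(1) show ?thesis by blast
  qed
  then obtain L where L: "\<And>b. L b \<ge> 0"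
    "\<And>b y z. y \<in> cball 0 \<rho> \<Longrightarrow> z \<in> cball 0 \<rho> \<Longrightarrow> norm (D y b - D z b) \<le> L b * norm (y - z)" by metis
  define K where "K = (\<Sum>b\<in>Basis. L b) + 1"
  have bound: "norm (D y u - D z u) \<le> K * norm (y - z) * norm u" if "y \<in> cball 0 \<rho>" "z \<in> cball 0 \<rho>" for y z u
  proof -
    have rep: "D x u = (\<Sum>b\<in>Basis. (u \<bullet> b) *\<^sub>R D x b)" if "x \<in> cball 0 \<rho>" for x
    proof -
      interpret linear "D x" using lin \<rho>(2) that by blast
      have "D x u = D x (\<Sum>b\<in>Basis. (u \<bullet> b) *\<^sub>R b)" by (simp add: euclidean_representation)
      then show ?thesis by (simp add: sum scaleR)
    qed
    have "D y u - D z u = (\<Sum>b\<in>Basis. (u \<bullet> b) *\<^sub>R (D y b - D z b))"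
      by (simp add: rep[OF that(1)] rep[OF that(2)] sum_subtractf scaleR_diff_right)
    also have "norm \<dots> \<le> (\<Sum>b\<in>Basis. norm u * (L b * norm (y - z)))"
    proof (rule sum_norm_le)
      fix b :: 'a assume b: "b \<in> Basis"
      show "norm ((u \<bullet> b) *\<^sub>R (D y b - D z b)) \<le> norm u * (L b * norm (y - z))"
        unfolding norm_scaleR real_norm_def
        by (intro mult_mono L(2) that Basis_le_norm b) (auto simp: L(1))
    qed
    also have "\<dots> = (\<Sum>b\<in>Basis. L b) * (norm (y - z) * norm u)"
      unfolding sum_distrib_right by (intro sum.cong) (simp_all add: mult_ac)
    also have "\<dots> \<le> K * (norm (y - z) * norm u)"
      unfolding K_def by (intro mult_right_mono) auto
    finally show ?thesis by (simp add: mult.assoc)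
  qed
  have "K \<ge> 1" unfolding K_def using L(1) by (simp add: sum_nonneg)
  with \<rho> bound show ?thesis using that by blast
qed

lemma doubling_map_bounds:
  fixes F :: "'a::euclidean_space \<Rightarrow> 'a"
  assumes W: "open W" "0 \<in> W" and F: "smooth_on UNIV W F"
    and F0: "F 0 = 0" and dF: "(F has_derivative (\<lambda>u. 2 *\<^sub>R u)) (at 0)"
  defines "D \<equiv> \<lambda>x. frechet_derivative F (at x)"
  obtains \<rho> K where "\<rho> > 0" "K \<ge> 1" "cball 0 \<rho> \<subseteq> W"
    "\<And>y z u. y \<in> cball 0 \<rho> \<Longrightarrow> z \<in> cball 0 \<rho> \<Longrightarrow> norm (D y u - D z u) \<le> K * norm (y - z) * norm u"
    "\<And>y u. y \<in> cball 0 \<rho> \<Longrightarrow> norm (D y u) \<le> 3 * norm u"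
    "\<And>y z s. s \<le> \<rho> \<Longrightarrow> norm y \<le> s \<Longrightarrow> norm z \<le> s \<Longrightarrow> norm (F y - F z - 2 *\<^sub>R (y - z)) \<le> K * s * norm (y - z)"
    "\<And>y z. y \<in> cball 0 \<rho> \<Longrightarrow> z \<in> cball 0 \<rho> \<Longrightarrow> norm (F y - F z) \<le> 3 * norm (y - z)"
proof -
  obtain \<rho>' K where \<rho>': "\<rho>' > 0" "K \<ge> 1" "cball 0 \<rho>' \<subseteq> W"
    and lip: "\<And>y z u. y \<in> cball 0 \<rho>' \<Longrightarrow> z \<in> cball 0 \<rho>' \<Longrightarrow> norm (D y u - D z u) \<le> K * norm (y - z) * norm u"
    unfolding D_def by (rule smooth_derivative_bounds[OF W F]) (rule that[unfolded D_def]; (assumption | blast))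
  define \<rho> where "\<rho> = min \<rho>' (1 / K)"
  have \<rho>: "\<rho> > 0" "\<rho> \<le> \<rho>'" "K * \<rho> \<le> 1" using \<rho>'(1,2) by (auto simp: \<rho>_def min_def field_simps)
  have sub: "cball 0 \<rho> \<subseteq> cball (0::'a) \<rho>'" using \<rho>(2) by auto
  have D: "(F has_derivative D x) (at x)" if "x \<in> cball 0 \<rho>" for x
    unfolding D_def using smooth_on_has_derivative[OF W(1) F] that sub \<rho>'(3) by blast
  have D0: "D 0 u = 2 *\<^sub>R u" for u
    using has_derivative_unique[OF D dF] \<rho>(1) by simp
  have near2: "norm (D y u - 2 *\<^sub>R u) \<le> K * norm y * norm u" if "y \<in> cball 0 \<rho>" for y u
    using lip[of y 0 u] that sub \<rho>(1) \<rho>'(1) by (auto simp: D0)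
  have le3: "norm (D y u) \<le> 3 * norm u" if "y \<in> cball 0 \<rho>" for y u
  proof -
    have "K * norm y \<le> K * \<rho>" using that \<rho>'(2) by (intro mult_left_mono) auto
    then have "K * norm y * norm u \<le> 1 * norm u" using \<rho>(3) by (intro mult_right_mono) auto
    moreover have "norm (D y u) \<le> norm (D y u - 2 *\<^sub>R u) + norm (2 *\<^sub>R u)"
      using norm_triangle_ineq[of "D y u - 2 *\<^sub>R u" "2 *\<^sub>R u"] by simp
    ultimately show ?thesis using near2[OF that, of u] by simp
  qed
  have quad: "norm (F y - F z - 2 *\<^sub>R (y - z)) \<le> K * s * norm (y - z)" if "s \<le> \<rho>" "norm y \<le> s" "norm z \<le> s" for y z s
  proof -
    have s0: "s \<ge> 0" using that(2) norm_ge_zero[of y] by linarith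
    have "norm ((F y - 2 *\<^sub>R y) - (F z - 2 *\<^sub>R z)) \<le> (K * s) * norm (y - z)"
    proof (rule differentiable_bound[where f = "\<lambda>y. F y - 2 *\<^sub>R y" and S = "cball 0 s"])
      fix x :: 'a assume x: "x \<in> cball 0 s"
      then have x': "x \<in> cball 0 \<rho>" using that(1) by auto
      show "((\<lambda>y. F y - 2 *\<^sub>R y) has_derivative (\<lambda>u. D x u - 2 *\<^sub>R u)) (at x within cball 0 s)"
        by (intro has_derivative_diff has_derivative_at_withinI[OF D[OF x']] has_derivative_scaleR_right has_derivative_ident)
      show "onorm (\<lambda>u. D x u - 2 *\<^sub>R u) \<le> K * s"
      proof (rule onorm_bound)
        fix u :: 'a
        have "K * norm x * norm u \<le> K * s * norm u"
          using x \<rho>'(2) by (intro mult_right_mono mult_left_mono) auto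
        then show "norm (D x u - 2 *\<^sub>R u) \<le> K * s * norm u" using near2[OF x', of u] by linarith
      qed (use \<rho>'(2) s0 in auto)
    qed (use that in auto)
    then show ?thesis by (simp add: algebra_simps)
  qed
  have lip3: "norm (F y - F z) \<le> 3 * norm (y - z)" if "y \<in> cball 0 \<rho>" "z \<in> cball 0 \<rho>" for y z
  proof (rule differentiable_bound[OF convex_cball _ _ that])
    fix x :: 'a assume x: "x \<in> cball 0 \<rho>"
    show "(F has_derivative D x) (at x within cball 0 \<rho>)" using D[OF x] by (rule has_derivative_at_withinI)
    show "onorm (D x) \<le> 3" by (rule onorm_bound) (use le3[OF x] in auto)
  qed
  have lip': "norm (D y u - D z u) \<le> K * norm (y - z) * norm u" if "y \<in> cball 0 \<rho>" "z \<in> cball 0 \<rho>" for y z u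
    using that sub by (intro lip) auto
  show ?thesis
    by (rule that[OF \<rho>(1) \<rho>'(2) _ lip' le3 quad lip3]) (use sub \<rho>'(3) in blast)
qed

text \<open>
  In this form the operator is a bounded linear function of the finitely many values \<open>f b\<close>; so the
  operator-valued derivative of a smooth map is smooth if its values on the basis are.
\<close>

lemma Blinfun_sum_Basis:
  fixes f :: "'a::euclidean_space \<Rightarrow> 'b::real_normed_vector"
  assumes "linear f"
  shows "blinfun_apply (\<Sum>b\<in>Basis. blinfun_scaleR_left (f b) o\<^sub>L blinfun_inner_left b) u = f u"
proof -
  interpret linear f by fact
  have "f u = f (\<Sum>b\<in>Basis. (u \<bullet> b) *\<^sub>R b)" by (simp add: euclidean_representation)
  then show ?thesis by (simp add: sum scaleR blinfun.sum_left inner_commute)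
qed

text \<open>
  Koenigs' linearisation at a repelling fixed point. For \<open>h\<^sub>n(x) = F\<^sup>n(x/2\<^sup>n)\<close> the first increment is
  quadratic in \<open>x\<close>, because \<open>F(y) - 2y\<close> is. Each further step multiplies the increments by a Lipschitz
  constant of at most \<open>3\<close>, while \<open>\<bar>x/2\<bar>\<^sup>2\<close> contributes \<open>1/4\<close>: they decay like \<open>(3/4)\<^sup>n\<close>. For the
  derivatives there is \<open>1/2\<close> from the chain rule and \<open>1/2\<close> from a bound that is linear in \<open>x\<close>; the
  rate \<open>7/8\<close> leaves room for the error made by evaluating \<open>DF\<close> at \<open>h\<^sub>n\<close>.

  The limit \<open>h\<close> satisfies \<open>h(x) = F(h(x/2))\<close>. Hence \<open>w(x) = Dh(x) v - v\<close> satisfies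
  \<open>w(x) = B(x) w(x/2) + (B(x) v - v)\<close> with \<open>B(x) = DF(h(x/2))/2\<close>, of norm at most \<open>3/2\<close>, and
  \<open>w(x) = O(\<bar>x\<bar>)\<close>. Since \<open>B\<close> is as smooth as \<open>h\<close>, so is \<open>Dh\<close>, and \<open>h\<close> is smooth by induction.
\<close>

theorem doubling_map_linearisation:
  fixes F :: "'a::euclidean_space \<Rightarrow> 'a"
  assumes W: "open W" "0 \<in> W" and F: "smooth_on UNIV W F"
    and F0: "F 0 = 0" and dF: "(F has_derivative (\<lambda>u. 2 *\<^sub>R u)) (at 0)"
  obtains r h where "r > 0" "smooth_on UNIV (ball 0 r) h" "h 0 = 0" "(h has_derivative (\<lambda>u. u)) (at 0)"
    "\<And>x. x \<in> ball 0 r \<Longrightarrow> h x \<in> W" "\<And>x. x \<in> ball 0 r \<Longrightarrow> h x = F (h (x /\<^sub>R 2))"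
proof -
  define D where "D = (\<lambda>x. frechet_derivative F (at x))"
  obtain \<rho> K where \<rho>0: "\<rho> > 0" and K: "K \<ge> 1" and \<rho>W: "cball 0 \<rho> \<subseteq> W"
    and lipD: "\<And>y z u. y \<in> cball 0 \<rho> \<Longrightarrow> z \<in> cball 0 \<rho> \<Longrightarrow> norm (D y u - D z u) \<le> K * norm (y - z) * norm u"
    and D3: "\<And>y u. y \<in> cball 0 \<rho> \<Longrightarrow> norm (D y u) \<le> 3 * norm u"
    and quad: "\<And>y z s. s \<le> \<rho> \<Longrightarrow> norm y \<le> s \<Longrightarrow> norm z \<le> s \<Longrightarrow> norm (F y - F z - 2 *\<^sub>R (y - z)) \<le> K * s * norm (y - z)"
    and lip: "\<And>y z. y \<in> cball 0 \<rho> \<Longrightarrow> z \<in> cball 0 \<rho> \<Longrightarrow> norm (F y - F z) \<le> 3 * norm (y - z)"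
    unfolding D_def by (rule doubling_map_bounds[OF W F F0 dF]) (rule that[unfolded D_def]; (assumption | blast))
  note \<rho> = \<rho>0 \<rho>W
  \<comment> \<open>As \<open>\<bar>h\<^sub>n(x)\<bar> \<le> 2\<bar>x\<bar>\<close>, the bound \<open>r \<le> \<rho>/2\<close> keeps the iterates where the estimates for \<open>F\<close> hold; \<open>16Kr \<le> 1\<close> keeps the accumulated increments below \<open>\<bar>x\<bar>\<close> and \<open>\<bar>u\<bar>\<close>.\<close>
  define r where "r = min (\<rho> / 2) (1 / (16 * K))"
  have r': "r > 0" "2 * r \<le> \<rho>" "16 * (K * r) \<le> 1"
    using \<rho>(1) K by (auto simp: r_def min_def field_simps)
  moreover have "r \<le> 1" using mult_right_mono[of 1 K r] r' K by linarith
  ultimately have r: "r > 0" "2 * r \<le> \<rho>" "16 * (K * r) \<le> 1" "r \<le> 1" by auto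
  have KrI: "16 * (K * norm x) \<le> 1" if "x \<in> ball 0 r" for x :: 'a
  proof -
    have "K * norm x \<le> K * r" using that K by (intro mult_left_mono) auto
    then show ?thesis using r(3) by linarith
  qed
  have Der: "(F has_derivative D x) (at x)" if "x \<in> cball 0 \<rho>" for x
    unfolding D_def using smooth_on_has_derivative[OF W(1) F] that \<rho>(2) by blast
  have linD: "linear (D x)" if "x \<in> cball 0 \<rho>" for x
    using Der[OF that] by (rule has_derivative_linear)
  have D0: "D 0 u = 2 *\<^sub>R u" for u
    using has_derivative_unique[OF Der dF] \<rho>(1) by simp
  define h where "h = rec_nat (\<lambda>x::'a. x) (\<lambda>n g x. F (g (x /\<^sub>R 2)))"
  have h0: "h 0 = (\<lambda>x. x)" and hS: "h (Suc n) = (\<lambda>x. F (h n (x /\<^sub>R 2)))" for n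
    by (auto simp: h_def)
  define A where "A = rec_nat (\<lambda>x u. u) (\<lambda>n g x u. D (h n (x /\<^sub>R 2)) (g (x /\<^sub>R 2) (u /\<^sub>R 2)))"
  have A0: "A 0 = (\<lambda>x u. u)" and AS: "A (Suc n) = (\<lambda>x u. D (h n (x /\<^sub>R 2)) (A n (x /\<^sub>R 2) (u /\<^sub>R 2)))" for n
    by (auto simp: A_def)
  have est: "norm (h n x - x) \<le> 4 * K * (1 - (3/4) ^ n) * (norm x)\<^sup>2 \<and>
      norm (h (Suc n) x - h n x) \<le> K * (3/4) ^ n * (norm x)\<^sup>2" if "x \<in> ball 0 r" for n x
    using that
  proof (induction n arbitrary: x)
    case 0
    have "norm (F (x /\<^sub>R 2) - F 0 - 2 *\<^sub>R (x /\<^sub>R 2 - 0)) \<le> K * norm (x /\<^sub>R 2) * norm (x /\<^sub>R 2 - 0)"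
      using 0 r(2) r(1) by (intro quad) auto
    also have "\<dots> = K * (norm x)\<^sup>2 / 4" by (simp add: power2_eq_square)
    also have "\<dots> \<le> K * (norm x)\<^sup>2" using K by simp
    finally show ?case by (simp add: h0 hS F0)
  next
    case (Suc n)
    have first: "norm (h (Suc n) x - x) \<le> 4 * K * (1 - (3/4) ^ Suc n) * (norm x)\<^sup>2" if "x \<in> ball 0 r" for x
    proof -
      have "norm (h (Suc n) x - x) \<le> norm (h (Suc n) x - h n x) + norm (h n x - x)"
        using norm_triangle_ineq[of "h (Suc n) x - h n x" "h n x - x"] by simp
      also have "\<dots> \<le> K * (3/4) ^ n * (norm x)\<^sup>2 + 4 * K * (1 - (3/4) ^ n) * (norm x)\<^sup>2"
        using Suc.IH[OF that] by linarith
      finally show ?thesis by (simp add: algebra_simps)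
    qed
    have inb: "z \<in> cball 0 \<rho>" if "norm (z - y) \<le> 4 * K * (1 - (3/4) ^ m) * (norm y)\<^sup>2" "y \<in> ball 0 r" for z y :: 'a and m :: nat
    proof -
      have "4 * K * (1 - (3/4) ^ m) * (norm y)\<^sup>2 \<le> 4 * K * 1 * (norm y)\<^sup>2"
        using K by (intro mult_right_mono mult_left_mono) auto
      also have "\<dots> = (4 * (K * norm y)) * norm y" by (simp add: power2_eq_square)
      also have "\<dots> \<le> 1 * norm y" using KrI[OF that(2)] K by (intro mult_right_mono) auto
      finally have "norm (z - y) \<le> norm y" using that(1) by simp
      then have "norm z \<le> 2 * norm y" using norm_triangle_ineq[of "z - y" y] by simp
      also have "\<dots> \<le> \<rho>" using that(2) r(2) by simp
      finally show ?thesis by simp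
    qed
    have y: "x /\<^sub>R 2 \<in> ball 0 r" using Suc.prems by (rule half_in_ball)
    have "h (Suc (Suc n)) x - h (Suc n) x = F (h (Suc n) (x /\<^sub>R 2)) - F (h n (x /\<^sub>R 2))"
      by (rule arg_cong2[where f = minus, OF fun_cong[OF hS] fun_cong[OF hS]])
    also have "norm \<dots> \<le> 3 * norm (h (Suc n) (x /\<^sub>R 2) - h n (x /\<^sub>R 2))"
      by (intro lip inb[OF first[OF y] y] inb[OF conjunct1[OF Suc.IH[OF y]] y])
    also have "\<dots> \<le> 3 * (K * (3/4) ^ n * (norm (x /\<^sub>R 2))\<^sup>2)"
      using Suc.IH[OF y] by (intro mult_left_mono) auto
    finally show ?case using first[OF Suc.prems] by (simp add: power2_eq_square)
  qed
  have hx: "norm (h n x) \<le> 2 * norm x" if "x \<in> ball 0 r" for n x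
  proof -
    have "4 * K * (1 - (3/4) ^ n) * (norm x)\<^sup>2 \<le> 4 * K * 1 * (norm x)\<^sup>2"
      using K by (intro mult_right_mono mult_left_mono) auto
    also have "\<dots> = (4 * (K * norm x)) * norm x" by (simp add: power2_eq_square)
    also have "\<dots> \<le> 1 * norm x" using KrI[OF that(1)] K by (intro mult_right_mono) auto
    finally have "norm (h n x - x) \<le> norm x" using est[OF that, of n] by simp
    then show ?thesis using norm_triangle_ineq[of "h n x - x" x] by simp
  qed
  have hin: "h n x \<in> cball 0 \<rho>" if "x \<in> ball 0 r" for n x
    using hx[OF that, of n] that r(2) by simp
  have dh: "(h n has_derivative A n x) (at x)" if "x \<in> ball 0 r" for n x
    using that
  proof (induction n arbitrary: x)
    case (Suc n)
    have y: "x /\<^sub>R 2 \<in> ball 0 r" using Suc.prems by (rule half_in_ball)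
    show ?case unfolding hS AS
      by (rule has_derivative_compose[where g = F, OF has_derivative_half[OF Suc.IH[OF y]] Der[OF hin[OF y]]])
  qed (simp add: h0 A0)
  have smooth_h: "smooth_on UNIV (ball 0 r) (h n)" for n
  proof (induction n)
    case (Suc n)
    have "smooth_on UNIV (ball 0 r) (\<lambda>x. h n (x /\<^sub>R 2))"
      using Suc Ck_on_half unfolding smooth_on_def by blast
    then show ?case unfolding hS
      by (rule smooth_on_comp[OF open_ball W(1) _ F]) (use hin half_in_ball \<rho>(2) in blast)
  qed (simp add: h0)
  have A_fr: "A n x = frechet_derivative (h n) (at x)" if "x \<in> ball 0 r" for n x
    using frechet_derivative_at[OF dh[OF that]] .
  have cA: "continuous_on (ball 0 r) (\<lambda>x. A n x u)" for n u
    by (rule smooth_on_imp_continuous[OF smooth_on_cong[OF smooth_on_frechet_derivative[OF open_ball smooth_h]]])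
       (simp add: A_fr)
  have estA: "norm (A n x u - u) \<le> 8 * K * (1 - (7/8) ^ n) * norm x * norm u \<and>
      norm (A (Suc n) x u - A n x u) \<le> K * (7/8) ^ n * norm x * norm u" if "x \<in> ball 0 r" for n x u
    using that
  proof (induction n arbitrary: x u)
    case 0
    have y: "x /\<^sub>R 2 \<in> cball 0 \<rho>" using 0 r(2) \<rho>0 by simp
    have "norm (D (x /\<^sub>R 2) (u /\<^sub>R 2) - D 0 (u /\<^sub>R 2)) \<le> K * norm (x /\<^sub>R 2 - 0) * norm (u /\<^sub>R 2)"
      using \<rho>(1) by (intro lipD y) auto
    also have "\<dots> = K * norm x * norm u / 4" by simp
    also have "\<dots> \<le> K * norm x * norm u" using K by simp
    finally show ?case by (simp add: A0 AS h0 D0)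
  next
    case (Suc n)
    have first: "norm (A (Suc n) x u - u) \<le> 8 * K * (1 - (7/8) ^ Suc n) * norm x * norm u"
    proof -
      have "norm (A (Suc n) x u - u) \<le> norm (A (Suc n) x u - A n x u) + norm (A n x u - u)"
        using norm_triangle_ineq[of "A (Suc n) x u - A n x u" "A n x u - u"] by simp
      also have "\<dots> \<le> K * (7/8) ^ n * norm x * norm u + 8 * K * (1 - (7/8) ^ n) * norm x * norm u"
        using Suc.IH[OF Suc.prems, of u] by linarith
      finally show ?thesis by (simp add: algebra_simps)
    qed
    let ?y = "x /\<^sub>R 2" and ?v = "u /\<^sub>R 2"
    have y: "?y \<in> ball 0 r" using Suc.prems by (rule half_in_ball)
    have An: "norm (A n ?y ?v) \<le> norm u"
    proof -
      have "8 * K * (1 - (7/8) ^ n) * norm ?y * norm ?v \<le> 8 * K * 1 * norm ?y * norm ?v"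
        using K by (intro mult_right_mono mult_left_mono) auto
      also have "\<dots> = (8 * (K * norm ?y)) * norm ?v" by simp
      also have "\<dots> \<le> 1 * norm ?v" using KrI[OF y] K by (intro mult_right_mono) auto
      finally have "norm (A n ?y ?v - ?v) \<le> norm ?v" using Suc.IH[OF y, of ?v] by linarith
      moreover have "norm (A n ?y ?v) \<le> norm (A n ?y ?v - ?v) + norm ?v"
        using norm_triangle_ineq[of "A n ?y ?v - ?v" ?v] by simp
      ultimately show ?thesis by simp
    qed
    interpret D1: linear "D (h (Suc n) ?y)" using linD hin[OF y] by blast
    have "A (Suc (Suc n)) x u - A (Suc n) x u = D (h (Suc n) ?y) (A (Suc n) ?y ?v) - D (h n ?y) (A n ?y ?v)"
      by (rule arg_cong2[where f = minus, OF fun_cong[OF fun_cong[OF AS]] fun_cong[OF fun_cong[OF AS]]])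
    then have "A (Suc (Suc n)) x u - A (Suc n) x u
        = D (h (Suc n) ?y) (A (Suc n) ?y ?v - A n ?y ?v) + (D (h (Suc n) ?y) (A n ?y ?v) - D (h n ?y) (A n ?y ?v))"
      unfolding D1.diff by simp
    then have "norm (A (Suc (Suc n)) x u - A (Suc n) x u)
        \<le> 3 * norm (A (Suc n) ?y ?v - A n ?y ?v) + K * norm (h (Suc n) ?y - h n ?y) * norm (A n ?y ?v)"
      using norm_triangle_mono[OF D3[OF hin[OF y]] lipD[OF hin[OF y] hin[OF y]]] by metis
    also have "\<dots> \<le> 3 * (K * (7/8) ^ n * norm ?y * norm ?v) + K * (K * (7/8) ^ n * (norm ?y)\<^sup>2) * norm u"
    proof -
      define N where "N = (norm ?y)\<^sup>2"
      define H where "H = norm (h (Suc n) ?y - h n ?y)"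
      have N: "N \<ge> 0" "H \<le> K * (3/4) ^ n * N" "H \<ge> 0"
        unfolding N_def H_def using est[OF y, of n] by (blast intro: zero_le_power2 norm_ge_zero)+
      have "(3/4) ^ n \<le> ((7/8) ^ n :: real)" by (rule power_mono) simp_all
      then have "K * (3/4) ^ n * N \<le> K * (7/8) ^ n * N"
        using K N(1) by (intro mult_right_mono[OF mult_left_mono]) linarith+
      then have "H \<le> K * (7/8) ^ n * N" using N(2) by linarith
      then have "K * H * norm (A n ?y ?v) \<le> K * (K * (7/8) ^ n * N) * norm u"
        by (intro mult_mono[OF mult_left_mono An] mult_nonneg_nonneg zero_le_power norm_ge_zero N(1,3))
           (use K in linarith)+
      moreover have "norm (A (Suc n) ?y ?v - A n ?y ?v) \<le> K * (7/8) ^ n * norm ?y * norm ?v"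
        using Suc.IH[OF y, of ?v] by blast
      ultimately show ?thesis unfolding N_def H_def by linarith
    qed
    also have "\<dots> = K * (7/8) ^ n * norm x * norm u * (3/4 + (K * norm x) / 4)"
      by (simp add: power2_eq_square algebra_simps)
    also have "\<dots> \<le> K * (7/8) ^ n * norm x * norm u * (7/8)"
      using KrI[OF Suc.prems] K by (intro mult_left_mono) auto
    finally show ?case using first by (simp add: mult_ac)
  qed
  have pow: "(3/4) ^ n \<le> ((7/8) ^ n :: real)" for n by (intro power_mono) auto
  have step: "norm (h (Suc n) x - h n x) \<le> K * (7/8) ^ n" if "x \<in> ball 0 r" for n x
  proof -
    have "norm x \<le> 1" using that r(4) by simp
    then have "(norm x)\<^sup>2 \<le> 1" by (simp add: power_le_one)
    then have "K * (3/4) ^ n * (norm x)\<^sup>2 \<le> K * (7/8) ^ n * 1"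
      using K pow[of n] by (intro mult_mono) auto
    then show ?thesis using est[OF that, of n] by linarith
  qed
  have step': "norm (A (Suc n) x u - A n x u) \<le> K * (7/8) ^ n * norm u" if "x \<in> ball 0 r" for n x u
  proof -
    have "norm x \<le> 1" using that r(4) by simp
    then have "K * (7/8) ^ n * norm x * norm u \<le> K * (7/8) ^ n * 1 * norm u"
      using K by (intro mult_mono) auto
    then show ?thesis using estA[OF that, of n u] by linarith
  qed
  obtain g g' where g: "\<And>x. x \<in> ball 0 r \<Longrightarrow> (g has_derivative g' x) (at x)"
    "\<And>x. x \<in> ball 0 r \<Longrightarrow> (\<lambda>n. h n x) \<longlonglongrightarrow> g x"
    "\<And>x u. x \<in> ball 0 r \<Longrightarrow> (\<lambda>n. A n x u) \<longlonglongrightarrow> g' x u"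
    "\<And>u. continuous_on (ball 0 r) (\<lambda>x. g' x u)"
    by (rule C1_limit[where f = h and f' = A and C = K and p = "7/8" and r = r, OF r(1) dh cA step step']) auto
  have gin: "g x \<in> cball 0 \<rho>" if "x \<in> ball 0 r" for x
    by (rule closed_sequentially[OF closed_cball _ g(2)[OF that]]) (use hin[OF that] in blast)
  have g2: "norm (g x) \<le> 2 * norm x" if "x \<in> ball 0 r" for x
    by (rule tendsto_upperbound[OF tendsto_norm[OF g(2)[OF that]] _ trivial_limit_sequentially])
       (use hx[OF that] in auto)
  have z: "0 \<in> ball (0::'a) r" using r(1) by simp
  have g0: "g 0 = 0" using g2[OF z] by simp
  have geq: "g x = F (g (x /\<^sub>R 2))" if "x \<in> ball 0 r" for x
  proof (rule LIMSEQ_unique)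
    show "(\<lambda>n. h (Suc n) x) \<longlonglongrightarrow> g x" using g(2)[OF that] by (rule LIMSEQ_Suc)
    have y: "x /\<^sub>R 2 \<in> ball 0 r" using that by (rule half_in_ball)
    have "isCont F (g (x /\<^sub>R 2))" using Der[OF gin[OF y]] by (rule has_derivative_continuous)
    then show "(\<lambda>n. h (Suc n) x) \<longlonglongrightarrow> F (g (x /\<^sub>R 2))"
      unfolding hS using g(2)[OF y] by (rule isCont_tendsto_compose)
  qed
  have g'est: "norm (g' x u - u) \<le> 8 * K * norm x * norm u" if "x \<in> ball 0 r" for x u
  proof (rule tendsto_upperbound[OF _ _ trivial_limit_sequentially])
    show "(\<lambda>n. norm (A n x u - u)) \<longlonglongrightarrow> norm (g' x u - u)"
      by (intro tendsto_intros g(3) that)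
    have "norm (A n x u - u) \<le> 8 * K * norm x * norm u" for n
    proof -
      have "8 * K * (1 - (7/8) ^ n) * norm x * norm u \<le> 8 * K * 1 * norm x * norm u"
        using K by (intro mult_right_mono mult_left_mono) auto
      then show ?thesis using estA[OF that, of n u] by linarith
    qed
    then show "\<forall>\<^sub>F n in sequentially. norm (A n x u - u) \<le> 8 * K * norm x * norm u" by simp
  qed
  have g'0: "g' 0 = (\<lambda>u. u)" using g'est[OF z] by auto
  have g'eq: "g' x u = D (g (x /\<^sub>R 2)) (g' (x /\<^sub>R 2) (u /\<^sub>R 2))" if "x \<in> ball 0 r" for x u
  proof -
    have y: "x /\<^sub>R 2 \<in> ball 0 r" using that by (rule half_in_ball)
    have "((\<lambda>x. F (g (x /\<^sub>R 2))) has_derivative (\<lambda>u. D (g (x /\<^sub>R 2)) (g' (x /\<^sub>R 2) (u /\<^sub>R 2)))) (at x)"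
      by (rule has_derivative_compose[where g = F, OF has_derivative_half[OF g(1)[OF y]] Der[OF gin[OF y]]])
    then have g': "(g has_derivative (\<lambda>u. D (g (x /\<^sub>R 2)) (g' (x /\<^sub>R 2) (u /\<^sub>R 2)))) (at x)"
      by (rule has_derivative_transform_within_open[OF _ open_ball that]) (simp add: geq)
    show ?thesis by (rule fun_cong[OF has_derivative_unique[OF g(1)[OF that] g']])
  qed
  define B where "B = (\<lambda>x. (\<Sum>b\<in>Basis. blinfun_scaleR_left (D (g (x /\<^sub>R 2)) b) o\<^sub>L blinfun_inner_left b) /\<^sub>R 2)"
  have B: "blinfun_apply (B x) u = D (g (x /\<^sub>R 2)) u /\<^sub>R 2" if "x \<in> ball 0 r" for x u
    unfolding B_def blinfun.scaleR_left
    by (subst Blinfun_sum_Basis) (use linD gin half_in_ball[OF that] in auto)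
  have Ck: "Ck_on (Suc k) UNIV (ball 0 r) g" for k
  proof (induction k)
    case 0
    show ?case by (rule Ck_on_SucI[OF g(1)]) (simp_all add: g(4))
  next
    case (Suc k)
    have "Ck_on (Suc k) UNIV W (\<lambda>x. D x b)" for b
      using smooth_on_frechet_derivative[OF W(1) F] unfolding smooth_on_def D_def by blast
    then have Dg: "Ck_on (Suc k) UNIV (ball 0 r) (\<lambda>x. D (g (x /\<^sub>R 2)) b)" for b
      by (rule Ck_on_comp[OF open_ball W(1) Ck_on_half[OF Suc]]) (use gin half_in_ball \<rho>(2) in blast)
    have CB: "Ck_on (Suc k) UNIV (ball 0 r) B"
      unfolding B_def
      by (intro Ck_on_bounded_linear[OF bounded_linear_scaleR_right] Ck_on_sum
          Ck_on_bounded_linear[OF bounded_bilinear.bounded_linear_left[OF bounded_bilinear_blinfun_compose]]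
          Ck_on_bounded_linear[OF bounded_linear_blinfun_scaleR_left] Dg)
    have g'k: "Ck_on (Suc k) UNIV (ball 0 r) (\<lambda>x. g' x v)" for v
    proof -
      have Cc: "Ck_on (Suc k) UNIV (ball 0 r) (\<lambda>x. B x v - v)"
        by (intro Ck_on_diff Ck_on_const Ck_on_bounded_linear[OF _ CB] bounded_bilinear.bounded_linear_left[OF bounded_bilinear_blinfun_apply])
      have "Ck_on (Suc k) UNIV (ball 0 r) (\<lambda>x. g' x v - v)"
      proof (rule linear_equation_Ck[OF r(1) CB Cc, where \<rho> = norm and M = "8 * K * norm v"])
        fix x :: 'a assume x: "x \<in> ball 0 r"
        have y: "x /\<^sub>R 2 \<in> ball 0 r" using x by (rule half_in_ball)
        show nB: "norm (B x) \<le> 3/2"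
        proof (rule norm_blinfun_bound)
          show "norm (B x u) \<le> 3/2 * norm u" for u using D3[OF gin[OF y], of u] by (simp add: B[OF x])
        qed simp
        show "norm (B x) * norm (x /\<^sub>R 2) \<le> 3/4 * norm x"
          using mult_right_mono[OF nB, of "norm x / 2"] by simp
        show "0 \<le> norm x \<and> norm x \<le> 1" using x r(4) by simp
        show "norm (g' x v - v) \<le> 8 * K * norm v * norm x" using g'est[OF x, of v] by (simp add: mult_ac)
        have "norm (B x v - v) = norm (D (g (x /\<^sub>R 2)) v - D 0 v) / 2"
        proof -
          have "B x v - v = (D (g (x /\<^sub>R 2)) v - D 0 v) /\<^sub>R 2"
            by (simp add: B[OF x] D0 scaleR_diff_right)
          then show ?thesis by simp
        qed
        also have "\<dots> \<le> (K * norm (g (x /\<^sub>R 2) - 0) * norm v) / 2"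
          using \<rho>(1) by (intro divide_right_mono lipD gin y) auto
        also have "\<dots> \<le> (K * norm x * norm v) / 2"
          using g2[OF y] K by (intro divide_right_mono mult_right_mono mult_left_mono) auto
        also have "\<dots> \<le> 8 * K * norm v * norm x" using K by simp
        finally show "norm (B x v - v) \<le> 8 * K * norm v * norm x" .
        have "g' (x /\<^sub>R 2) (v /\<^sub>R 2) = g' (x /\<^sub>R 2) v /\<^sub>R 2"
          by (rule linear_cmul[OF has_derivative_linear[OF g(1)[OF y]]])
        then have "g' x v = B x (g' (x /\<^sub>R 2) v)"
          using linear_cmul[OF linD[OF gin[OF y]], of "1/2"] by (simp add: g'eq[OF x] B[OF x])
        then show "g' x v - v = B x (g' (x /\<^sub>R 2) v - v) + (B x v - v)"
          by (simp add: blinfun.diff_right)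
      qed
      from Ck_on_add[OF this Ck_on_const[of _ _ _ v]] show ?thesis by simp
    qed
    show ?case by (rule Ck_on_SucI[OF g(1) g'k])
  qed
  have smg: "smooth_on UNIV (ball 0 r) g"
    unfolding smooth_on_def using Ck Ck_on_Suc_imp by blast
  show ?thesis
    by (rule that[OF r(1) smg g0]) (use g(1)[OF z] g'0 gin \<rho>(2) geq in auto)
qed

text \<open>
  Near the fixed point \<open>F\<close> expands distances by at most \<open>2(1 + O(\<bar>t\<bar>))\<close> along the two curves, so
  \<open>\<bar>y(t) - z(t)\<bar>/\<bar>t\<bar>\<close> grows by at most a factor \<open>exp(L\<bar>t\<bar>)\<close> from \<open>t/2\<close> to \<open>t\<close>. The weight
  \<open>exp(-2L\<bar>t\<bar>)\<close> compensates all these factors, and the quotient tends to \<open>0\<close> because the velocities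
  agree.
\<close>

lemma doubling_curve_unique:
  fixes F :: "'a::euclidean_space \<Rightarrow> 'a" and y z :: "real \<Rightarrow> 'a"
  assumes W: "open W" "0 \<in> W" and F: "smooth_on UNIV W F"
    and F0: "F 0 = 0" and dF: "(F has_derivative (\<lambda>u. 2 *\<^sub>R u)) (at 0)"
    and y: "y 0 = 0" "(y has_vector_derivative v) (at 0)" and z: "z 0 = 0" "(z has_vector_derivative v) (at 0)"
    and eq: "\<forall>\<^sub>F t in nhds 0. y t = F (y (t / 2)) \<and> z t = F (z (t / 2))"
  shows "\<forall>\<^sub>F t in nhds 0. y t = z t"
proof -
  obtain \<rho> K where \<rho>: "\<rho> > 0" and K: "K \<ge> 1"
    and quad: "\<And>y z s. s \<le> \<rho> \<Longrightarrow> norm y \<le> s \<Longrightarrow> norm z \<le> s \<Longrightarrow> norm (F y - F z - 2 *\<^sub>R (y - z)) \<le> K * s * norm (y - z)"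
    using doubling_map_bounds[OF W F F0 dF] by metis
  define C where "C = norm v + 1"
  have C: "C > 0" by (simp add: C_def add_nonneg_pos)
  have lin: "\<exists>d>0. \<forall>t. \<bar>t\<bar> < d \<longrightarrow> norm (x t) \<le> C * \<bar>t\<bar>" if "x 0 = 0" "(x has_vector_derivative v) (at 0)" for x :: "real \<Rightarrow> 'a"
  proof -
    from that(2) obtain d where d: "d > 0" "\<And>t. norm (t - 0) < d \<Longrightarrow> norm (x t - x 0 - (t - 0) *\<^sub>R v) \<le> 1 * norm (t - 0)"
      unfolding has_vector_derivative_def has_derivative_at_alt by (metis zero_less_one)
    have "norm (x t) \<le> C * \<bar>t\<bar>" if "\<bar>t\<bar> < d" for t
    proof -
      have "norm (x t) \<le> norm (x t - t *\<^sub>R v) + norm (t *\<^sub>R v)"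
        using norm_triangle_ineq[of "x t - t *\<^sub>R v" "t *\<^sub>R v"] by simp
      also have "\<dots> \<le> \<bar>t\<bar> + \<bar>t\<bar> * norm v" using d(2)[of t] that \<open>x 0 = 0\<close> by simp
      finally show ?thesis by (simp add: C_def algebra_simps)
    qed
    with d(1) show ?thesis by blast
  qed
  obtain d1 where d1: "d1 > 0" "\<And>t. \<bar>t\<bar> < d1 \<Longrightarrow> norm (y t) \<le> C * \<bar>t\<bar>" using lin[OF y] by blast
  obtain d2 where d2: "d2 > 0" "\<And>t. \<bar>t\<bar> < d2 \<Longrightarrow> norm (z t) \<le> C * \<bar>t\<bar>" using lin[OF z] by blast
  obtain d3 where d3: "d3 > 0" "\<And>t. \<bar>t\<bar> < d3 \<Longrightarrow> y t = F (y (t / 2)) \<and> z t = F (z (t / 2))"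
    using eq unfolding eventually_nhds_metric dist_real_def by auto
  define d where "d = min (min d1 d2) (min d3 (\<rho> / C))"
  have d: "d > 0" "d \<le> d1" "d \<le> d2" "d \<le> d3" "d \<le> \<rho> / C" using d1(1) d2(1) d3(1) \<rho> C by (auto simp: d_def)
  define L where "L = K * C / 4"
  have L: "L \<ge> 0" using K C by (simp add: L_def)
  define q where "q = (\<lambda>t. norm (y t - z t) / \<bar>t\<bar> * exp (- 2 * L * \<bar>t\<bar>))"
  have halve: "q t \<le> q (t / 2)" if t: "\<bar>t\<bar> < d" "t \<noteq> 0" for t
  proof -
    let ?s = "C * \<bar>t / 2\<bar>"
    have th: "\<bar>t / 2\<bar> < d" using t by simp
    have "C * \<bar>t\<bar> \<le> C * (\<rho> / C)" using t(1) d(5) C by (intro mult_left_mono) auto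
    then have "C * \<bar>t\<bar> \<le> \<rho>" using C by simp
    then have s: "?s \<le> \<rho>" using \<rho> by simp
    have "norm (y t - z t) \<le> norm (F (y (t/2)) - F (z (t/2)) - 2 *\<^sub>R (y (t/2) - z (t/2))) + norm (2 *\<^sub>R (y (t/2) - z (t/2)))"
      using d3(2)[of t] t d(4) norm_triangle_ineq[of "F (y (t/2)) - F (z (t/2)) - 2 *\<^sub>R (y (t/2) - z (t/2))" "2 *\<^sub>R (y (t/2) - z (t/2))"]
      by simp
    also have "\<dots> \<le> K * ?s * norm (y (t/2) - z (t/2)) + norm (2 *\<^sub>R (y (t/2) - z (t/2)))"
      using d1(2)[of "t / 2"] d2(2)[of "t / 2"] th d by (intro add_right_mono quad s) auto
    also have "\<dots> = K * ?s * norm (y (t/2) - z (t/2)) + 2 * norm (y (t/2) - z (t/2))"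
      by (simp only: norm_scaleR abs_numeral real_norm_def)
    also have "\<dots> = (1 + L * \<bar>t\<bar>) * (2 * norm (y (t/2) - z (t/2)))"
      by (simp add: L_def algebra_simps)
    also have "\<dots> \<le> exp (L * \<bar>t\<bar>) * (2 * norm (y (t/2) - z (t/2)))"
      by (intro mult_right_mono exp_ge_add_one_self) auto
    finally have *: "norm (y t - z t) \<le> exp (L * \<bar>t\<bar>) * (2 * norm (y (t/2) - z (t/2)))" .
    have "q t \<le> exp (L * \<bar>t\<bar>) * (2 * norm (y (t/2) - z (t/2))) / \<bar>t\<bar> * exp (- 2 * L * \<bar>t\<bar>)"
      unfolding q_def using * by (intro mult_right_mono divide_right_mono) auto
    also have "\<dots> = (2 * norm (y (t/2) - z (t/2))) / \<bar>t\<bar> * (exp (L * \<bar>t\<bar>) * exp (- 2 * L * \<bar>t\<bar>))" by simp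
    also have "exp (L * \<bar>t\<bar>) * exp (- 2 * L * \<bar>t\<bar>) = exp (- 2 * L * \<bar>t / 2\<bar>)"
      by (simp add: exp_add[symmetric])
    also have "(2 * norm (y (t/2) - z (t/2))) / \<bar>t\<bar> * exp (- 2 * L * \<bar>t / 2\<bar>) = q (t / 2)"
      by (simp add: q_def)
    finally show ?thesis .
  qed
  have halve_n: "q t \<le> q (t / 2 ^ n)" if "\<bar>t\<bar> < d" "t \<noteq> 0" for t n
  proof (induction n)
    case (Suc n)
    have "\<bar>t / 2 ^ n\<bar> \<le> \<bar>t\<bar>" using mult_left_mono[of 1 "2 ^ n" "\<bar>t\<bar>"] by (simp add: divide_le_eq)
    then have "q (t / 2 ^ n) \<le> q (t / 2 ^ n / 2)" using that by (intro halve) auto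
    then show ?case using Suc by (simp add: mult.commute)
  qed simp
  have "y t = z t" if t: "\<bar>t\<bar> < d" for t
  proof (cases "t = 0")
    case False
    have "((\<lambda>t. y t - z t) has_vector_derivative v - v) (at 0)"
      by (intro has_vector_derivative_diff y z)
    then have "((\<lambda>t. norm (y t - z t) / \<bar>t\<bar>) \<longlongrightarrow> 0) (at 0)"
      by (simp add: has_vector_derivative_def has_derivative_at y(1) z(1))
    moreover have "filterlim (\<lambda>n. t / 2 ^ n) (at 0) sequentially"
      unfolding filterlim_at
    proof
      have "(\<lambda>n. t * (1/2) ^ n) \<longlonglongrightarrow> t * 0" by (intro tendsto_intros) auto
      then show "(\<lambda>n. t / 2 ^ n) \<longlonglongrightarrow> 0" by (simp add: power_divide)
    qed (use False in auto)
    ultimately have lim: "(\<lambda>n. norm (y (t / 2 ^ n) - z (t / 2 ^ n)) / \<bar>t / 2 ^ n\<bar>) \<longlonglongrightarrow> 0"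
      by (rule filterlim_compose)
    have "q t \<le> 0"
    proof (rule tendsto_lowerbound[OF lim _ trivial_limit_sequentially])
      have "q t \<le> norm (y (t / 2 ^ n) - z (t / 2 ^ n)) / \<bar>t / 2 ^ n\<bar>" for n
      proof -
        have "q t \<le> norm (y (t / 2 ^ n) - z (t / 2 ^ n)) / \<bar>t / 2 ^ n\<bar> * exp (- 2 * L * \<bar>t / 2 ^ n\<bar>)"
          using halve_n[OF t False, of n] unfolding q_def .
        also have "\<dots> \<le> norm (y (t / 2 ^ n) - z (t / 2 ^ n)) / \<bar>t / 2 ^ n\<bar> * 1"
          using L by (intro mult_left_mono) auto
        finally show ?thesis by simp
      qed
      then show "\<forall>\<^sub>F n in sequentially. q t \<le> norm (y (t / 2 ^ n) - z (t / 2 ^ n)) / \<bar>t / 2 ^ n\<bar>" by simp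
    qed
    then have "norm (y t - z t) / \<bar>t\<bar> \<le> 0"
      unfolding q_def by (simp add: mult_le_0_iff)
    then show ?thesis using False by (simp add: divide_le_0_iff)
  qed (simp add: y z)
  then show ?thesis unfolding eventually_nhds_metric dist_real_def using d(1) by auto
qed

section \<open>Smooth maps of manifolds\<close>

text \<open>
  The inverse of a chart, extended along the projection to an open subset of the ambient Euclidean
  space.
\<close>

definition par :: "('a, 'e::euclidean_space) manifold \<Rightarrow> 'a set \<Rightarrow> ('a \<Rightarrow> 'e) \<Rightarrow> 'e \<Rightarrow> 'a" where
  "par M V \<phi> y = inv_into V \<phi> (proj (model M) y)"

definition chart_dom :: "('a, 'e::euclidean_space) manifold \<Rightarrow> 'a set \<Rightarrow> ('a \<Rightarrow> 'e) \<Rightarrow> 'e set" where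
  "chart_dom M V \<phi> = proj (model M) -` (\<phi> ` V)"

lemma smooth_manifold_subspace: "smooth_manifold M \<Longrightarrow> subspace (model M)"
  by (simp add: smooth_manifold_def)

lemma chart_at:
  assumes "smooth_manifold M"
  obtains V \<phi> where "(V, \<phi>) \<in> atlas M" "p \<in> V"
proof -
  have "p \<in> (\<Union>(U, \<phi>)\<in>atlas M. U)" using assms by (simp add: smooth_manifold_def)
  then show ?thesis using that by auto
qed

context
  fixes M :: "('a::{t2_space,second_countable_topology}, 'e::euclidean_space) manifold"
    and V :: "'a set" and \<phi> :: "'a \<Rightarrow> 'e"
  assumes M: "smooth_manifold M" and c: "(V, \<phi>) \<in> atlas M"
begin

lemma chart_open: "open V"
  and chart_openin: "openin (top_of_set (model M)) (\<phi> ` V)"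
  and chart_homeomorphism: "homeomorphism V (\<phi> ` V) \<phi> (inv_into V \<phi>)"
  using M c unfolding smooth_manifold_def by auto

lemma chart_transition:
  "(W, \<psi>) \<in> atlas M \<Longrightarrow> smooth_on (model M) (\<phi> ` (V \<inter> W)) (\<psi> \<circ> inv_into V \<phi>)"
  using M c unfolding smooth_manifold_def by blast

lemma inv_chart: "q \<in> V \<Longrightarrow> inv_into V \<phi> (\<phi> q) = q"
  using homeomorphism_apply1[OF chart_homeomorphism] .

lemma chart_inj: "inj_on \<phi> V"
  by (rule inj_on_inverseI) (rule inv_chart)

lemma chart_in_model: "q \<in> V \<Longrightarrow> \<phi> q \<in> model M"
  using openin_imp_subset[OF chart_openin] by auto

lemma chart_continuous: "continuous_on V \<phi>"
  using chart_homeomorphism by (simp add: homeomorphism_def)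

lemma proj_chart: "q \<in> V \<Longrightarrow> proj (model M) (\<phi> q) = \<phi> q"
  using proj_id[OF smooth_manifold_subspace[OF M]] chart_in_model by blast

lemma chart_in_chart_dom: "q \<in> V \<Longrightarrow> \<phi> q \<in> chart_dom M V \<phi>"
  by (simp add: chart_dom_def proj_chart)

lemma par_chart: "q \<in> V \<Longrightarrow> par M V \<phi> (\<phi> q) = q"
  by (simp add: par_def proj_chart inv_chart)

lemma par_in: "y \<in> chart_dom M V \<phi> \<Longrightarrow> par M V \<phi> y \<in> V"
  by (auto simp: par_def chart_dom_def intro: inv_into_into)

lemma chart_par: "y \<in> chart_dom M V \<phi> \<Longrightarrow> \<phi> (par M V \<phi> y) = proj (model M) y"
  by (auto simp: par_def chart_dom_def inv_chart)

lemma open_chart_dom: "open (chart_dom M V \<phi>)"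
proof -
  obtain T where T: "open T" "\<phi> ` V = T \<inter> model M"
    using chart_openin unfolding openin_open by auto
  have "chart_dom M V \<phi> = proj (model M) -` T"
    unfolding chart_dom_def T(2) using proj_in[OF smooth_manifold_subspace[OF M]] by auto
  then show ?thesis
    using T(1) linear_continuous_on[OF bounded_linear_proj[OF smooth_manifold_subspace[OF M]], of UNIV]
    by (simp add: continuous_on_open_vimage)
qed

lemma par_continuous: "continuous_on (chart_dom M V \<phi>) (par M V \<phi>)"
  unfolding par_def
proof (rule continuous_on_compose2[where g = "inv_into V \<phi>"])
  show "continuous_on (\<phi> ` V) (inv_into V \<phi>)"
    using chart_homeomorphism by (simp add: homeomorphism_def)
  show "continuous_on (chart_dom M V \<phi>) (proj (model M))"
    by (rule linear_continuous_on[OF bounded_linear_proj[OF smooth_manifold_subspace[OF M]]])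
qed (auto simp: chart_dom_def)

lemma rep_set_open:
  assumes "open U" "continuous_on U f" "open W"
  shows "open {y \<in> chart_dom M V \<phi>. par M V \<phi> y \<in> U \<and> f (par M V \<phi> y) \<in> W}"
proof -
  have "open (U \<inter> f -` W)" by (rule continuous_open_preimage[OF assms(2,1,3)])
  note open_vimage = continuous_open_preimage[OF par_continuous open_chart_dom this]
  have "{y \<in> chart_dom M V \<phi>. par M V \<phi> y \<in> U \<and> f (par M V \<phi> y) \<in> W} = chart_dom M V \<phi> \<inter> par M V \<phi> -` (U \<inter> f -` W)"
    by auto
  then show ?thesis using open_vimage by simp
qed

lemma rep_set_eq: "proj (model M) -` (\<phi> ` (U \<inter> V \<inter> f -` W)) =
    {y \<in> chart_dom M V \<phi>. par M V \<phi> y \<in> U \<and> f (par M V \<phi> y) \<in> W}" (is "?L = ?R")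
proof (intro equalityI subsetI)
  fix y assume "y \<in> ?L"
  then obtain q where q: "q \<in> U" "q \<in> V" "f q \<in> W" "proj (model M) y = \<phi> q" by auto
  then have "par M V \<phi> y = q" by (simp add: par_def inv_chart)
  with q show "y \<in> ?R" by (auto simp: chart_dom_def)
next
  fix y assume y: "y \<in> ?R"
  then have "proj (model M) y = \<phi> (par M V \<phi> y)" "par M V \<phi> y \<in> V" using chart_par par_in by auto
  with y show "y \<in> ?L" by auto
qed

lemma smooth_rep_iff:
  "smooth_on (model M) (\<phi> ` (U \<inter> V \<inter> f -` W)) (\<psi> \<circ> f \<circ> inv_into V \<phi>) \<longleftrightarrow>
   smooth_on UNIV {y \<in> chart_dom M V \<phi>. par M V \<phi> y \<in> U \<and> f (par M V \<phi> y) \<in> W} (\<lambda>y. \<psi> (f (par M V \<phi> y)))"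
proof -
  have "\<phi> ` (U \<inter> V \<inter> f -` W) \<subseteq> model M" using chart_in_model by auto
  from smooth_on_proj[OF smooth_manifold_subspace[OF M] this, of "\<psi> \<circ> f \<circ> inv_into V \<phi>"] show ?thesis
    unfolding rep_set_eq par_def comp_def .
qed

end

lemma smooth_map_on_iff:
  assumes M: "smooth_manifold M"
  shows "smooth_map_on M N U f \<longleftrightarrow> open U \<and> continuous_on U f \<and>
    (\<forall>V \<phi> W \<psi>. (V, \<phi>) \<in> atlas M \<longrightarrow> (W, \<psi>) \<in> atlas N \<longrightarrow>
      smooth_on UNIV {y \<in> chart_dom M V \<phi>. par M V \<phi> y \<in> U \<and> f (par M V \<phi> y) \<in> W} (\<lambda>y. \<psi> (f (par M V \<phi> y))))"
  unfolding smooth_map_on_def using smooth_rep_iff[OF M] by fastforce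

lemma smooth_map_onI:
  assumes "smooth_manifold M" "open U" "continuous_on U f"
    and "\<And>V \<phi> W \<psi>. (V, \<phi>) \<in> atlas M \<Longrightarrow> (W, \<psi>) \<in> atlas N \<Longrightarrow>
      smooth_on UNIV {y \<in> chart_dom M V \<phi>. par M V \<phi> y \<in> U \<and> f (par M V \<phi> y) \<in> W} (\<lambda>y. \<psi> (f (par M V \<phi> y)))"
  shows "smooth_map_on M N U f"
  using assms unfolding smooth_map_on_iff[OF assms(1)] by blast

lemma smooth_map_onD:
  assumes "smooth_map_on M N U f"
  shows smooth_map_on_open: "open U" and smooth_map_on_continuous: "continuous_on U f"
  using assms by (auto simp: smooth_map_on_def)

lemma smooth_map_on_rep:
  assumes "smooth_manifold M" "smooth_map_on M N U f" "(V, \<phi>) \<in> atlas M" "(W, \<psi>) \<in> atlas N"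
  shows "smooth_on UNIV {y \<in> chart_dom M V \<phi>. par M V \<phi> y \<in> U \<and> f (par M V \<phi> y) \<in> W} (\<lambda>y. \<psi> (f (par M V \<phi> y)))"
  using assms(2-4) unfolding smooth_map_on_iff[OF assms(1)] by blast

lemma smooth_map_on_subset:
  assumes "smooth_map_on M N U f" "open U'" "U' \<subseteq> U"
  shows "smooth_map_on M N U' f"
proof -
  have "smooth_on (model M) (\<phi> ` (U' \<inter> V \<inter> f -` W)) (\<psi> \<circ> f \<circ> inv_into V \<phi>)"
    if "(V, \<phi>) \<in> atlas M" "(W, \<psi>) \<in> atlas N" for V \<phi> W \<psi>
  proof (rule smooth_on_subset)
    show "smooth_on (model M) (\<phi> ` (U \<inter> V \<inter> f -` W)) (\<psi> \<circ> f \<circ> inv_into V \<phi>)"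
      using assms(1) that unfolding smooth_map_on_def by blast
  qed (use assms(3) in auto)
  moreover have "continuous_on U' f"
    using assms(3) smooth_map_on_continuous[OF assms(1)] continuous_on_subset by blast
  ultimately show ?thesis using assms(2) unfolding smooth_map_on_def by blast
qed

lemma smooth_map_on_cong:
  assumes M: "smooth_manifold M" and f: "smooth_map_on M N U f" and eq: "\<And>x. x \<in> U \<Longrightarrow> g x = f x"
  shows "smooth_map_on M N U g"
proof (rule smooth_map_onI[OF M smooth_map_on_open[OF f]])
  show "continuous_on U g"
    using smooth_map_on_continuous[OF f] eq by (simp cong: continuous_on_cong)
  fix V \<phi> W \<psi> assume "(V, \<phi>) \<in> atlas M" "(W, \<psi>) \<in> atlas N"
  from smooth_map_on_rep[OF M f this]
  show "smooth_on UNIV {y \<in> chart_dom M V \<phi>. par M V \<phi> y \<in> U \<and> g (par M V \<phi> y) \<in> W} (\<lambda>y. \<psi> (g (par M V \<phi> y)))"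
    by (rule smooth_on_cong[OF smooth_on_subset]) (auto simp: eq)
qed

lemma smooth_map_on_local:
  assumes M: "smooth_manifold M" and N: "smooth_manifold N" and U: "open U"
    and loc: "\<And>p. p \<in> U \<Longrightarrow> \<exists>U'. p \<in> U' \<and> smooth_map_on M N U' f"
  shows "smooth_map_on M N U f"
proof (rule smooth_map_onI[OF M U])
  show cont: "continuous_on U f"
  proof (intro continuous_at_imp_continuous_on ballI)
    fix p assume "p \<in> U"
    then obtain U' where U': "p \<in> U'" "smooth_map_on M N U' f" using loc by blast
    show "isCont f p"
      using smooth_map_onD[OF U'(2)] U'(1) by (simp add: continuous_on_eq_continuous_at)
  qed
  fix V \<phi> W \<psi> assume c: "(V, \<phi>) \<in> atlas M" "(W, \<psi>) \<in> atlas N"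
  let ?O = "\<lambda>U. {y \<in> chart_dom M V \<phi>. par M V \<phi> y \<in> U \<and> f (par M V \<phi> y) \<in> W}"
  show "smooth_on UNIV (?O U) (\<lambda>y. \<psi> (f (par M V \<phi> y)))"
  proof (rule smooth_on_local)
    show "open (?O U)" by (rule rep_set_open[OF M c(1) U cont chart_open[OF N c(2)]])
    fix y assume y: "y \<in> ?O U"
    then obtain U' where U': "par M V \<phi> y \<in> U'" "smooth_map_on M N U' f" using loc by blast
    have "open (?O U')"
      by (rule rep_set_open[OF M c(1) smooth_map_onD[OF U'(2)] chart_open[OF N c(2)]])
    moreover have "smooth_on UNIV (?O U \<inter> ?O U') (\<lambda>y. \<psi> (f (par M V \<phi> y)))"
      by (rule smooth_on_subset[OF smooth_map_on_rep[OF M U'(2) c]]) auto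
    ultimately show "\<exists>O'. open O' \<and> y \<in> O' \<and> smooth_on UNIV (?O U \<inter> O') (\<lambda>y. \<psi> (f (par M V \<phi> y)))"
      using y U'(1) by (intro exI[of _ "?O U'"]) auto
  qed
qed

text \<open>
  The chart in the middle is chosen for each point separately, since one chart need not contain the
  whole image.
\<close>

lemma smooth_map_on_comp:
  assumes M: "smooth_manifold M" and N: "smooth_manifold N" and K: "smooth_manifold K"
    and f: "smooth_map_on M N U f" and g: "smooth_map_on N K V g" and UV: "f ` U \<subseteq> V"
  shows "smooth_map_on M K U (\<lambda>q. g (f q))"
proof (rule smooth_map_onI[OF M])
  show U: "open U" by (rule smooth_map_on_open[OF f])
  show cont: "continuous_on U (\<lambda>q. g (f q))"
    by (rule continuous_on_compose2[OF smooth_map_on_continuous[OF g] smooth_map_on_continuous[OF f] UV])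
  fix A \<phi> C \<psi> assume A: "(A, \<phi>) \<in> atlas M" and C: "(C, \<psi>) \<in> atlas K"
  let ?O = "{y \<in> chart_dom M A \<phi>. par M A \<phi> y \<in> U \<and> g (f (par M A \<phi> y)) \<in> C}"
  show "smooth_on UNIV ?O (\<lambda>y. \<psi> (g (f (par M A \<phi> y))))"
  proof (rule smooth_on_local)
    show O: "open ?O" by (rule rep_set_open[OF M A U cont chart_open[OF K C]])
    fix y assume y: "y \<in> ?O"
    obtain B \<xi> where B: "(B, \<xi>) \<in> atlas N" "f (par M A \<phi> y) \<in> B" using chart_at[OF N] .
    let ?P = "{y \<in> chart_dom M A \<phi>. par M A \<phi> y \<in> U \<and> f (par M A \<phi> y) \<in> B}"
    let ?Q = "{z \<in> chart_dom N B \<xi>. par N B \<xi> z \<in> V \<and> g (par N B \<xi> z) \<in> C}"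
    have P: "open ?P"
      by (rule rep_set_open[OF M A smooth_map_onD[OF f] chart_open[OF N B(1)]])
    have Q: "open ?Q"
      by (rule rep_set_open[OF N B(1) smooth_map_onD[OF g] chart_open[OF K C]])
    have "smooth_on UNIV (?O \<inter> ?P) (\<lambda>y. (\<lambda>z. \<psi> (g (par N B \<xi> z))) (\<xi> (f (par M A \<phi> y))))"
    proof (rule smooth_on_comp[OF open_Int[OF O P] Q _ smooth_map_on_rep[OF N g B(1) C]])
      show "smooth_on UNIV (?O \<inter> ?P) (\<lambda>y. \<xi> (f (par M A \<phi> y)))"
        by (rule smooth_on_subset[OF smooth_map_on_rep[OF M f A B(1)]]) auto
      show "(\<lambda>y. \<xi> (f (par M A \<phi> y))) ` (?O \<inter> ?P) \<subseteq> ?Q"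
        using UV by (auto simp: chart_in_chart_dom[OF N B(1)] par_chart[OF N B(1)])
    qed
    then have "smooth_on UNIV (?O \<inter> ?P) (\<lambda>y. \<psi> (g (f (par M A \<phi> y))))"
      by (rule smooth_on_cong) (auto simp: par_chart[OF N B(1)])
    then show "\<exists>O'. open O' \<and> y \<in> O' \<and> smooth_on UNIV (?O \<inter> O') (\<lambda>y. \<psi> (g (f (par M A \<phi> y))))"
      using y B(2) P by (intro exI[of _ ?P]) auto
  qed
qed

lemma smooth_map_on_const: "smooth_map_on M N UNIV (\<lambda>q. c)"
  unfolding smooth_map_on_def
  by (auto intro: smooth_on_cong[OF smooth_on_const])

lemma smooth_map_on_ident: "smooth_manifold M \<Longrightarrow> smooth_map_on M M UNIV (\<lambda>q. q)"
  unfolding smooth_map_on_def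
  using chart_transition[of M] by (fastforce simp: comp_def)

subsection \<open>Vector spaces and products as manifolds\<close>

text \<open>
  Treating Euclidean spaces as manifolds makes functions, curves, charts and parametrisations instances
  of smooth maps, so that one composition lemma covers them all.
\<close>

definition euclid :: "('e, 'e) manifold" where
  "euclid = \<lparr> model = UNIV, atlas = {(UNIV, \<lambda>x. x)} \<rparr>"

lemma real_line_eq_euclid: "real_line = euclid"
  by (simp add: real_line_def euclid_def)

lemma model_euclid [simp]: "model euclid = UNIV" and atlas_euclid [simp]: "atlas euclid = {(UNIV, \<lambda>x. x)}"
  by (simp_all add: euclid_def)

lemma smooth_manifold_euclid [simp]: "smooth_manifold (euclid :: ('e::euclidean_space, 'e) manifold)"
  by (auto simp: smooth_manifold_def homeomorphism_def comp_def)

lemma chart_dom_euclid [simp]: "chart_dom euclid UNIV (\<lambda>x. x) = UNIV"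
  and par_euclid [simp]: "par euclid UNIV (\<lambda>x. x) = (\<lambda>x. x)"
  by (auto simp: chart_dom_def par_def)

lemma smooth_map_on_euclid:
  assumes M: "smooth_manifold M"
  shows "smooth_map_on M (euclid :: ('f::euclidean_space, 'f) manifold) U f \<longleftrightarrow> open U \<and> continuous_on U f \<and>
    (\<forall>V \<phi>. (V, \<phi>) \<in> atlas M \<longrightarrow> smooth_on UNIV {y \<in> chart_dom M V \<phi>. par M V \<phi> y \<in> U} (\<lambda>y. f (par M V \<phi> y)))"
  unfolding smooth_map_on_iff[OF M] by simp

lemma smooth_map_on_euclid_euclid:
  fixes f :: "'e::euclidean_space \<Rightarrow> 'f::euclidean_space"
  shows "smooth_map_on euclid euclid U f \<longleftrightarrow> open U \<and> smooth_on UNIV U f"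
  unfolding smooth_map_on_euclid[OF smooth_manifold_euclid] by (auto dest: smooth_on_imp_continuous)

lemma smooth_map_on_chart:
  assumes M: "smooth_manifold M" and c: "(V, \<phi>) \<in> atlas M"
  shows "smooth_map_on M euclid V \<phi>"
proof -
  have "smooth_on (model M) (\<psi> ` (V \<inter> W \<inter> \<phi> -` UNIV)) ((\<lambda>x. x) \<circ> \<phi> \<circ> inv_into W \<psi>)" if W: "(W, \<psi>) \<in> atlas M" for W \<psi>
    using chart_transition[OF M W c] by (simp add: comp_def Int_commute)
  then show ?thesis
    using chart_open[OF M c] chart_continuous[OF M c] unfolding smooth_map_on_def atlas_euclid by fastforce
qed

lemma smooth_map_on_par:
  assumes M: "smooth_manifold M" and c: "(V, \<phi>) \<in> atlas M"
  shows "smooth_map_on euclid M (chart_dom M V \<phi>) (par M V \<phi>)"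
proof (rule smooth_map_onI[OF smooth_manifold_euclid open_chart_dom[OF M c] par_continuous[OF M c]], goal_cases)
  case (1 A \<xi> W \<psi>)
  have "smooth_on (model M) (\<phi> ` (UNIV \<inter> V \<inter> (\<lambda>x. x) -` W)) (\<psi> \<circ> (\<lambda>x. x) \<circ> inv_into V \<phi>)"
    using chart_transition[OF M c 1(2)] by (simp add: comp_def)
  from this[unfolded smooth_rep_iff[OF M c]] show ?case using 1(1) by simp
qed

lemma smooth_map_on_Pair:
  assumes "smooth_map_on K M U f" "smooth_map_on K N U g"
  shows "smooth_map_on K (prod_manifold M N) U (\<lambda>q. (f q, g q))"
proof -
  have "smooth_on (model K) (\<phi> ` (U \<inter> V \<inter> (\<lambda>q. (f q, g q)) -` W)) (\<psi> \<circ> (\<lambda>q. (f q, g q)) \<circ> inv_into V \<phi>)"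
    if K: "(V, \<phi>) \<in> atlas K" and WN: "(W, \<psi>) \<in> atlas (prod_manifold M N)" for V \<phi> W \<psi>
  proof -
    obtain W1 \<psi>1 W2 \<psi>2 where W: "W = W1 \<times> W2" "\<psi> = map_prod \<psi>1 \<psi>2" "(W1, \<psi>1) \<in> atlas M" "(W2, \<psi>2) \<in> atlas N"
      using WN by (auto simp: prod_manifold_def)
    let ?S = "\<phi> ` (U \<inter> V \<inter> (\<lambda>q. (f q, g q)) -` W)"
    have "smooth_on (model K) (\<phi> ` (U \<inter> V \<inter> f -` W1)) (\<psi>1 \<circ> f \<circ> inv_into V \<phi>)"
      "smooth_on (model K) (\<phi> ` (U \<inter> V \<inter> g -` W2)) (\<psi>2 \<circ> g \<circ> inv_into V \<phi>)"
      using assms K W unfolding smooth_map_on_def by blast+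
    then have "smooth_on (model K) ?S (\<psi>1 \<circ> f \<circ> inv_into V \<phi>)" "smooth_on (model K) ?S (\<psi>2 \<circ> g \<circ> inv_into V \<phi>)"
      by (auto intro: smooth_on_subset simp: W(1))
    from smooth_on_Pair[OF this] show ?thesis by (rule smooth_on_cong) (simp add: W)
  qed
  moreover have "continuous_on U (\<lambda>q. (f q, g q))"
    by (rule continuous_on_Pair[OF smooth_map_on_continuous[OF assms(1)] smooth_map_on_continuous[OF assms(2)]])
  ultimately show ?thesis using smooth_map_on_open[OF assms(1)] unfolding smooth_map_on_def by blast
qed

lemma prod_euclid: "prod_manifold euclid euclid = euclid"
  by (simp add: prod_manifold_def euclid_def)

lemma inv_into_map_prod:
  assumes "inj_on \<phi> V" "inj_on \<psi> W" "x \<in> \<phi> ` V" "y \<in> \<psi> ` W"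
  shows "inv_into (V \<times> W) (map_prod \<phi> \<psi>) (x, y) = (inv_into V \<phi> x, inv_into W \<psi> y)"
proof (rule inv_into_f_eq)
  show "inj_on (map_prod \<phi> \<psi>) (V \<times> W)" using assms(1,2) by (rule map_prod_inj_on)
qed (use assms in \<open>auto intro: inv_into_into f_inv_into_f\<close>)

lemma smooth_manifold_prod:
  fixes M :: "('a::{t2_space,second_countable_topology}, 'e::euclidean_space) manifold"
    and N :: "('b::{t2_space,second_countable_topology}, 'f::euclidean_space) manifold"
  assumes M: "smooth_manifold M" and N: "smooth_manifold N"
  shows "smooth_manifold (prod_manifold M N)"
proof -
  have 1: "subspace (model M \<times> model N)"
    using subspace_Times smooth_manifold_subspace[OF M] smooth_manifold_subspace[OF N] by blast
  have cover: "\<exists>U \<phi>. (U, \<phi>) \<in> atlas (prod_manifold M N) \<and> pq \<in> U" for pq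
  proof -
    obtain V \<phi> where V: "(V, \<phi>) \<in> atlas M" "fst pq \<in> V" using chart_at[OF M] .
    obtain W \<psi> where W: "(W, \<psi>) \<in> atlas N" "snd pq \<in> W" using chart_at[OF N] .
    show ?thesis using V W by (intro exI[of _ "V \<times> W"] exI[of _ "map_prod \<phi> \<psi>"])
      (auto simp: prod_manifold_def mem_Times_iff)
  qed
  have 2: "open (V \<times> W) \<and> openin (top_of_set (model M \<times> model N)) (map_prod \<phi> \<psi> ` (V \<times> W)) \<and>
      homeomorphism (V \<times> W) (map_prod \<phi> \<psi> ` (V \<times> W)) (map_prod \<phi> \<psi>) (inv_into (V \<times> W) (map_prod \<phi> \<psi>))"
    if V: "(V, \<phi>) \<in> atlas M" and W: "(W, \<psi>) \<in> atlas N" for V W \<phi> \<psi>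
  proof (intro conjI)
    have im: "map_prod \<phi> \<psi> ` (V \<times> W) = \<phi> ` V \<times> \<psi> ` W" by (rule map_prod_image)
    show "open (V \<times> W)" using chart_open[OF M V] chart_open[OF N W] by (rule open_Times)
    show "openin (top_of_set (model M \<times> model N)) (map_prod \<phi> \<psi> ` (V \<times> W))"
      unfolding im using chart_openin[OF M V] chart_openin[OF N W] by (rule openin_Times)
    note inj = map_prod_inj_on[OF chart_inj[OF M V] chart_inj[OF N W]]
    have cinv: "continuous_on (\<phi> ` V) (inv_into V \<phi>)" "continuous_on (\<psi> ` W) (inv_into W \<psi>)"
      using chart_homeomorphism[OF M V] chart_homeomorphism[OF N W] by (simp_all add: homeomorphism_def)
    have "continuous_on (\<phi> ` V \<times> \<psi> ` W) (\<lambda>z. (inv_into V \<phi> (fst z), inv_into W \<psi> (snd z)))"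
      by (intro continuous_on_Pair continuous_on_compose2[OF cinv(1)] continuous_on_compose2[OF cinv(2)]
          continuous_on_fst continuous_on_snd continuous_on_id) auto
    then have cinv: "continuous_on (\<phi> ` V \<times> \<psi> ` W) (inv_into (V \<times> W) (map_prod \<phi> \<psi>))"
      by (rule continuous_on_eq) (auto simp: inv_into_map_prod[OF chart_inj[OF M V] chart_inj[OF N W]])
    have "continuous_on (V \<times> W) (\<lambda>z. (\<phi> (fst z), \<psi> (snd z)))"
      by (intro continuous_on_Pair continuous_on_compose2[OF chart_continuous[OF M V]]
          continuous_on_compose2[OF chart_continuous[OF N W]] continuous_on_fst continuous_on_snd continuous_on_id) auto
    then have cm: "continuous_on (V \<times> W) (map_prod \<phi> \<psi>)"
      by (simp add: map_prod_def case_prod_beta')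
    show "homeomorphism (V \<times> W) (map_prod \<phi> \<psi> ` (V \<times> W)) (map_prod \<phi> \<psi>) (inv_into (V \<times> W) (map_prod \<phi> \<psi>))"
      by (rule homeomorphismI[OF cm cinv[folded im]])
        (use inv_into_f_f[OF inj] f_inv_into_f inv_into_into in \<open>fastforce\<close>)+
  qed
  have 3: "smooth_on (model M \<times> model N) (map_prod \<phi> \<psi> ` ((V \<times> W) \<inter> (V' \<times> W'))) (map_prod \<phi>' \<psi>' \<circ> inv_into (V \<times> W) (map_prod \<phi> \<psi>))"
    if V: "(V, \<phi>) \<in> atlas M" and W: "(W, \<psi>) \<in> atlas N" and V': "(V', \<phi>') \<in> atlas M" and W': "(W', \<psi>') \<in> atlas N"
    for V W \<phi> \<psi> V' W' \<phi>' \<psi>'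
  proof -
    have im: "map_prod \<phi> \<psi> ` ((V \<times> W) \<inter> (V' \<times> W')) = \<phi> ` (V \<inter> V') \<times> \<psi> ` (W \<inter> W')"
      by (simp add: Times_Int_Times map_prod_image)
    let ?S = "\<phi> ` (V \<inter> V') \<times> \<psi> ` (W \<inter> W')"
    have "smooth_on (model M \<times> model N) ?S (\<lambda>z. ((\<phi>' \<circ> inv_into V \<phi>) (fst z), (\<psi>' \<circ> inv_into W \<psi>) (snd z)))"
      by (intro smooth_on_Pair smooth_on_linear_precomp[OF bounded_linear_fst chart_transition[OF M V V']]
          smooth_on_linear_precomp[OF bounded_linear_snd chart_transition[OF N W W']]) auto
    then have "smooth_on (model M \<times> model N) ?S (map_prod \<phi>' \<psi>' \<circ> inv_into (V \<times> W) (map_prod \<phi> \<psi>))"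
      by (rule smooth_on_cong) (auto simp: inv_into_map_prod[OF chart_inj[OF M V] chart_inj[OF N W]])
    then show ?thesis by (simp only: im)
  qed
  have at: "atlas (prod_manifold M N) =
      {(U \<times> V, map_prod \<phi> \<psi>) | U \<phi> V \<psi>. (U, \<phi>) \<in> atlas M \<and> (V, \<psi>) \<in> atlas N}"
    and mo: "model (prod_manifold M N) = model M \<times> model N"
    by (simp_all add: prod_manifold_def)
  show ?thesis
    unfolding smooth_manifold_def mo
  proof (intro conjI ballI)
    show "(\<Union>(U, \<phi>)\<in>atlas (prod_manifold M N). U) = UNIV" using cover by fast
  next
    fix c assume "c \<in> atlas (prod_manifold M N)"
    then show "case c of (U, \<phi>) \<Rightarrow> open U \<and> openin (top_of_set (model M \<times> model N)) (\<phi> ` U) \<and>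
        homeomorphism U (\<phi> ` U) \<phi> (inv_into U \<phi>)"
      unfolding at using 2 by fastforce
  next
    fix c assume c: "c \<in> atlas (prod_manifold M N)"
    show "case c of (U, \<phi>) \<Rightarrow> \<forall>(V, \<psi>)\<in>atlas (prod_manifold M N).
        smooth_on (model M \<times> model N) (\<phi> ` (U \<inter> V)) (\<psi> \<circ> inv_into U \<phi>)"
      using c unfolding at using 3 by fastforce
  qed (rule 1)
qed

lemma smooth_map_on_fst:
  fixes M :: "('a::{t2_space,second_countable_topology}, 'e::euclidean_space) manifold"
    and N :: "('b::{t2_space,second_countable_topology}, 'f::euclidean_space) manifold"
  assumes M: "smooth_manifold M" and N: "smooth_manifold N"
  shows "smooth_map_on (prod_manifold M N) M UNIV fst"
proof -
  have "smooth_on (model M \<times> model N) (map_prod \<phi> \<psi> ` (UNIV \<inter> (V \<times> W) \<inter> fst -` U)) (\<xi> \<circ> fst \<circ> inv_into (V \<times> W) (map_prod \<phi> \<psi>))"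
    if V: "(V, \<phi>) \<in> atlas M" and W: "(W, \<psi>) \<in> atlas N" and U: "(U, \<xi>) \<in> atlas M" for V W U \<phi> \<psi> \<xi>
  proof -
    have "smooth_on (model M \<times> model N) (map_prod \<phi> \<psi> ` (UNIV \<inter> (V \<times> W) \<inter> fst -` U)) (\<lambda>z. (\<xi> \<circ> inv_into V \<phi>) (fst z))"
      by (rule smooth_on_linear_precomp[OF bounded_linear_fst chart_transition[OF M V U]]) auto
    then show ?thesis
      by (rule smooth_on_cong) (auto simp: inv_into_map_prod[OF chart_inj[OF M V] chart_inj[OF N W]])
  qed
  then show ?thesis
    unfolding smooth_map_on_def by (auto simp: prod_manifold_def intro: continuous_intros)
qed

lemma smooth_map_on_snd:
  fixes M :: "('a::{t2_space,second_countable_topology}, 'e::euclidean_space) manifold"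
    and N :: "('b::{t2_space,second_countable_topology}, 'f::euclidean_space) manifold"
  assumes M: "smooth_manifold M" and N: "smooth_manifold N"
  shows "smooth_map_on (prod_manifold M N) N UNIV snd"
proof -
  have "smooth_on (model M \<times> model N) (map_prod \<phi> \<psi> ` (UNIV \<inter> (V \<times> W) \<inter> snd -` U)) (\<xi> \<circ> snd \<circ> inv_into (V \<times> W) (map_prod \<phi> \<psi>))"
    if V: "(V, \<phi>) \<in> atlas M" and W: "(W, \<psi>) \<in> atlas N" and U: "(U, \<xi>) \<in> atlas N" for V W U \<phi> \<psi> \<xi>
  proof -
    have "smooth_on (model M \<times> model N) (map_prod \<phi> \<psi> ` (UNIV \<inter> (V \<times> W) \<inter> snd -` U)) (\<lambda>z. (\<xi> \<circ> inv_into W \<psi>) (snd z))"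
      by (rule smooth_on_linear_precomp[OF bounded_linear_snd chart_transition[OF N W U]]) auto
    then show ?thesis
      by (rule smooth_on_cong) (auto simp: inv_into_map_prod[OF chart_inj[OF M V] chart_inj[OF N W]])
  qed
  then show ?thesis
    unfolding smooth_map_on_def by (auto simp: prod_manifold_def intro: continuous_intros)
qed

lemma smooth_map_on_smooth_comp:
  fixes H :: "'f::euclidean_space \<Rightarrow> 'h::euclidean_space"
  assumes M: "smooth_manifold M" and f: "smooth_map_on M euclid U f"
    and H: "smooth_on UNIV W H" "open W" "f ` U \<subseteq> W"
  shows "smooth_map_on M euclid U (\<lambda>q. H (f q))"
proof -
  have "smooth_map_on euclid euclid W H" using H by (simp add: smooth_map_on_euclid_euclid)
  from smooth_map_on_comp[OF M _ _ f this H(3)] show ?thesis by simp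
qed

lemma smooth_map_on_bounded_linear:
  fixes L :: "'f::euclidean_space \<Rightarrow> 'h::euclidean_space"
  assumes M: "smooth_manifold M" and f: "smooth_map_on M euclid U f" and L: "bounded_linear L"
  shows "smooth_map_on M euclid U (\<lambda>q. L (f q))"
  by (rule smooth_map_on_smooth_comp[OF M f smooth_on_linear[OF L] open_UNIV]) simp

lemma smooth_map_on_bounded_bilinear:
  fixes B :: "'f::euclidean_space \<Rightarrow> 'g::euclidean_space \<Rightarrow> 'h::euclidean_space"
  assumes M: "smooth_manifold M" and f: "smooth_map_on M euclid U f" and g: "smooth_map_on M euclid U g"
    and B: "bounded_bilinear B"
  shows "smooth_map_on M euclid U (\<lambda>q. B (f q) (g q))"
proof -
  have fg: "smooth_map_on M euclid U (\<lambda>q. (f q, g q))"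
    using smooth_map_on_Pair[OF f g] by (simp only: prod_euclid)
  have "smooth_on UNIV UNIV (\<lambda>z. B (fst z) (snd z))"
    by (intro smooth_on_bounded_bilinear[OF B] smooth_on_linear bounded_linear_fst bounded_linear_snd)
  from smooth_map_on_smooth_comp[OF M fg this open_UNIV] show ?thesis by simp
qed

lemma smooth_map_on_add:
  fixes f g :: "'a::{t2_space,second_countable_topology} \<Rightarrow> 'f::euclidean_space"
  assumes M: "smooth_manifold M" and f: "smooth_map_on M euclid U f" and g: "smooth_map_on M euclid U g"
  shows "smooth_map_on M euclid U (\<lambda>q. f q + g q)"
proof -
  have fg: "smooth_map_on M euclid U (\<lambda>q. (f q, g q))"
    using smooth_map_on_Pair[OF f g] by (simp only: prod_euclid)
  have "bounded_linear (\<lambda>z::'f \<times> 'f. fst z + snd z)"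
    by (intro bounded_linear_add bounded_linear_fst bounded_linear_snd)
  from smooth_map_on_bounded_linear[OF M fg this] show ?thesis by simp
qed

lemma smooth_map_on_sum:
  fixes f :: "'i \<Rightarrow> 'a::{t2_space,second_countable_topology} \<Rightarrow> 'f::euclidean_space"
  assumes M: "smooth_manifold M" and U: "open U" and f: "\<And>i. i \<in> I \<Longrightarrow> smooth_map_on M euclid U (f i)"
  shows "smooth_map_on M euclid U (\<lambda>q. \<Sum>i\<in>I. f i q)"
  using f
proof (induction I rule: infinite_finite_induct)
  case (insert i I)
  have "smooth_map_on M euclid U (\<lambda>q. f i q + (\<Sum>i\<in>I. f i q))"
    by (rule smooth_map_on_add[OF M]) (use insert in auto)
  then show ?case using insert by simp
qed (simp_all add: smooth_map_on_subset[OF smooth_map_on_const U])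

section \<open>Tangent vectors through curves and charts\<close>

text \<open>
  Germs of smooth maps: compositions need no bookkeeping of domains.
\<close>

definition smooth_at ::
  "('a::topological_space, 'e::real_normed_vector) manifold \<Rightarrow>
   ('b::topological_space, 'f::real_normed_vector) manifold \<Rightarrow> 'a \<Rightarrow> ('a \<Rightarrow> 'b) \<Rightarrow> bool" where
  "smooth_at M N p F \<longleftrightarrow> (\<exists>U. p \<in> U \<and> smooth_map_on M N U F)"

lemma smooth_near_eq: "smooth_near M p f = smooth_at M euclid p f"
  by (simp add: smooth_near_def smooth_at_def real_line_eq_euclid)

lemma smooth_atI: "smooth_map_on M N U F \<Longrightarrow> p \<in> U \<Longrightarrow> smooth_at M N p F"
  by (auto simp: smooth_at_def)

lemma smooth_at_const: "smooth_at M N p (\<lambda>q. c)"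
  using smooth_atI[OF smooth_map_on_const] by blast

lemma smooth_at_ident: "smooth_manifold M \<Longrightarrow> smooth_at M M p (\<lambda>q. q)"
  using smooth_atI[OF smooth_map_on_ident] by blast

lemma smooth_map_on_restrict:
  assumes F: "smooth_map_on M N U F" and W: "open W"
  shows "smooth_map_on M N (U \<inter> F -` W) F"
  by (rule smooth_map_on_subset[OF F continuous_open_preimage[OF smooth_map_on_continuous[OF F] smooth_map_on_open[OF F] W]])
     simp

lemma smooth_at_comp:
  assumes M: "smooth_manifold M" and N: "smooth_manifold N" and K: "smooth_manifold K"
    and F: "smooth_at M N p F" and G: "smooth_at N K (F p) G"
  shows "smooth_at M K p (\<lambda>q. G (F q))"
proof -
  obtain U where U: "p \<in> U" "smooth_map_on M N U F" using F smooth_at_def by blast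
  obtain W where W: "F p \<in> W" "smooth_map_on N K W G" using G smooth_at_def by blast
  have "smooth_map_on M K (U \<inter> F -` W) (\<lambda>q. G (F q))"
    by (rule smooth_map_on_comp[OF M N K smooth_map_on_restrict[OF U(2) smooth_map_on_open[OF W(2)]] W(2)]) auto
  then show ?thesis by (rule smooth_atI) (use U W in auto)
qed

lemma smooth_at_Pair:
  assumes "smooth_at K M p f" "smooth_at K N p g"
  shows "smooth_at K (prod_manifold M N) p (\<lambda>q. (f q, g q))"
proof -
  obtain U where U: "p \<in> U" "smooth_map_on K M U f" using assms smooth_at_def by blast
  obtain W where W: "p \<in> W" "smooth_map_on K N W g" using assms smooth_at_def by blast
  have OO: "open (U \<inter> W)" by (rule open_Int[OF smooth_map_on_open[OF U(2)] smooth_map_on_open[OF W(2)]])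
  show ?thesis
    by (rule smooth_atI[OF smooth_map_on_Pair[OF smooth_map_on_subset[OF U(2) OO] smooth_map_on_subset[OF W(2) OO]]])
       (use U W in auto)
qed

lemma smooth_at_comp2:
  fixes A :: "('a::{t2_space,second_countable_topology}, 'e::euclidean_space) manifold"
    and B :: "('b::{t2_space,second_countable_topology}, 'f::euclidean_space) manifold"
  assumes S: "smooth_manifold S" and A: "smooth_manifold A" and B: "smooth_manifold B" and C: "smooth_manifold C"
    and F: "smooth_at S A p F" and H: "smooth_at S B p H"
    and \<Psi>: "smooth_at (prod_manifold A B) C (F p, H p) (\<lambda>z. \<Psi> (fst z) (snd z))"
  shows "smooth_at S C p (\<lambda>q. \<Psi> (F q) (H q))"
  using smooth_at_comp[OF S smooth_manifold_prod[OF A B] C smooth_at_Pair[OF F H] \<Psi>] by simp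

lemma smooth_at_fst: 
  fixes A :: "('a::{t2_space,second_countable_topology}, 'e::euclidean_space) manifold"
    and B :: "('b::{t2_space,second_countable_topology}, 'f::euclidean_space) manifold"
  assumes "smooth_manifold A" "smooth_manifold B" shows "smooth_at (prod_manifold A B) A z fst"
  using smooth_atI[OF smooth_map_on_fst[OF assms]] by blast

lemma smooth_at_snd:
  fixes A :: "('a::{t2_space,second_countable_topology}, 'e::euclidean_space) manifold"
    and B :: "('b::{t2_space,second_countable_topology}, 'f::euclidean_space) manifold"
  assumes "smooth_manifold A" "smooth_manifold B" shows "smooth_at (prod_manifold A B) B z snd"
  using smooth_atI[OF smooth_map_on_snd[OF assms]] by blast

lemma smooth_at_swap:
  fixes A :: "('a::{t2_space,second_countable_topology}, 'e::euclidean_space) manifold"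
    and B :: "('b::{t2_space,second_countable_topology}, 'f::euclidean_space) manifold"
  assumes A: "smooth_manifold A" and B: "smooth_manifold B" and C: "smooth_manifold C"
    and \<Psi>: "smooth_at (prod_manifold A B) C (a, b) (\<lambda>z. \<Psi> (fst z) (snd z))"
  shows "smooth_at (prod_manifold B A) C (b, a) (\<lambda>z. \<Psi> (snd z) (fst z))"
  by (rule smooth_at_comp2[OF smooth_manifold_prod[OF B A] A B C smooth_at_snd[OF B A] smooth_at_fst[OF B A], where \<Psi> = \<Psi>])
     (simp add: \<Psi>)

lemma smooth_at_bounded_linear:
  fixes L :: "'f::euclidean_space \<Rightarrow> 'h::euclidean_space"
  assumes "smooth_manifold M" "smooth_at M euclid p f" "bounded_linear L"
  shows "smooth_at M euclid p (\<lambda>q. L (f q))"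
  using assms smooth_map_on_bounded_linear unfolding smooth_at_def by blast

lemma smooth_at_bounded_bilinear:
  fixes B :: "'f::euclidean_space \<Rightarrow> 'g::euclidean_space \<Rightarrow> 'h::euclidean_space"
  assumes M: "smooth_manifold M" and f: "smooth_at M euclid p f" and g: "smooth_at M euclid p g"
    and B: "bounded_bilinear B"
  shows "smooth_at M euclid p (\<lambda>q. B (f q) (g q))"
proof -
  obtain U where U: "p \<in> U" "smooth_map_on M euclid U f" using f smooth_at_def by blast
  obtain W where W: "p \<in> W" "smooth_map_on M euclid W g" using g smooth_at_def by blast
  have OO: "open (U \<inter> W)" by (rule open_Int[OF smooth_map_on_open[OF U(2)] smooth_map_on_open[OF W(2)]])
  show ?thesis
    by (rule smooth_atI[OF smooth_map_on_bounded_bilinear[OF M smooth_map_on_subset[OF U(2) OO] smooth_map_on_subset[OF W(2) OO] B]])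
       (use U W in auto)
qed

lemma smooth_at_add:
  fixes f g :: "'a::{t2_space,second_countable_topology} \<Rightarrow> 'f::euclidean_space"
  assumes M: "smooth_manifold M" and f: "smooth_at M euclid p f" and g: "smooth_at M euclid p g"
  shows "smooth_at M euclid p (\<lambda>q. f q + g q)"
proof -
  obtain U where U: "p \<in> U" "smooth_map_on M euclid U f" using f smooth_at_def by blast
  obtain W where W: "p \<in> W" "smooth_map_on M euclid W g" using g smooth_at_def by blast
  have OO: "open (U \<inter> W)" by (rule open_Int[OF smooth_map_on_open[OF U(2)] smooth_map_on_open[OF W(2)]])
  show ?thesis
    by (rule smooth_atI[OF smooth_map_on_add[OF M smooth_map_on_subset[OF U(2) OO] smooth_map_on_subset[OF W(2) OO]]])
       (use U W in auto)
qed

lemma smooth_at_euclid_obtain: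
  fixes f :: "'e::euclidean_space \<Rightarrow> 'f::euclidean_space"
  assumes "smooth_at euclid euclid p f"
  obtains U where "open U" "p \<in> U" "smooth_on UNIV U f"
  using assms unfolding smooth_at_def smooth_map_on_euclid_euclid by blast

lemma smooth_at_euclid_has_derivative:
  fixes f :: "'e::euclidean_space \<Rightarrow> 'f::euclidean_space"
  assumes "smooth_at euclid euclid p f"
  shows "(f has_derivative frechet_derivative f (at p)) (at p)"
  using smooth_at_euclid_obtain[OF assms] smooth_on_has_derivative by metis

lemma smooth_at_euclid_curve_derivative:
  fixes f :: "'e::euclidean_space \<Rightarrow> real"
  assumes f: "smooth_at euclid euclid (\<gamma> t) f" and \<gamma>: "(\<gamma> has_vector_derivative w) (at t)"
  shows "((\<lambda>s. f (\<gamma> s)) has_real_derivative frechet_derivative f (at (\<gamma> t)) w) (at t)"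
proof -
  obtain U where "open U" "\<gamma> t \<in> U" "smooth_on UNIV U f" by (rule smooth_at_euclid_obtain[OF f])
  from smooth_on_real_derivative[OF this(1,3,2) \<gamma> refl] show ?thesis .
qed

subsection \<open>Tangent vectors as velocities\<close>

lemma velocity_has_derivative:
  fixes M :: "('a::{t2_space,second_countable_topology}, 'e::euclidean_space) manifold"
  assumes M: "smooth_manifold M" and \<gamma>: "smooth_at euclid M t \<gamma>" and f: "smooth_near M (\<gamma> t) f"
  shows "((\<lambda>s. f (\<gamma> s)) has_real_derivative velocity M \<gamma> t f) (at t)"
proof -
  have "smooth_at euclid euclid t (\<lambda>s. f (\<gamma> s))"
    using smooth_at_comp[OF smooth_manifold_euclid M smooth_manifold_euclid \<gamma>] f by (simp add: smooth_near_eq)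
  from smooth_at_euclid_curve_derivative[OF this has_vector_derivative_id]
  have "((\<lambda>s. f (\<gamma> s)) has_real_derivative deriv (\<lambda>s. f (\<gamma> s)) t) (at t)"
    by (simp add: DERIV_imp_deriv)
  then show ?thesis using f by (simp add: velocity_def)
qed

lemma velocity_in_tangent_space:
  fixes M :: "('a::{t2_space,second_countable_topology}, 'e::euclidean_space) manifold"
  assumes \<gamma>: "smooth_at euclid M 0 \<gamma>"
  shows "velocity M \<gamma> 0 \<in> tangent_space M (\<gamma> 0)"
proof -
  obtain U where U: "0 \<in> U" "smooth_map_on euclid M U \<gamma>" using \<gamma> smooth_at_def by blast
  obtain e where e: "e > 0" "\<And>t. dist t 0 < e \<Longrightarrow> t \<in> U"
    using smooth_map_on_open[OF U(2)] U(1) unfolding open_dist by blast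
  have "{-e<..<e} \<subseteq> U" using e(2) by (auto simp: dist_real_def)
  then have "smooth_map_on real_line M {-e<..<e} \<gamma>"
    unfolding real_line_eq_euclid by (intro smooth_map_on_subset[OF U(2)]) auto
  then show ?thesis using e(1) unfolding tangent_space_def by blast
qed

text \<open>
  The algebraic rules for tangent vectors follow from those for real functions along such a curve.
\<close>

lemma tangent_curve:
  fixes M :: "('a::{t2_space,second_countable_topology}, 'e::euclidean_space) manifold"
  assumes M: "smooth_manifold M" and X: "X \<in> tangent_space M p"
  shows "\<exists>\<gamma>. \<gamma> 0 = p \<and> smooth_at euclid M 0 \<gamma> \<and>
    (\<forall>f. smooth_near M p f \<longrightarrow> ((\<lambda>s. f (\<gamma> s)) has_real_derivative X f) (at 0))"
proof -
  obtain \<gamma> e where \<gamma>: "X = velocity M \<gamma> 0" "\<gamma> 0 = p" "e > 0" "smooth_map_on real_line M {-e<..<e} \<gamma>"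
    using X unfolding tangent_space_def by blast
  have s: "smooth_at euclid M 0 \<gamma>"
    by (rule smooth_atI[OF \<gamma>(4)[unfolded real_line_eq_euclid]]) (use \<gamma>(3) in simp)
  show ?thesis
    using \<gamma>(2) s velocity_has_derivative[OF M s] unfolding \<gamma>(1) by blast
qed

lemma tangent_not_smooth:
  assumes "X \<in> tangent_space M p" "\<not> smooth_near M p f"
  shows "X f = 0"
  using assms unfolding tangent_space_def velocity_def by auto

context
  fixes M :: "('a::{t2_space,second_countable_topology}, 'e::euclidean_space) manifold" and X p
  assumes M: "smooth_manifold M" and X: "X \<in> tangent_space M p"
begin

lemma tangent_const: "X (\<lambda>q. c) = 0"
proof -
  have "smooth_near M p (\<lambda>q. c)" unfolding smooth_near_eq by (rule smooth_at_const)
  note sm = this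
  obtain \<gamma> where "\<gamma> 0 = p" "smooth_at euclid M 0 \<gamma>"
    and \<gamma>: "\<And>f. smooth_near M p f \<Longrightarrow> ((\<lambda>s. f (\<gamma> s)) has_real_derivative X f) (at 0)"
    using tangent_curve[OF M X] by blast
  show ?thesis by (rule DERIV_unique[OF \<gamma>[OF sm] DERIV_const])
qed

lemma tangent_add:
  assumes f: "smooth_near M p f" and g: "smooth_near M p g"
  shows "X (\<lambda>q. f q + g q) = X f + X g"
proof -
  have fg: "smooth_near M p (\<lambda>q. f q + g q)"
    using smooth_at_add[OF M] f g unfolding smooth_near_eq by blast
  obtain \<gamma> where "\<gamma> 0 = p" "smooth_at euclid M 0 \<gamma>"
    and \<gamma>: "\<And>f. smooth_near M p f \<Longrightarrow> ((\<lambda>s. f (\<gamma> s)) has_real_derivative X f) (at 0)"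
    using tangent_curve[OF M X] by blast
  show ?thesis by (rule DERIV_unique[OF \<gamma>[OF fg] DERIV_add[OF \<gamma>[OF f] \<gamma>[OF g]]])
qed

lemma tangent_cmul:
  assumes f: "smooth_near M p f"
  shows "X (\<lambda>q. c * f q) = c * X f"
proof -
  have fg: "smooth_near M p (\<lambda>q. c * f q)"
    using smooth_at_bounded_linear[OF M _ bounded_linear_mult_right] f unfolding smooth_near_eq by blast
  obtain \<gamma> where "\<gamma> 0 = p" "smooth_at euclid M 0 \<gamma>"
    and \<gamma>: "\<And>f. smooth_near M p f \<Longrightarrow> ((\<lambda>s. f (\<gamma> s)) has_real_derivative X f) (at 0)"
    using tangent_curve[OF M X] by blast
  show ?thesis by (rule DERIV_unique[OF \<gamma>[OF fg] DERIV_cmult[OF \<gamma>[OF f]]])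
qed

lemma tangent_diff:
  assumes f: "smooth_near M p f" and g: "smooth_near M p g"
  shows "X (\<lambda>q. f q - g q) = X f - X g"
proof -
  have g': "smooth_near M p (\<lambda>q. (- 1) * g q)"
    using smooth_at_bounded_linear[OF M _ bounded_linear_mult_right] g unfolding smooth_near_eq by blast
  from tangent_add[OF f this] tangent_cmul[OF g, of "- 1"] show ?thesis by simp
qed

end

lemma tangent_eqI:
  assumes "X \<in> tangent_space M p" "Y \<in> tangent_space M p" "\<And>f. smooth_near M p f \<Longrightarrow> X f = Y f"
  shows "X = Y"
proof
  fix f show "X f = Y f"
    using assms tangent_not_smooth[OF assms(1)] tangent_not_smooth[OF assms(2)]
    by (cases "smooth_near M p f") simp_all
qed

lemma pushforward_apply: "smooth_near N (F p) f \<Longrightarrow> pushforward N F p X f = X (\<lambda>x. f (F x))"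
  by (simp add: pushforward_def)

lemma pushforward_in_tangent_space:
  fixes M :: "('a::{t2_space,second_countable_topology}, 'e::euclidean_space) manifold"
    and N :: "('b::{t2_space,second_countable_topology}, 'f::euclidean_space) manifold"
  assumes M: "smooth_manifold M" and N: "smooth_manifold N" and F: "smooth_at M N p F"
    and X: "X \<in> tangent_space M p" and q: "q = F p"
  shows "pushforward N F p X \<in> tangent_space N q"
proof -
  obtain \<gamma> where \<gamma>: "\<gamma> 0 = p" "smooth_at euclid M 0 \<gamma>"
    "\<And>f. smooth_near M p f \<Longrightarrow> ((\<lambda>s. f (\<gamma> s)) has_real_derivative X f) (at 0)"
    using tangent_curve[OF M X] by blast
  have s: "smooth_at euclid N 0 (\<lambda>s. F (\<gamma> s))"
    by (rule smooth_at_comp[OF smooth_manifold_euclid M N \<gamma>(2)]) (simp add: \<gamma>(1) F)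
  have "pushforward N F p X = velocity N (\<lambda>s. F (\<gamma> s)) 0"
  proof
    fix f
    show "pushforward N F p X f = velocity N (\<lambda>s. F (\<gamma> s)) 0 f"
    proof (cases "smooth_near N (F p) f")
      case True
      then have "smooth_near M p (\<lambda>x. f (F x))"
        using smooth_at_comp[OF M N smooth_manifold_euclid F] by (simp add: smooth_near_eq)
      from \<gamma>(3)[OF this] velocity_has_derivative[OF N s, of f] True show ?thesis
        by (simp add: pushforward_def \<gamma>(1) DERIV_unique)
    qed (simp add: pushforward_def velocity_def \<gamma>(1))
  qed
  then show ?thesis using velocity_in_tangent_space[OF s] by (simp add: \<gamma>(1) q)
qed

text \<open>
  Along a curve with velocity \<open>X\<close> the three functions are the restrictions of one function on \<open>\<real>\<^sup>2\<close> to
  the diagonal and to the two axes, and \<open>D(1, 1) = D(1, 0) + D(0, 1)\<close>.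
\<close>

lemma tangent_product_rule:
  fixes S :: "('s::{t2_space,second_countable_topology}, 'd::euclidean_space) manifold"
    and A :: "('a::{t2_space,second_countable_topology}, 'e::euclidean_space) manifold"
    and B :: "('b::{t2_space,second_countable_topology}, 'f::euclidean_space) manifold"
  assumes S: "smooth_manifold S" and A: "smooth_manifold A" and B: "smooth_manifold B"
    and X: "X \<in> tangent_space S q" and F: "smooth_at S A q F" and H: "smooth_at S B q H"
    and \<Psi>: "smooth_near (prod_manifold A B) (F q, H q) (\<lambda>z. \<Psi> (fst z) (snd z))"
  shows "X (\<lambda>r. \<Psi> (F r) (H r)) = X (\<lambda>r. \<Psi> (F r) (H q)) + X (\<lambda>r. \<Psi> (F q) (H r))"
proof -
  note E = smooth_manifold_euclid
  note \<Psi>' = \<Psi>[unfolded smooth_near_eq]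
  have sm: "smooth_near S q (\<lambda>r. \<Psi> (F r) (H r))" "smooth_near S q (\<lambda>r. \<Psi> (F r) (H q))" "smooth_near S q (\<lambda>r. \<Psi> (F q) (H r))"
    unfolding smooth_near_eq
    using smooth_at_comp2[OF S A B E F H \<Psi>'] smooth_at_comp2[OF S A B E F smooth_at_const \<Psi>']
      smooth_at_comp2[OF S A B E smooth_at_const H \<Psi>'] by blast+
  obtain \<gamma> where \<gamma>: "\<gamma> 0 = q" "smooth_at euclid S 0 \<gamma>"
    "\<And>f. smooth_near S q f \<Longrightarrow> ((\<lambda>s. f (\<gamma> s)) has_real_derivative X f) (at 0)"
    using tangent_curve[OF S X] by blast
  define \<Theta> where "\<Theta> = (\<lambda>z::real \<times> real. \<Psi> (F (\<gamma> (fst z))) (H (\<gamma> (snd z))))"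
  have fs: "smooth_at euclid euclid z fst" "smooth_at euclid euclid z snd" for z :: "real \<times> real"
    using smooth_at_fst[OF E E, of z] smooth_at_snd[OF E E, of z] by (simp_all only: prod_euclid)
  have \<gamma>': "smooth_at euclid S (fst (0::real \<times> real)) \<gamma>" "smooth_at euclid S (snd (0::real \<times> real)) \<gamma>" using \<gamma>(2) by simp_all
  have FA: "smooth_at euclid A 0 (\<lambda>z::real \<times> real. F (\<gamma> (fst z)))"
    by (rule smooth_at_comp[OF E S A smooth_at_comp[OF E E S fs(1) \<gamma>'(1)]]) (simp add: \<gamma>(1) F)
  have HB: "smooth_at euclid B 0 (\<lambda>z::real \<times> real. H (\<gamma> (snd z)))"
    by (rule smooth_at_comp[OF E S B smooth_at_comp[OF E E S fs(2) \<gamma>'(2)]]) (simp add: \<gamma>(1) H)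
  have "smooth_at euclid euclid 0 \<Theta>"
    unfolding \<Theta>_def by (rule smooth_at_comp2[OF E A B E FA HB]) (simp add: \<gamma>(1) \<Psi>')
  then have \<Theta>: "smooth_at euclid euclid (0, 0) \<Theta>" by (simp add: zero_prod_def)
  define D where "D = frechet_derivative \<Theta> (at (0, 0))"
  have lin: "linear D"
    unfolding D_def by (rule has_derivative_linear[OF smooth_at_euclid_has_derivative[OF \<Theta>]])
  have c: "((\<lambda>s. \<Theta> (\<delta> s)) has_real_derivative D w) (at 0)" if "(\<delta> has_vector_derivative w) (at 0)" "\<delta> 0 = (0, 0)" for \<delta> w
    using smooth_at_euclid_curve_derivative[of \<delta> 0 \<Theta> w] \<Theta> that unfolding D_def by simp
  have "((\<lambda>s. \<Theta> (s, s)) has_real_derivative D (1, 1)) (at 0)" "((\<lambda>s. \<Theta> (s, 0)) has_real_derivative D (1, 0)) (at 0)"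
    "((\<lambda>s. \<Theta> (0, s)) has_real_derivative D (0, 1)) (at 0)"
    by (rule c; simp add: has_vector_derivative_Pair)+
  then have "X (\<lambda>r. \<Psi> (F r) (H r)) = D (1, 1)" "X (\<lambda>r. \<Psi> (F r) (H q)) = D (1, 0)" "X (\<lambda>r. \<Psi> (F q) (H r)) = D (0, 1)"
    using \<gamma>(3)[OF sm(1)] \<gamma>(3)[OF sm(2)] \<gamma>(3)[OF sm(3)] DERIV_unique unfolding \<Theta>_def by (simp_all add: \<gamma>(1)) blast+
  then show ?thesis using linear_add[OF lin, of "(1, 0)" "(0, 1)"] by simp
qed

subsection \<open>Tangent vectors in a chart\<close>

text \<open>
  The vector of the model space that represents \<open>X\<close> in the chart \<open>\<phi>\<close>.
\<close>

definition coords :: "('a \<Rightarrow> 'e::euclidean_space) \<Rightarrow> 'a tvec \<Rightarrow> 'e" where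
  "coords \<phi> X = (\<Sum>b\<in>Basis. X (\<lambda>q. \<phi> q \<bullet> b) *\<^sub>R b)"

lemma coords_scale: "coords \<phi> (scale r X) = r *\<^sub>R coords \<phi> X"
  by (simp add: coords_def scale_def scaleR_sum_right)

lemma limit_in_closed_subspace:
  fixes E :: "'e::euclidean_space set"
  assumes E: "subspace E" and y: "(y has_vector_derivative w) (at t)" and yE: "\<forall>\<^sub>F s in nhds t. y s \<in> E"
  shows "w \<in> E"
proof -
  have t: "y t \<in> E" using yE eventually_nhds_x_imp_x by blast
  have "((\<lambda>s. (y s - y t - (s - t) *\<^sub>R w) /\<^sub>R norm (s - t)) \<longlongrightarrow> 0) (at t)"
    using y unfolding has_vector_derivative_def has_derivative_at_within by simp
  then have "((\<lambda>s. norm ((y s - y t - (s - t) *\<^sub>R w) /\<^sub>R norm (s - t))) \<longlongrightarrow> 0) (at t)"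
    by (rule tendsto_norm_zero)
  then have "((\<lambda>s. norm ((1 / (s - t)) *\<^sub>R (y s - y t) - w)) \<longlongrightarrow> 0) (at t)"
  proof (rule Lim_transform_eventually)
    show "\<forall>\<^sub>F s in at t. norm ((y s - y t - (s - t) *\<^sub>R w) /\<^sub>R norm (s - t)) = norm ((1 / (s - t)) *\<^sub>R (y s - y t) - w)"
      unfolding eventually_at_filter
    proof (intro always_eventually allI impI)
      fix s assume "s \<noteq> t"
      then have "(1 / (s - t)) *\<^sub>R (y s - y t) - w = (1 / (s - t)) *\<^sub>R (y s - y t - (s - t) *\<^sub>R w)"
        by (simp add: scaleR_diff_right)
      then show "norm ((y s - y t - (s - t) *\<^sub>R w) /\<^sub>R norm (s - t)) = norm ((1 / (s - t)) *\<^sub>R (y s - y t) - w)"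
        by (simp add: divide_inverse_commute)
    qed
  qed
  then have "((\<lambda>s. (1 / (s - t)) *\<^sub>R (y s - y t) - w) \<longlongrightarrow> 0) (at t)"
    by (rule tendsto_norm_zero_cancel)
  then have lim: "((\<lambda>s. (1 / (s - t)) *\<^sub>R (y s - y t)) \<longlongrightarrow> w) (at t)"
    by (simp add: LIM_zero_iff)
  have "\<forall>\<^sub>F s in at t. y s \<in> E"
    using yE by (simp add: eventually_at_filter eventually_mono)
  then have "\<forall>\<^sub>F s in at t. (1 / (s - t)) *\<^sub>R (y s - y t) \<in> E"
    by (rule eventually_mono) (intro subspace_scale subspace_diff E t)
  then show ?thesis
    by (rule Lim_in_closed_set[OF closed_subspace[OF E] _ at_neq_bot lim])
qed

context
  fixes M :: "('a::{t2_space,second_countable_topology}, 'e::euclidean_space) manifold"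
    and V :: "'a set" and \<phi> :: "'a \<Rightarrow> 'e" and p :: 'a
  assumes M: "smooth_manifold M" and c: "(V, \<phi>) \<in> atlas M" and p: "p \<in> V"
begin

lemma smooth_at_chart: "smooth_at M euclid p \<phi>"
  by (rule smooth_atI[OF smooth_map_on_chart[OF M c] p])

lemma smooth_near_chart_component: "smooth_near M p (\<lambda>q. \<phi> q \<bullet> b)"
  unfolding smooth_near_eq by (rule smooth_at_bounded_linear[OF M smooth_at_chart bounded_linear_inner_left])

lemma smooth_at_par: "smooth_at euclid M (\<phi> p) (par M V \<phi>)"
  by (rule smooth_atI[OF smooth_map_on_par[OF M c] chart_in_chart_dom[OF M c p]])

lemma smooth_at_comp_par:
  "smooth_near M p f \<Longrightarrow> smooth_at euclid euclid (\<phi> p) (\<lambda>y. f (par M V \<phi> y))"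
  unfolding smooth_near_eq
  by (rule smooth_at_comp[OF smooth_manifold_euclid M smooth_manifold_euclid smooth_at_par]) (simp add: par_chart[OF M c p])

lemma
  assumes X: "X \<in> tangent_space M p"
  shows coords_in_model: "coords \<phi> X \<in> model M"
    and tangent_in_chart: "smooth_near M p f \<Longrightarrow>
      X f = frechet_derivative (\<lambda>y. f (par M V \<phi> y)) (at (\<phi> p)) (coords \<phi> X)"
proof -
  obtain \<gamma> where \<gamma>: "\<gamma> 0 = p" "smooth_at euclid M 0 \<gamma>"
    "\<And>f. smooth_near M p f \<Longrightarrow> ((\<lambda>s. f (\<gamma> s)) has_real_derivative X f) (at 0)"
    using tangent_curve[OF M X] by blast
  obtain U where U: "0 \<in> U" "smooth_map_on euclid M U \<gamma>" using \<gamma>(2) smooth_at_def by blast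
  let ?U = "U \<inter> \<gamma> -` V"
  have oU: "open ?U" "0 \<in> ?U"
    using smooth_map_on_open[OF smooth_map_on_restrict[OF U(2) chart_open[OF M c]]] U(1) p by (auto simp: \<gamma>(1))
  have "smooth_at euclid euclid 0 (\<lambda>s. \<phi> (\<gamma> s))"
    by (rule smooth_at_comp[OF smooth_manifold_euclid M smooth_manifold_euclid \<gamma>(2)]) (simp add: \<gamma>(1) smooth_at_chart)
  from smooth_at_euclid_has_derivative[OF this]
  obtain w where w: "((\<lambda>s. \<phi> (\<gamma> s)) has_vector_derivative w) (at 0)"
    using differentiableI vector_derivative_works by blast
  have "\<forall>\<^sub>F s in nhds 0. \<phi> (\<gamma> s) \<in> model M"
    using oU chart_in_model[OF M c] unfolding eventually_nhds by (intro exI[of _ ?U]) auto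
  then have wE: "w \<in> model M" by (rule limit_in_closed_subspace[OF smooth_manifold_subspace[OF M] w])
  have "X (\<lambda>q. \<phi> q \<bullet> b) = w \<bullet> b" for b
  proof (rule DERIV_unique[OF \<gamma>(3)[OF smooth_near_chart_component]])
    show "((\<lambda>s. \<phi> (\<gamma> s) \<bullet> b) has_real_derivative w \<bullet> b) (at 0)"
      using bounded_linear.has_vector_derivative[OF bounded_linear_inner_left w]
      by (simp add: has_real_derivative_iff_has_vector_derivative)
  qed
  then have cX: "coords \<phi> X = w" by (simp add: coords_def euclidean_representation)
  then show "coords \<phi> X \<in> model M" using wE by simp
  assume f: "smooth_near M p f"
  have "((\<lambda>s. f (par M V \<phi> (\<phi> (\<gamma> s)))) has_real_derivative
      frechet_derivative (\<lambda>y. f (par M V \<phi> y)) (at (\<phi> (\<gamma> 0))) w) (at 0)"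
    by (rule smooth_at_euclid_curve_derivative[OF _ w]) (simp add: \<gamma>(1) smooth_at_comp_par[OF f])
  then have "((\<lambda>s. f (\<gamma> s)) has_real_derivative
      frechet_derivative (\<lambda>y. f (par M V \<phi> y)) (at (\<phi> (\<gamma> 0))) w) (at 0)"
    by (rule has_field_derivative_transform_within_open[OF _ oU]) (simp add: par_chart[OF M c])
  then show "X f = frechet_derivative (\<lambda>y. f (par M V \<phi> y)) (at (\<phi> p)) (coords \<phi> X)"
    using DERIV_unique[OF \<gamma>(3)[OF f]] by (simp add: \<gamma>(1) cX)
qed

lemma
  assumes w: "w \<in> model M"
  shows coord_vector_in_tangent_space: "coord_vector M (V, \<phi>) w p \<in> tangent_space M p"
    and coord_vector_apply: "smooth_near M p f \<Longrightarrow>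
      coord_vector M (V, \<phi>) w p f = frechet_derivative (\<lambda>y. f (par M V \<phi> y)) (at (\<phi> p)) w"
proof -
  note E = smooth_manifold_euclid
  define \<gamma> where "\<gamma> = (\<lambda>t. par M V \<phi> (\<phi> p + t *\<^sub>R w))"
  note sub = smooth_manifold_subspace[OF M]
  have inE: "\<phi> p + t *\<^sub>R w \<in> model M" for t
    using chart_in_model[OF M c p] w sub by (intro subspace_add subspace_scale) auto
  have cv: "coord_vector M (V, \<phi>) w p = velocity M \<gamma> 0"
    by (simp add: coord_vector_def \<gamma>_def par_def proj_id[OF sub inE])
  have \<gamma>0: "\<gamma> 0 = p" by (simp add: \<gamma>_def par_chart[OF M c p])
  have d: "((\<lambda>t. \<phi> p + t *\<^sub>R w) has_vector_derivative w) (at t)" for t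
    by (auto intro!: derivative_eq_intros simp: has_vector_derivative_def)
  have "smooth_on UNIV UNIV (\<lambda>t. \<phi> p + t *\<^sub>R w)"
    by (intro smooth_on_add smooth_on_const smooth_on_linear bounded_linear_scaleR_left)
  then have "smooth_map_on euclid euclid UNIV (\<lambda>t. \<phi> p + t *\<^sub>R w)"
    by (simp add: smooth_map_on_euclid_euclid)
  then have "smooth_at euclid euclid 0 (\<lambda>t. \<phi> p + t *\<^sub>R w)" by (rule smooth_atI) simp
  then have s: "smooth_at euclid M 0 \<gamma>"
    unfolding \<gamma>_def by (rule smooth_at_comp[OF E E M]) (simp add: smooth_at_par)
  show inT: "coord_vector M (V, \<phi>) w p \<in> tangent_space M p"
    using velocity_in_tangent_space[OF s] by (simp add: cv \<gamma>0)
  show app: "coord_vector M (V, \<phi>) w p f = frechet_derivative (\<lambda>y. f (par M V \<phi> y)) (at (\<phi> p)) w"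
    if f: "smooth_near M p f" for f
  proof -
    have "((\<lambda>t. f (par M V \<phi> (\<phi> p + t *\<^sub>R w))) has_real_derivative
        frechet_derivative (\<lambda>y. f (par M V \<phi> y)) (at (\<phi> p + 0 *\<^sub>R w)) w) (at 0)"
      by (rule smooth_at_euclid_curve_derivative[OF _ d]) (simp add: smooth_at_comp_par[OF f])
    moreover have "((\<lambda>t. f (\<gamma> t)) has_real_derivative coord_vector M (V, \<phi>) w p f) (at 0)"
      unfolding cv by (rule velocity_has_derivative[OF M s]) (simp add: \<gamma>0 f)
    ultimately show ?thesis unfolding \<gamma>_def using DERIV_unique by fastforce
  qed
qed

lemma coord_vector_coords:
  assumes X: "X \<in> tangent_space M p"
  shows "coord_vector M (V, \<phi>) (coords \<phi> X) p = X"
  by (rule tangent_eqI[OF coord_vector_in_tangent_space[OF coords_in_model[OF X]] X])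
     (simp add: coord_vector_apply[OF coords_in_model[OF X]] tangent_in_chart[OF X])

lemma linear_chart_derivative:
  assumes f: "smooth_near M p f"
  shows "bounded_linear (frechet_derivative (\<lambda>y. f (par M V \<phi> y)) (at (\<phi> p)))"
  by (rule has_derivative_bounded_linear[OF smooth_at_euclid_has_derivative[OF smooth_at_comp_par[OF f]]])

lemma tangent_space_of_coords:
  assumes w: "w \<in> model M" and Z: "\<And>f. \<not> smooth_near M p f \<Longrightarrow> Z f = 0"
    and Zf: "\<And>f. smooth_near M p f \<Longrightarrow> Z f = frechet_derivative (\<lambda>y. f (par M V \<phi> y)) (at (\<phi> p)) w"
  shows "Z = coord_vector M (V, \<phi>) w p"
  using Z Zf coord_vector_apply[OF w] tangent_not_smooth[OF coord_vector_in_tangent_space[OF w]] by (intro ext) metis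

lemma coord_vector_add:
  assumes v: "v \<in> model M" and w: "w \<in> model M"
  shows "coord_vector M (V, \<phi>) (v + w) p = coord_vector M (V, \<phi>) v p + coord_vector M (V, \<phi>) w p"
proof (rule tangent_space_of_coords[symmetric])
  show "v + w \<in> model M" using v w smooth_manifold_subspace[OF M] by (intro subspace_add)
  fix f
  show "\<not> smooth_near M p f \<Longrightarrow> (coord_vector M (V, \<phi>) v p + coord_vector M (V, \<phi>) w p) f = 0"
    using tangent_not_smooth[OF coord_vector_in_tangent_space] v w by simp
  show "smooth_near M p f \<Longrightarrow> (coord_vector M (V, \<phi>) v p + coord_vector M (V, \<phi>) w p) f
      = frechet_derivative (\<lambda>y. f (par M V \<phi> y)) (at (\<phi> p)) (v + w)"
    using v w by (simp add: coord_vector_apply linear_add[OF bounded_linear.linear[OF linear_chart_derivative]])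
qed

lemma coord_vector_scale:
  assumes w: "w \<in> model M"
  shows "coord_vector M (V, \<phi>) (r *\<^sub>R w) p = scale r (coord_vector M (V, \<phi>) w p)"
proof (rule tangent_space_of_coords[symmetric])
  show "r *\<^sub>R w \<in> model M" using w smooth_manifold_subspace[OF M] by (intro subspace_scale)
  fix f
  show "\<not> smooth_near M p f \<Longrightarrow> scale r (coord_vector M (V, \<phi>) w p) f = 0"
    using tangent_not_smooth[OF coord_vector_in_tangent_space] w by (simp add: scale_def)
  show "smooth_near M p f \<Longrightarrow> scale r (coord_vector M (V, \<phi>) w p) f
      = frechet_derivative (\<lambda>y. f (par M V \<phi> y)) (at (\<phi> p)) (r *\<^sub>R w)"
    using w by (simp add: scale_def coord_vector_apply linear_cmul[OF bounded_linear.linear[OF linear_chart_derivative]])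
qed

text \<open>
  A linear functional on a tangent space is only known there. Composed with \<open>proj\<close>, it extends to the
  ambient Euclidean space, where linear maps are continuous.
\<close>

lemma linear_functional_in_chart:
  assumes \<beta>: "linear_functional (tangent_space M p) \<beta>"
  shows "bounded_linear (\<lambda>v. \<beta> (coord_vector M (V, \<phi>) (proj (model M) v) p))"
proof -
  note sub = smooth_manifold_subspace[OF M]
  note P = linear_proj[OF sub] and Pin = proj_in[OF sub]
  show ?thesis
    unfolding linear_conv_bounded_linear[symmetric]
  proof (rule linearI)
    fix v w :: 'e and r :: real
    show "\<beta> (coord_vector M (V, \<phi>) (proj (model M) (v + w)) p) =
        \<beta> (coord_vector M (V, \<phi>) (proj (model M) v) p) + \<beta> (coord_vector M (V, \<phi>) (proj (model M) w) p)"
      using \<beta> coord_vector_in_tangent_space[OF Pin] unfolding linear_functional_def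
      by (simp add: linear_add[OF P] coord_vector_add[OF Pin Pin])
    show "\<beta> (coord_vector M (V, \<phi>) (proj (model M) (r *\<^sub>R v)) p) =
        r *\<^sub>R \<beta> (coord_vector M (V, \<phi>) (proj (model M) v) p)"
      using \<beta> coord_vector_in_tangent_space[OF Pin] unfolding linear_functional_def
      by (simp add: linear_cmul[OF P] coord_vector_scale[OF Pin])
  qed
qed

lemma coord_vector_proj_coords:
  assumes X: "X \<in> tangent_space M p"
  shows "coord_vector M (V, \<phi>) (proj (model M) (coords \<phi> X)) p = X"
  using coord_vector_coords[OF X] proj_id[OF smooth_manifold_subspace[OF M] coords_in_model[OF X]] by simp

text \<open>
  If all evaluations of a curve in a tangent space are differentiable, then so are its finitely many
  components, and their derivative lies in the model space because that is closed.
\<close>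

lemma
  assumes y: "\<And>t. y t \<in> tangent_space M p"
    and d: "\<And>f. smooth_near M p f \<Longrightarrow> ((\<lambda>t. y t f) has_real_derivative Z f) (at t)"
    and Z: "\<And>f. \<not> smooth_near M p f \<Longrightarrow> Z f = 0"
  shows tangent_curve_derivative_in_chart: "Z \<in> tangent_space M p"
    and tangent_curve_coords_derivative: "((\<lambda>t. coords \<phi> (y t)) has_vector_derivative coords \<phi> Z) (at t)"
proof -
  show dc: "((\<lambda>t. coords \<phi> (y t)) has_vector_derivative coords \<phi> Z) (at t)"
    unfolding coords_def
  proof (rule has_vector_derivative_sum)
    fix b :: 'e
    show "((\<lambda>t. y t (\<lambda>q. \<phi> q \<bullet> b) *\<^sub>R b) has_vector_derivative Z (\<lambda>q. \<phi> q \<bullet> b) *\<^sub>R b) (at t)"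
      using bounded_linear.has_vector_derivative[OF bounded_linear_scaleR_left
          d[OF smooth_near_chart_component, unfolded has_real_derivative_iff_has_vector_derivative]] .
  qed
  have ZE: "coords \<phi> Z \<in> model M"
    by (rule limit_in_closed_subspace[OF smooth_manifold_subspace[OF M] dc]) (simp add: coords_in_model[OF y])
  have "Z f = frechet_derivative (\<lambda>y. f (par M V \<phi> y)) (at (\<phi> p)) (coords \<phi> Z)" if f: "smooth_near M p f" for f
  proof (rule DERIV_unique[OF d[OF f]])
    show "((\<lambda>t. y t f) has_real_derivative frechet_derivative (\<lambda>y. f (par M V \<phi> y)) (at (\<phi> p)) (coords \<phi> Z)) (at t)"
      using bounded_linear.has_vector_derivative[OF linear_chart_derivative[OF f] dc]
      by (simp add: tangent_in_chart[OF y f] has_real_derivative_iff_has_vector_derivative)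
  qed
  from tangent_space_of_coords[OF ZE Z this] show "Z \<in> tangent_space M p"
    using coord_vector_in_tangent_space[OF ZE] by simp
qed

end

context
  fixes M :: "('a::{t2_space,second_countable_topology}, 'e::euclidean_space) manifold" and p :: 'a
  assumes M: "smooth_manifold M"
begin

lemma tangent_space_add:
  assumes "X \<in> tangent_space M p" "Y \<in> tangent_space M p"
  shows "X + Y \<in> tangent_space M p"
proof -
  obtain V \<phi> where c: "(V, \<phi>) \<in> atlas M" "p \<in> V" using chart_at[OF M] .
  note in_model = coords_in_model[OF M c assms(1)] coords_in_model[OF M c assms(2)]
  have "X + Y = coord_vector M (V, \<phi>) (coords \<phi> X + coords \<phi> Y) p"
    by (simp add: coord_vector_add[OF M c in_model] coord_vector_coords[OF M c] assms)
  then show ?thesis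
    using coord_vector_in_tangent_space[OF M c] subspace_add[OF smooth_manifold_subspace[OF M] in_model] by simp
qed

lemma tangent_space_scale:
  assumes "X \<in> tangent_space M p"
  shows "scale r X \<in> tangent_space M p"
proof -
  obtain V \<phi> where c: "(V, \<phi>) \<in> atlas M" "p \<in> V" using chart_at[OF M] .
  note in_model = coords_in_model[OF M c assms(1)]
  have "scale r X = coord_vector M (V, \<phi>) (r *\<^sub>R coords \<phi> X) p"
    by (simp add: coord_vector_scale[OF M c in_model] coord_vector_coords[OF M c] assms)
  then show ?thesis
    using coord_vector_in_tangent_space[OF M c] subspace_scale[OF smooth_manifold_subspace[OF M] in_model] by simp
qed

lemma
  assumes y: "\<And>t. y t \<in> tangent_space M p"
    and d: "\<And>f. smooth_near M p f \<Longrightarrow> ((\<lambda>t. y t f) has_real_derivative Z f) (at t)"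
    and Z: "\<And>f. \<not> smooth_near M p f \<Longrightarrow> Z f = 0"
  shows tangent_curve_derivative_in: "Z \<in> tangent_space M p"
    and tangent_curve_linear: "linear_functional (tangent_space M p) \<beta> \<Longrightarrow>
      ((\<lambda>t. \<beta> (y t)) has_real_derivative \<beta> Z) (at t)"
proof -
  obtain V \<phi> where c: "(V, \<phi>) \<in> atlas M" "p \<in> V" using chart_at[OF M] .
  show ZT: "Z \<in> tangent_space M p" by (rule tangent_curve_derivative_in_chart[OF M c y d Z])
  assume \<beta>: "linear_functional (tangent_space M p) \<beta>"
  from bounded_linear.has_vector_derivative[OF linear_functional_in_chart[OF M c \<beta>]
      tangent_curve_coords_derivative[OF M c y d Z]]
  show "((\<lambda>t. \<beta> (y t)) has_real_derivative \<beta> Z) (at t)"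
    by (simp add: coord_vector_proj_coords[OF M c] y ZT has_real_derivative_iff_has_vector_derivative)
qed

end

definition bilinear_form :: "'a tvec set \<Rightarrow> ('a tvec \<Rightarrow> 'a tvec \<Rightarrow> real) \<Rightarrow> bool" where
  "bilinear_form T B \<longleftrightarrow> (\<forall>x\<in>T. linear_functional T (B x)) \<and> (\<forall>y\<in>T. linear_functional T (\<lambda>x. B x y))"

lemma bilinear_form_in_chart:
  fixes M :: "('a::{t2_space,second_countable_topology}, 'e::euclidean_space) manifold"
  assumes M: "smooth_manifold M" and c: "(V, \<phi>) \<in> atlas M" and p: "p \<in> V"
    and B: "bilinear_form (tangent_space M p) B"
  shows "bounded_bilinear (\<lambda>v w. B (coord_vector M (V, \<phi>) (proj (model M) v) p) (coord_vector M (V, \<phi>) (proj (model M) w) p))"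
proof -
  have cT: "coord_vector M (V, \<phi>) (proj (model M) v) p \<in> tangent_space M p" for v
    by (rule coord_vector_in_tangent_space[OF M c p proj_in[OF smooth_manifold_subspace[OF M]]])
  have "bilinear (\<lambda>v w. B (coord_vector M (V, \<phi>) (proj (model M) v) p) (coord_vector M (V, \<phi>) (proj (model M) w) p))"
    unfolding bilinear_def
    using B cT linear_functional_in_chart[OF M c p] bounded_linear.linear unfolding bilinear_form_def by blast
  then show ?thesis by (simp add: bilinear_conv_bounded_bilinear)
qed

lemma tangent_curve_bilinear:
  fixes M :: "('a::{t2_space,second_countable_topology}, 'e::euclidean_space) manifold"
  assumes M: "smooth_manifold M" and B: "bilinear_form (tangent_space M p) B"
    and y: "\<And>t. y t \<in> tangent_space M p"
    and dy: "\<And>f. smooth_near M p f \<Longrightarrow> ((\<lambda>t. y t f) has_real_derivative Y f) (at t)"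
    and Y: "\<And>f. \<not> smooth_near M p f \<Longrightarrow> Y f = 0"
    and z: "\<And>t. z t \<in> tangent_space M p"
    and dz: "\<And>f. smooth_near M p f \<Longrightarrow> ((\<lambda>t. z t f) has_real_derivative Z f) (at t)"
    and Z: "\<And>f. \<not> smooth_near M p f \<Longrightarrow> Z f = 0"
  shows "((\<lambda>t. B (y t) (z t)) has_real_derivative B (y t) Z + B Y (z t)) (at t)"
proof -
  obtain V \<phi> where c: "(V, \<phi>) \<in> atlas M" "p \<in> V" using chart_at[OF M] .
  note T = tangent_curve_derivative_in[OF M y dy Y] tangent_curve_derivative_in[OF M z dz Z]
  from bounded_bilinear.has_vector_derivative[OF bilinear_form_in_chart[OF M c B]
      tangent_curve_coords_derivative[OF M c y dy Y] tangent_curve_coords_derivative[OF M c z dz Z]]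
  show ?thesis
    by (simp add: coord_vector_proj_coords[OF M c] y z T has_real_derivative_iff_has_vector_derivative)
qed

subsection \<open>Derivatives depending smoothly on a parameter\<close>

text \<open>
  In charts this is a partial derivative of a smooth function. The point \<open>\<kappa>(q)\<close> of differentiation may
  move with the parameter: for \<open>dg g\<^sup>-\<^sup>1\<close> it is the parameter itself.
\<close>

lemma smooth_map_on_coord_derivative:
  fixes A :: "('a::{t2_space,second_countable_topology}, 'e::euclidean_space) manifold"
    and B :: "('b::{t2_space,second_countable_topology}, 'f::euclidean_space) manifold"
  assumes A: "smooth_manifold A" and B: "smooth_manifold B"
    and c: "(V, \<phi>) \<in> atlas B" and v: "v \<in> model B"
    and \<Psi>: "smooth_map_on (prod_manifold A B) euclid W (\<lambda>z. \<Psi> (fst z) (snd z))"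
    and \<kappa>: "smooth_map_on A B U \<kappa>" and \<kappa>V: "\<And>q. q \<in> U \<Longrightarrow> \<kappa> q \<in> V" and \<kappa>W: "\<And>q. q \<in> U \<Longrightarrow> (q, \<kappa> q) \<in> W"
  shows "smooth_map_on A euclid U (\<lambda>q. coord_vector B (V, \<phi>) v (\<kappa> q) (\<lambda>b. \<Psi> q b))"
proof (rule smooth_map_on_local[OF A smooth_manifold_euclid smooth_map_on_open[OF \<kappa>]])
  note E = smooth_manifold_euclid and AB = smooth_manifold_prod[OF A B]
  fix q0 assume q0: "q0 \<in> U"
  obtain V' \<psi> where c': "(V', \<psi>) \<in> atlas A" "q0 \<in> V'" using chart_at[OF A] .
  let ?C = "chart_dom A V' \<psi> \<times> chart_dom B V \<phi>"
  let ?P = "\<lambda>z. (par A V' \<psi> (fst z), par B V \<phi> (snd z))"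
  have oC: "open ?C" using open_chart_dom[OF A c'(1)] open_chart_dom[OF B c] by (rule open_Times)
  have fs: "smooth_map_on euclid euclid ?C fst" "smooth_map_on euclid euclid ?C snd"
    using oC by (simp_all add: smooth_map_on_euclid_euclid smooth_on_linear bounded_linear_fst bounded_linear_snd)
  have "smooth_map_on euclid A ?C (\<lambda>z. par A V' \<psi> (fst z))" "smooth_map_on euclid B ?C (\<lambda>z. par B V \<phi> (snd z))"
    by (rule smooth_map_on_comp[OF E E A fs(1) smooth_map_on_par[OF A c'(1)]], force)
       (rule smooth_map_on_comp[OF E E B fs(2) smooth_map_on_par[OF B c]], force)
  then have P: "smooth_map_on euclid (prod_manifold A B) ?C ?P" by (rule smooth_map_on_Pair)
  define Q where "Q = ?C \<inter> ?P -` W"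
  define \<Theta> where "\<Theta> = (\<lambda>z. \<Psi> (par A V' \<psi> (fst z)) (par B V \<phi> (snd z)))"
  have PO: "smooth_map_on euclid (prod_manifold A B) Q ?P"
    unfolding Q_def by (rule smooth_map_on_restrict[OF P smooth_map_on_open[OF \<Psi>]])
  have "smooth_map_on euclid euclid Q (\<lambda>z. (\<lambda>z. \<Psi> (fst z) (snd z)) (?P z))"
    by (rule smooth_map_on_comp[OF E AB E PO \<Psi>]) (auto simp: Q_def)
  then have \<Theta>: "open Q" "smooth_on UNIV Q \<Theta>"
    by (simp_all add: smooth_map_on_euclid_euclid \<Theta>_def)
  define G where "G = (\<lambda>z. frechet_derivative \<Theta> (at z) (0, v))"
  have G: "smooth_on UNIV Q G" unfolding G_def by (rule smooth_on_frechet_derivative[OF \<Theta>])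
  have UV': "open (U \<inter> V')" using smooth_map_on_open[OF \<kappa>] chart_open[OF A c'(1)] by blast
  have inO: "(\<psi> q, \<phi> (\<kappa> q)) \<in> Q" if "q \<in> U \<inter> V'" for q
    using that \<kappa>V \<kappa>W chart_in_chart_dom[OF A c'(1)] chart_in_chart_dom[OF B c]
    by (auto simp: Q_def par_chart[OF A c'(1)] par_chart[OF B c])
  have 1: "smooth_map_on A euclid (U \<inter> V') \<psi>"
    by (rule smooth_map_on_subset[OF smooth_map_on_chart[OF A c'(1)] UV']) simp
  have 2: "smooth_map_on A euclid (U \<inter> V') (\<lambda>q. \<phi> (\<kappa> q))"
    by (rule smooth_map_on_comp[OF A B E smooth_map_on_subset[OF \<kappa> UV'] smooth_map_on_chart[OF B c]]) (use \<kappa>V in auto)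
  have "smooth_map_on A euclid (U \<inter> V') (\<lambda>q. (\<psi> q, \<phi> (\<kappa> q)))"
    using smooth_map_on_Pair[OF 1 2] by (simp only: prod_euclid)
  from smooth_map_on_smooth_comp[OF A this G \<Theta>(1)] have Gs: "smooth_map_on A euclid (U \<inter> V') (\<lambda>q. G (\<psi> q, \<phi> (\<kappa> q)))"
    using inO by blast
  have eq: "coord_vector B (V, \<phi>) v (\<kappa> q) (\<lambda>b. \<Psi> q b) = G (\<psi> q, \<phi> (\<kappa> q))" if q: "q \<in> U \<inter> V'" for q
  proof -
    have "smooth_at (prod_manifold A B) euclid (q, \<kappa> q) (\<lambda>z. \<Psi> (fst z) (snd z))"
      by (rule smooth_atI[OF \<Psi> \<kappa>W]) (use q in auto)
    then have "smooth_near B (\<kappa> q) (\<lambda>b. \<Psi> q b)"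
      unfolding smooth_near_eq using smooth_at_comp2[OF B A B E smooth_at_const smooth_at_ident[OF B]] by blast
    then have "coord_vector B (V, \<phi>) v (\<kappa> q) (\<lambda>b. \<Psi> q b)
        = frechet_derivative (\<lambda>y. \<Psi> q (par B V \<phi> y)) (at (\<phi> (\<kappa> q))) v"
      using coord_vector_apply[OF B c \<kappa>V v] q by blast
    also have "(\<lambda>y. \<Psi> q (par B V \<phi> y)) = (\<lambda>y. \<Theta> (\<psi> q, y))"
      using q by (simp add: \<Theta>_def par_chart[OF A c'(1)])
    also have "frechet_derivative (\<lambda>y. \<Theta> (\<psi> q, y)) (at (\<phi> (\<kappa> q))) v = G (\<psi> q, \<phi> (\<kappa> q))"
    proof -
      have d: "(\<Theta> has_derivative frechet_derivative \<Theta> (at (\<psi> q, \<phi> (\<kappa> q)))) (at (\<psi> q, \<phi> (\<kappa> q)))"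
        by (rule smooth_on_has_derivative[OF \<Theta> inO[OF q]])
      have "((\<lambda>y. (\<psi> q, y)) has_derivative (\<lambda>u. (0, u))) (at (\<phi> (\<kappa> q)))"
        by (intro derivative_intros)
      from has_derivative_compose[OF this d]
      have "((\<lambda>y. \<Theta> (\<psi> q, y)) has_derivative (\<lambda>u. frechet_derivative \<Theta> (at (\<psi> q, \<phi> (\<kappa> q))) (0, u))) (at (\<phi> (\<kappa> q)))" .
      from frechet_derivative_at[OF this] show ?thesis unfolding G_def by metis
    qed
    finally show ?thesis .
  qed
  show "\<exists>U'. q0 \<in> U' \<and> smooth_map_on A euclid U' (\<lambda>q. coord_vector B (V, \<phi>) v (\<kappa> q) (\<lambda>b. \<Psi> q b))"
    by (rule exI[of _ "U \<inter> V'"]) (use q0 c'(2) smooth_map_on_cong[OF A Gs eq] in blast)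
qed

lemma smooth_at_tangent_derivative:
  fixes A :: "('a::{t2_space,second_countable_topology}, 'e::euclidean_space) manifold"
    and B :: "('b::{t2_space,second_countable_topology}, 'f::euclidean_space) manifold"
  assumes A: "smooth_manifold A" and B: "smooth_manifold B" and Y: "Y \<in> tangent_space B b"
    and \<Psi>: "smooth_at (prod_manifold A B) euclid (a, b) (\<lambda>z. \<Psi> (fst z) (snd z))"
  shows "smooth_at A euclid a (\<lambda>r. Y (\<lambda>s. \<Psi> r s))"
proof -
  obtain V \<phi> where c: "(V, \<phi>) \<in> atlas B" "b \<in> V" using chart_at[OF B] .
  obtain W where W: "(a, b) \<in> W" "smooth_map_on (prod_manifold A B) euclid W (\<lambda>z. \<Psi> (fst z) (snd z))"
    using \<Psi> smooth_at_def by blast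
  have oU: "open {r. (r, b) \<in> W}"
    using open_vimage[OF smooth_map_on_open[OF W(2)] continuous_on_Pair[OF continuous_on_id continuous_on_const], of b]
    by (simp add: vimage_def)
  have "smooth_map_on A euclid {r. (r, b) \<in> W} (\<lambda>r. coord_vector B (V, \<phi>) (coords \<phi> Y) b (\<lambda>s. \<Psi> r s))"
    by (rule smooth_map_on_coord_derivative[OF A B c(1) coords_in_model[OF B c Y] W(2) smooth_map_on_subset[OF smooth_map_on_const oU]])
       (use c in auto)
  then have "smooth_map_on A euclid {r. (r, b) \<in> W} (\<lambda>r. Y (\<lambda>s. \<Psi> r s))"
    by (simp add: coord_vector_coords[OF B c Y])
  then show ?thesis by (rule smooth_atI) (use W in auto)
qed

text \<open>
  Along curves with velocities \<open>X\<close> and \<open>Y\<close> the two sides are the mixed partial derivatives of a single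
  function of two real variables.
\<close>

lemma tangent_commute:
  fixes A :: "('a::{t2_space,second_countable_topology}, 'e::euclidean_space) manifold"
    and B :: "('b::{t2_space,second_countable_topology}, 'f::euclidean_space) manifold"
  assumes A: "smooth_manifold A" and B: "smooth_manifold B"
    and X: "X \<in> tangent_space A a" and Y: "Y \<in> tangent_space B b"
    and \<Psi>: "smooth_at (prod_manifold A B) euclid (a, b) (\<lambda>z. \<Psi> (fst z) (snd z))"
  shows "X (\<lambda>r. Y (\<lambda>s. \<Psi> r s)) = Y (\<lambda>s. X (\<lambda>r. \<Psi> r s))"
proof -
  note E = smooth_manifold_euclid
  obtain \<gamma> where \<gamma>: "\<gamma> 0 = a" "smooth_at euclid A 0 \<gamma>"
    "\<And>f. smooth_near A a f \<Longrightarrow> ((\<lambda>s. f (\<gamma> s)) has_real_derivative X f) (at 0)"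
    using tangent_curve[OF A X] by blast
  obtain \<delta> where \<delta>: "\<delta> 0 = b" "smooth_at euclid B 0 \<delta>"
    "\<And>f. smooth_near B b f \<Longrightarrow> ((\<lambda>s. f (\<delta> s)) has_real_derivative Y f) (at 0)"
    using tangent_curve[OF B Y] by blast
  obtain U1 where U1: "0 \<in> U1" "smooth_map_on euclid A U1 \<gamma>" using \<gamma>(2) smooth_at_def by blast
  obtain U2 where U2: "0 \<in> U2" "smooth_map_on euclid B U2 \<delta>" using \<delta>(2) smooth_at_def by blast
  obtain W where W: "(a, b) \<in> W" "smooth_map_on (prod_manifold A B) euclid W (\<lambda>z. \<Psi> (fst z) (snd z))"
    using \<Psi> smooth_at_def by blast
  let ?C = "U1 \<times> U2" and ?P = "\<lambda>z. (\<gamma> (fst z), \<delta> (snd z))"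
  have oC: "open ?C" using smooth_map_on_open[OF U1(2)] smooth_map_on_open[OF U2(2)] by (rule open_Times)
  have fs: "smooth_map_on euclid euclid ?C fst" "smooth_map_on euclid euclid ?C snd"
    using oC by (simp_all add: smooth_map_on_euclid_euclid smooth_on_linear bounded_linear_fst bounded_linear_snd)
  have "smooth_map_on euclid A ?C (\<lambda>z. \<gamma> (fst z))" "smooth_map_on euclid B ?C (\<lambda>z. \<delta> (snd z))"
    by (rule smooth_map_on_comp[OF E E A fs(1) U1(2)], force) (rule smooth_map_on_comp[OF E E B fs(2) U2(2)], force)
  then have P: "smooth_map_on euclid (prod_manifold A B) ?C ?P" by (rule smooth_map_on_Pair)
  define Q where "Q = ?C \<inter> ?P -` W"
  define \<Theta> where "\<Theta> = (\<lambda>z. \<Psi> (\<gamma> (fst z)) (\<delta> (snd z)))"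
  have PO: "smooth_map_on euclid (prod_manifold A B) Q ?P"
    unfolding Q_def by (rule smooth_map_on_restrict[OF P smooth_map_on_open[OF W(2)]])
  have "smooth_map_on euclid euclid Q (\<lambda>z. (\<lambda>z. \<Psi> (fst z) (snd z)) (?P z))"
    by (rule smooth_map_on_comp[OF E smooth_manifold_prod[OF A B] E PO W(2)]) (auto simp: Q_def)
  then have \<Theta>: "open Q" "smooth_on UNIV Q \<Theta>"
    by (simp_all add: smooth_map_on_euclid_euclid \<Theta>_def)
  have O0: "(0, 0) \<in> Q" using U1(1) U2(1) W(1) by (simp add: Q_def \<gamma>(1) \<delta>(1))
  define D where "D = (\<lambda>v z. frechet_derivative \<Theta> (at z) v)"
  have D: "smooth_on UNIV Q (D v)" for v unfolding D_def by (rule smooth_on_frechet_derivative[OF \<Theta>])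
  have near0: "\<forall>\<^sub>F s in nhds 0. (s, 0) \<in> Q" "\<forall>\<^sub>F s in nhds 0. (0, s) \<in> Q"
  proof -
    have "open ((\<lambda>s. (s, 0::real)) -` Q)" "open ((\<lambda>s. (0::real, s)) -` Q)"
      using \<Theta>(1) by (auto intro!: open_vimage continuous_intros)
    from eventually_nhds_in_open[OF this(1), of 0] eventually_nhds_in_open[OF this(2), of 0] O0
    show "\<forall>\<^sub>F s in nhds 0. (s, 0) \<in> Q" "\<forall>\<^sub>F s in nhds 0. (0, s) \<in> Q"
      by simp_all
  qed
  have Yd: "Y (\<lambda>s. \<Psi> (\<gamma> t) s) = D (0, 1) (t, 0)" if t: "(t, 0) \<in> Q" for t
  proof (rule DERIV_unique)
    have "smooth_at (prod_manifold A B) euclid (\<gamma> t, b) (\<lambda>z. \<Psi> (fst z) (snd z))"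
      using t by (intro smooth_atI[OF W(2)]) (simp add: Q_def \<delta>(1))
    then have "smooth_near B b (\<lambda>s. \<Psi> (\<gamma> t) s)"
      unfolding smooth_near_eq using smooth_at_comp2[OF B A B E smooth_at_const smooth_at_ident[OF B]] by blast
    from \<delta>(3)[OF this] show "((\<lambda>s. \<Theta> (t, s)) has_real_derivative Y (\<lambda>s. \<Psi> (\<gamma> t) s)) (at 0)"
      by (simp add: \<Theta>_def)
    show "((\<lambda>s. \<Theta> (t, s)) has_real_derivative D (0, 1) (t, 0)) (at 0)"
      unfolding D_def by (rule smooth_on_real_derivative[OF \<Theta> t]) (simp_all add: has_vector_derivative_Pair)
  qed
  have Xd: "X (\<lambda>r. \<Psi> r (\<delta> t)) = D (1, 0) (0, t)" if t: "(0, t) \<in> Q" for t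
  proof (rule DERIV_unique)
    have "smooth_at (prod_manifold A B) euclid (a, \<delta> t) (\<lambda>z. \<Psi> (fst z) (snd z))"
      using t by (intro smooth_atI[OF W(2)]) (simp add: Q_def \<gamma>(1))
    then have "smooth_near A a (\<lambda>r. \<Psi> r (\<delta> t))"
      unfolding smooth_near_eq using smooth_at_comp2[OF A A B E smooth_at_ident[OF A] smooth_at_const] by blast
    from \<gamma>(3)[OF this] show "((\<lambda>s. \<Theta> (s, t)) has_real_derivative X (\<lambda>r. \<Psi> r (\<delta> t))) (at 0)"
      by (simp add: \<Theta>_def)
    show "((\<lambda>s. \<Theta> (s, t)) has_real_derivative D (1, 0) (0, t)) (at 0)"
      unfolding D_def by (rule smooth_on_real_derivative[OF \<Theta> t]) (simp_all add: has_vector_derivative_Pair)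
  qed
  have "X (\<lambda>r. Y (\<lambda>s. \<Psi> r s)) = frechet_derivative (D (0, 1)) (at (0, 0)) (1, 0)"
  proof (rule DERIV_unique)
    have "smooth_near A a (\<lambda>r. Y (\<lambda>s. \<Psi> r s))"
      unfolding smooth_near_eq by (rule smooth_at_tangent_derivative[OF A B Y \<Psi>])
    from \<gamma>(3)[OF this] show "((\<lambda>t. Y (\<lambda>s. \<Psi> (\<gamma> t) s)) has_real_derivative X (\<lambda>r. Y (\<lambda>s. \<Psi> r s))) (at 0)" .
    have "((\<lambda>t. D (0, 1) (t, 0)) has_real_derivative frechet_derivative (D (0, 1)) (at (0, 0)) (1, 0)) (at 0)"
      by (rule smooth_on_real_derivative[OF \<Theta>(1) D O0]) (simp_all add: has_vector_derivative_Pair)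
    then show "((\<lambda>t. Y (\<lambda>s. \<Psi> (\<gamma> t) s)) has_real_derivative frechet_derivative (D (0, 1)) (at (0, 0)) (1, 0)) (at 0)"
      by (subst DERIV_cong_ev[OF refl eventually_mono[OF near0(1) Yd] refl])
  qed
  moreover have "Y (\<lambda>s. X (\<lambda>r. \<Psi> r s)) = frechet_derivative (D (1, 0)) (at (0, 0)) (0, 1)"
  proof (rule DERIV_unique)
    have "smooth_near B b (\<lambda>s. X (\<lambda>r. \<Psi> r s))"
      unfolding smooth_near_eq
      by (rule smooth_at_tangent_derivative[OF B A X]) (rule smooth_at_swap[OF A B E \<Psi>])
    from \<delta>(3)[OF this] show "((\<lambda>t. X (\<lambda>r. \<Psi> r (\<delta> t))) has_real_derivative Y (\<lambda>s. X (\<lambda>r. \<Psi> r s))) (at 0)" .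
    have "((\<lambda>t. D (1, 0) (0, t)) has_real_derivative frechet_derivative (D (1, 0)) (at (0, 0)) (0, 1)) (at 0)"
      by (rule smooth_on_real_derivative[OF \<Theta>(1) D O0]) (simp_all add: has_vector_derivative_Pair)
    then show "((\<lambda>t. X (\<lambda>r. \<Psi> r (\<delta> t))) has_real_derivative frechet_derivative (D (1, 0)) (at (0, 0)) (0, 1)) (at 0)"
      by (subst DERIV_cong_ev[OF refl eventually_mono[OF near0(2) Xd] refl])
  qed
  ultimately show ?thesis using mixed_partials_eq[OF \<Theta>(1) O0 \<Theta>(2)] unfolding D_def by simp
qed

section \<open>Lie groups\<close>

lemma smooth_map_on_at:
  assumes M: "smooth_manifold M" and N: "smooth_manifold N" and U: "open U"
    and f: "\<And>p. p \<in> U \<Longrightarrow> smooth_at M N p f"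
  shows "smooth_map_on M N U f"
  by (rule smooth_map_on_local[OF M N U]) (use f in \<open>simp add: smooth_at_def\<close>)

locale lie_grp =
  fixes G :: "'g::{t2_space,second_countable_topology} monoid" and M :: "('g, 'e::euclidean_space) manifold"
  assumes lie: "lie_group G M"

sublocale lie_grp \<subseteq> group G
  using lie by (simp add: lie_group_def)

context lie_grp
begin

abbreviation mul (infixl "\<cdot>" 70) where "g \<cdot> h \<equiv> g \<otimes>\<^bsub>G\<^esub> h"
abbreviation inverse_el ("_\<^sup>-" [1000] 1000) where "g\<^sup>- \<equiv> inv\<^bsub>G\<^esub> g"
abbreviation unit_el ("e\<^sub>G") where "e\<^sub>G \<equiv> \<one>\<^bsub>G\<^esub>"
abbreviation \<gg> where "\<gg> \<equiv> lie_alg G M"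

lemma carrier_eq_UNIV [simp]: "carrier G = UNIV"
  and manifold_M: "smooth_manifold M"
  using lie by (simp_all add: lie_group_def)

lemma mul_inv_cancel [simp]: "g \<cdot> (g\<^sup>- \<cdot> h) = h" "g\<^sup>- \<cdot> (g \<cdot> h) = h"
  by (simp_all add: m_assoc[symmetric])

lemma smooth_mul: "smooth_at (prod_manifold M M) M z (\<lambda>z. fst z \<cdot> snd z)"
  using lie smooth_atI[of "prod_manifold M M" M UNIV]
  by (simp add: lie_group_def smooth_maps_def case_prod_beta')

lemma smooth_inv: "smooth_at M M g (\<lambda>g. g\<^sup>-)"
  using lie smooth_atI[of M M UNIV] by (simp add: lie_group_def smooth_maps_def)

lemma smooth_at_mul:
  fixes S :: "('s::{t2_space,second_countable_topology}, 'd::euclidean_space) manifold"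
  assumes S: "smooth_manifold S" and f: "smooth_at S M q f" and g: "smooth_at S M q g"
  shows "smooth_at S M q (\<lambda>r. f r \<cdot> g r)"
  by (rule smooth_at_comp2[OF S manifold_M manifold_M manifold_M f g]) (rule smooth_mul)

lemma smooth_at_inv:
  fixes S :: "('s::{t2_space,second_countable_topology}, 'd::euclidean_space) manifold"
  assumes S: "smooth_manifold S" and f: "smooth_at S M q f"
  shows "smooth_at S M q (\<lambda>r. (f r)\<^sup>-)"
  by (rule smooth_at_comp[OF S manifold_M manifold_M f smooth_inv])

lemma smooth_near_comp:
  fixes S :: "('s::{t2_space,second_countable_topology}, 'd::euclidean_space) manifold"
  assumes S: "smooth_manifold S" and F: "smooth_at S M q F" and f: "smooth_near M p f" and p: "F q = p"
  shows "smooth_near S q (\<lambda>r. f (F r))"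
  using smooth_at_comp[OF S manifold_M smooth_manifold_euclid F] f p by (simp add: smooth_near_eq)

lemma smooth_near_mul:
  assumes f: "smooth_near M (g \<cdot> h) f"
  shows "smooth_near (prod_manifold M M) (g, h) (\<lambda>z. f (fst z \<cdot> snd z))"
  by (rule smooth_near_comp[OF smooth_manifold_prod[OF manifold_M manifold_M] smooth_mul f]) simp

lemma product_rule:
  fixes S :: "('s::{t2_space,second_countable_topology}, 'd::euclidean_space) manifold"
  assumes S: "smooth_manifold S" and X: "X \<in> tangent_space S q"
    and g: "smooth_at S M q g" and h: "smooth_at S M q h" and f: "smooth_near M (g q \<cdot> h q) f"
  shows "X (\<lambda>r. f (g r \<cdot> h r)) = X (\<lambda>r. f (g r \<cdot> h q)) + X (\<lambda>r. f (g q \<cdot> h r))"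
  by (rule tangent_product_rule[OF S manifold_M manifold_M X g h smooth_near_mul[OF f]])

text \<open>
  The product rule for \<open>h h\<^sup>-\<^sup>1\<close>, which is constant.
\<close>

lemma tangent_inverse:
  assumes x: "x \<in> \<gg>" and f: "smooth_near M e\<^sub>G f"
  shows "x (\<lambda>h. f (h\<^sup>-)) = - x f"
proof -
  have "x (\<lambda>r. f (r \<cdot> r\<^sup>-)) = x (\<lambda>r. f (r \<cdot> e\<^sub>G\<^sup>-)) + x (\<lambda>r. f (e\<^sub>G \<cdot> r\<^sup>-))"
    by (rule product_rule[OF manifold_M x[unfolded lie_alg_def] smooth_at_ident[OF manifold_M] smooth_inv]) (simp add: f)
  then show ?thesis using tangent_const[OF manifold_M x[unfolded lie_alg_def]] by simp
qed

subsection \<open>The adjoint action and the right logarithmic derivative\<close>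

text \<open>In the names of lemmas, \<open>rld\<close> stands for the right logarithmic derivative.\<close>

lemma Ad_in: "x \<in> \<gg> \<Longrightarrow> Ad G M h x \<in> \<gg>"
  unfolding lie_alg_def Ad_def
  by (rule pushforward_in_tangent_space[OF manifold_M manifold_M])
     (auto intro!: smooth_at_mul smooth_at_const smooth_at_ident manifold_M)

lemma Ad_apply: "smooth_near M e\<^sub>G f \<Longrightarrow> Ad G M h x f = x (\<lambda>k. f (h \<cdot> k \<cdot> h\<^sup>-))"
  unfolding Ad_def by (rule pushforward_apply) simp

context
  fixes S :: "('s::{t2_space,second_countable_topology}, 'd::euclidean_space) manifold"
  assumes S: "smooth_manifold S"
begin

lemma rld_in: "smooth_at S M q g \<Longrightarrow> X \<in> tangent_space S q \<Longrightarrow> right_log_deriv G M g q X \<in> \<gg>"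
  unfolding lie_alg_def right_log_deriv_def
  by (rule pushforward_in_tangent_space[OF S manifold_M])
     (auto intro!: smooth_at_mul smooth_at_const S)

lemma rld_apply: "smooth_near M e\<^sub>G f \<Longrightarrow> right_log_deriv G M g q X f = X (\<lambda>r. f (g r \<cdot> (g q)\<^sup>-))"
  unfolding right_log_deriv_def by (rule pushforward_apply) simp

lemma rld_add: "right_log_deriv G M g q (X + Y) = right_log_deriv G M g q X + right_log_deriv G M g q Y"
  unfolding right_log_deriv_def pushforward_def by (rule ext) simp

lemma rld_scale: "right_log_deriv G M g q (scale c X) = scale c (right_log_deriv G M g q X)"
  unfolding right_log_deriv_def pushforward_def scale_def by (rule ext) simp

text \<open>
  Apply the product rule to \<open>g(r) \<cdot> (h(r) h(q)\<^sup>-\<^sup>1 g(q)\<^sup>-\<^sup>1)\<close>. In the first term \<open>h\<close> cancels; the second is the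
  conjugate of \<open>h(r) h(q)\<^sup>-\<^sup>1\<close> by \<open>g(q)\<close>.
\<close>

lemma rld_mult:
  assumes g: "smooth_at S M q g" and h: "smooth_at S M q h" and X: "X \<in> tangent_space S q"
  shows "right_log_deriv G M (\<lambda>r. g r \<cdot> h r) q X =
    right_log_deriv G M g q X + Ad G M (g q) (right_log_deriv G M h q X)"
proof -
  note gh = smooth_at_mul[OF S g h]
  have T: "right_log_deriv G M g q X + Ad G M (g q) (right_log_deriv G M h q X) \<in> tangent_space M e\<^sub>G"
    using tangent_space_add[OF manifold_M] rld_in[OF g X] Ad_in[OF rld_in[OF h X]] by (simp add: lie_alg_def)
  show ?thesis
  proof (rule tangent_eqI[OF rld_in[OF gh X, unfolded lie_alg_def] T])
    fix f assume f: "smooth_near M e\<^sub>G f"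
    let ?h = "\<lambda>r. h r \<cdot> ((h q)\<^sup>- \<cdot> (g q)\<^sup>-)"
    have h': "smooth_at S M q ?h" by (rule smooth_at_mul[OF S h smooth_at_const])
    have "smooth_near M e\<^sub>G (\<lambda>k. f (g q \<cdot> k \<cdot> (g q)\<^sup>-))"
      by (rule smooth_near_comp[OF manifold_M _ f]) (auto intro!: smooth_at_mul smooth_at_const smooth_at_ident manifold_M)
    then have "Ad G M (g q) (right_log_deriv G M h q X) f = X (\<lambda>r. f (g q \<cdot> (h r \<cdot> (h q)\<^sup>-) \<cdot> (g q)\<^sup>-))"
      by (simp add: Ad_apply[OF f] rld_apply)
    moreover have "X (\<lambda>r. f (g r \<cdot> ?h r)) = X (\<lambda>r. f (g r \<cdot> ?h q)) + X (\<lambda>r. f (g q \<cdot> ?h r))"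
      by (rule product_rule[OF S X g h']) (simp add: f)
    ultimately show "right_log_deriv G M (\<lambda>r. g r \<cdot> h r) q X f =
        (right_log_deriv G M g q X + Ad G M (g q) (right_log_deriv G M h q X)) f"
      by (simp add: rld_apply[OF f] inv_mult_group m_assoc)
  qed
qed

end

subsection \<open>The Lie bracket\<close>

lemma lie_alg_add: "x \<in> \<gg> \<Longrightarrow> y \<in> \<gg> \<Longrightarrow> x + y \<in> \<gg>"
  and lie_alg_scale: "x \<in> \<gg> \<Longrightarrow> scale r x \<in> \<gg>"
  unfolding lie_alg_def using tangent_space_add[OF manifold_M] tangent_space_scale[OF manifold_M] by blast+

lemma smooth_near_mul1: "smooth_near M e\<^sub>G f \<Longrightarrow> smooth_near (prod_manifold M M) (e\<^sub>G, e\<^sub>G) (\<lambda>z. f (fst z \<cdot> snd z))"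
  using smooth_near_mul[of "e\<^sub>G" "e\<^sub>G" f] by simp

lemma smooth_translate_derivative:
  assumes y: "y \<in> \<gg>" and f: "smooth_near M e\<^sub>G f"
  shows "smooth_near M e\<^sub>G (\<lambda>h. y (\<lambda>k. f (h \<cdot> k)))"
  unfolding smooth_near_eq
  by (rule smooth_at_tangent_derivative[OF manifold_M manifold_M y[unfolded lie_alg_def]
        smooth_near_mul1[OF f, unfolded smooth_near_eq]])

text \<open>
  The two factors of the conjugation are separate variables here, as the product rule requires.
\<close>

lemma smooth_conj_derivative:
  assumes y: "y \<in> \<gg>" and f: "smooth_near M e\<^sub>G f"
  shows "smooth_near (prod_manifold M M) (e\<^sub>G, e\<^sub>G) (\<lambda>z. y (\<lambda>k. f (fst z \<cdot> k \<cdot> (snd z)\<^sup>-)))"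
proof -
  note MM = smooth_manifold_prod[OF manifold_M manifold_M]
  note MMM = smooth_manifold_prod[OF MM manifold_M]
  let ?z = "((e\<^sub>G, e\<^sub>G), e\<^sub>G)"
  have p: "smooth_at (prod_manifold (prod_manifold M M) M) M ?z (\<lambda>z. fst (fst z))"
    "smooth_at (prod_manifold (prod_manifold M M) M) M ?z (\<lambda>z. snd (fst z))"
    by (rule smooth_at_comp[OF MMM MM manifold_M smooth_at_fst[OF MM manifold_M] smooth_at_fst[OF manifold_M manifold_M]])
       (rule smooth_at_comp[OF MMM MM manifold_M smooth_at_fst[OF MM manifold_M] smooth_at_snd[OF manifold_M manifold_M]])
  have "smooth_at (prod_manifold (prod_manifold M M) M) M ?z (\<lambda>z. fst (fst z) \<cdot> snd z \<cdot> (snd (fst z))\<^sup>-)"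
    by (rule smooth_at_mul[OF MMM smooth_at_mul[OF MMM p(1) smooth_at_snd[OF MM manifold_M]] smooth_at_inv[OF MMM p(2)]])
  from smooth_near_comp[OF MMM this f]
  have "smooth_near (prod_manifold (prod_manifold M M) M) ?z (\<lambda>z. f (fst (fst z) \<cdot> snd z \<cdot> (snd (fst z))\<^sup>-))"
    by simp
  then show ?thesis
    unfolding smooth_near_eq by (rule smooth_at_tangent_derivative[OF MM manifold_M y[unfolded lie_alg_def]])
qed

text \<open>
  The product rule in \<open>h\<close> splits the derivative of \<open>f(h k h\<^sup>-\<^sup>1)\<close> into the two terms of the bracket; in the
  second one \<open>h\<^sup>-\<^sup>1\<close> gives the sign, and the derivatives in \<open>h\<close> and \<open>k\<close> have to be exchanged.
\<close>

lemma bracket_as_derivative_of_Ad: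
  assumes x: "x \<in> \<gg>" and y: "y \<in> \<gg>" and f: "smooth_near M e\<^sub>G f"
  shows "lie_bracket G M x y f = x (\<lambda>h. Ad G M h y f)"
proof -
  note x' = x[unfolded lie_alg_def] and y' = y[unfolded lie_alg_def]
  let ?\<Psi> = "\<lambda>h h'. y (\<lambda>k. f (h \<cdot> k \<cdot> h'\<^sup>-))"
  have "smooth_at M euclid e\<^sub>G (\<lambda>r. y (\<lambda>k. f (k \<cdot> r)))"
    by (rule smooth_at_tangent_derivative[OF manifold_M manifold_M y'])
       (rule smooth_at_swap[OF manifold_M manifold_M smooth_manifold_euclid smooth_near_mul1[OF f, unfolded smooth_near_eq]])
  then have "x (\<lambda>r. y (\<lambda>k. f (k \<cdot> r\<^sup>-))) = - x (\<lambda>r. y (\<lambda>k. f (k \<cdot> r)))"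
    by (rule tangent_inverse[OF x, unfolded smooth_near_eq])
  also have "x (\<lambda>r. y (\<lambda>k. f (k \<cdot> r))) = y (\<lambda>k. x (\<lambda>r. f (k \<cdot> r)))"
    by (rule tangent_commute[OF manifold_M manifold_M x' y'])
       (rule smooth_at_swap[OF manifold_M manifold_M smooth_manifold_euclid smooth_near_mul1[OF f, unfolded smooth_near_eq]])
  finally have 1: "x (\<lambda>r. y (\<lambda>k. f (k \<cdot> r\<^sup>-))) = - y (\<lambda>k. x (\<lambda>r. f (k \<cdot> r)))" .
  have "x (\<lambda>h. ?\<Psi> h h) = x (\<lambda>r. ?\<Psi> r e\<^sub>G) + x (\<lambda>r. ?\<Psi> e\<^sub>G r)"
    by (rule tangent_product_rule[OF manifold_M manifold_M manifold_M x' smooth_at_ident[OF manifold_M] smooth_at_ident[OF manifold_M]])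
       (rule smooth_conj_derivative[OF y f])
  then show ?thesis using f by (simp add: 1 lie_bracket_def Ad_apply[OF f])
qed

lemma bracket_in:
  assumes x: "x \<in> \<gg>" and y: "y \<in> \<gg>"
  shows "lie_bracket G M x y \<in> \<gg>"
proof -
  obtain \<gamma> where \<gamma>: "\<gamma> 0 = e\<^sub>G" "smooth_at euclid M 0 \<gamma>"
    "\<And>f. smooth_near M e\<^sub>G f \<Longrightarrow> ((\<lambda>s. f (\<gamma> s)) has_real_derivative x f) (at 0)"
    using tangent_curve[OF manifold_M x[unfolded lie_alg_def]] by blast
  show ?thesis
    unfolding lie_alg_def
  proof (rule tangent_curve_derivative_in[OF manifold_M, where t = 0])
    show "Ad G M (\<gamma> t) y \<in> tangent_space M e\<^sub>G" for t using Ad_in[OF y] by (simp add: lie_alg_def)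
    fix f
    show "\<not> smooth_near M e\<^sub>G f \<Longrightarrow> lie_bracket G M x y f = 0" by (simp add: lie_bracket_def)
    assume f: "smooth_near M e\<^sub>G f"
    have "smooth_near M e\<^sub>G (\<lambda>h. Ad G M h y f)"
      unfolding Ad_apply[OF f] smooth_near_eq
      by (rule smooth_at_comp2[OF manifold_M manifold_M manifold_M smooth_manifold_euclid smooth_at_ident[OF manifold_M] smooth_at_ident[OF manifold_M]])
         (rule smooth_conj_derivative[OF y f, unfolded smooth_near_eq])
    from \<gamma>(3)[OF this] show "((\<lambda>t. Ad G M (\<gamma> t) y f) has_real_derivative lie_bracket G M x y f) (at 0)"
      by (simp add: bracket_as_derivative_of_Ad[OF x y f])
  qed
qed

lemma bracket_swap: "lie_bracket G M y x = scale (- 1) (lie_bracket G M x y)"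
  by (rule ext) (simp add: lie_bracket_def scale_def)

lemma bracket_add_left:
  assumes x: "x \<in> \<gg>" and x': "x' \<in> \<gg>" and y: "y \<in> \<gg>"
  shows "lie_bracket G M (x + x') y = lie_bracket G M x y + lie_bracket G M x' y"
proof
  fix f show "lie_bracket G M (x + x') y f = (lie_bracket G M x y + lie_bracket G M x' y) f"
    using tangent_add[OF manifold_M y[unfolded lie_alg_def] smooth_translate_derivative[OF x] smooth_translate_derivative[OF x']]
    by (simp add: lie_bracket_def)
qed

lemma bracket_scale_left:
  assumes x: "x \<in> \<gg>" and y: "y \<in> \<gg>"
  shows "lie_bracket G M (scale c x) y = scale c (lie_bracket G M x y)"
proof
  fix f show "lie_bracket G M (scale c x) y f = scale c (lie_bracket G M x y) f"
    using tangent_cmul[OF manifold_M y[unfolded lie_alg_def] smooth_translate_derivative[OF x]]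
    by (simp add: lie_bracket_def scale_def algebra_simps)
qed

lemma bracket_add_right:
  assumes x: "x \<in> \<gg>" and x': "x' \<in> \<gg>" and y: "y \<in> \<gg>"
  shows "lie_bracket G M y (x + x') = lie_bracket G M y x + lie_bracket G M y x'"
  unfolding bracket_swap[of y] bracket_add_left[OF assms] by (rule ext) (simp add: scale_def)

lemma bracket_scale_right:
  assumes x: "x \<in> \<gg>" and y: "y \<in> \<gg>"
  shows "lie_bracket G M y (scale c x) = scale c (lie_bracket G M y x)"
  unfolding bracket_swap[of y] bracket_scale_left[OF assms] by (rule ext) (simp add: scale_def)

lemma bracket_bilinear:
  assumes \<beta>: "linear_functional \<gg> \<beta>"
  shows "bilinear_form \<gg> (\<lambda>x y. \<beta> (lie_bracket G M x y))"
  using \<beta> unfolding bilinear_form_def linear_functional_def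
  by (simp add: bracket_add_left bracket_scale_left bracket_add_right bracket_scale_right bracket_in)

lemma evaluation_linear: "linear_functional \<gg> (\<lambda>x. x f)"
  by (simp add: linear_functional_def scale_def)

end

section \<open>The exponential map\<close>

lemma chart_curve_derivative:
  fixes M :: "('a::{t2_space,second_countable_topology}, 'e::euclidean_space) manifold"
  assumes M: "smooth_manifold M" and c: "(V, \<phi>) \<in> atlas M" and p: "\<gamma> t \<in> V" and \<gamma>: "smooth_at euclid M t \<gamma>"
  shows "((\<lambda>s. \<phi> (\<gamma> s)) has_vector_derivative coords \<phi> (velocity M \<gamma> t)) (at t)"
proof -
  have "((\<lambda>s. \<Sum>b\<in>Basis. (\<phi> (\<gamma> s) \<bullet> b) *\<^sub>R b) has_vector_derivative coords \<phi> (velocity M \<gamma> t)) (at t)"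
    unfolding coords_def
  proof (rule has_vector_derivative_sum)
    fix b :: 'e
    show "((\<lambda>s. (\<phi> (\<gamma> s) \<bullet> b) *\<^sub>R b) has_vector_derivative velocity M \<gamma> t (\<lambda>q. \<phi> q \<bullet> b) *\<^sub>R b) (at t)"
      using bounded_linear.has_vector_derivative[OF bounded_linear_scaleR_left
          velocity_has_derivative[OF M \<gamma> smooth_near_chart_component[OF M c p],
            unfolded has_real_derivative_iff_has_vector_derivative]] .
  qed
  then show ?thesis by (simp add: euclidean_representation)
qed

lemma velocity_rescale:
  fixes M :: "('a::{t2_space,second_countable_topology}, 'e::euclidean_space) manifold"
  assumes M: "smooth_manifold M" and \<gamma>: "smooth_at euclid M 0 \<gamma>"
  shows "smooth_at euclid M 0 (\<lambda>t. \<gamma> (c * t))"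
    and "velocity M (\<lambda>t. \<gamma> (c * t)) 0 = scale c (velocity M \<gamma> 0)"
proof -
  have "smooth_at euclid euclid 0 (\<lambda>t::real. c * t)"
    by (rule smooth_atI[of _ _ UNIV]) (simp_all add: smooth_map_on_euclid_euclid smooth_on_linear bounded_linear_mult_right)
  then show s: "smooth_at euclid M 0 (\<lambda>t. \<gamma> (c * t))"
    by (rule smooth_at_comp[OF smooth_manifold_euclid smooth_manifold_euclid M]) (simp add: \<gamma>)
  show "velocity M (\<lambda>t. \<gamma> (c * t)) 0 = scale c (velocity M \<gamma> 0)"
  proof
    fix f
    show "velocity M (\<lambda>t. \<gamma> (c * t)) 0 f = scale c (velocity M \<gamma> 0) f"
    proof (cases "smooth_near M (\<gamma> 0) f")
      case True
      have "((\<lambda>t. f (\<gamma> (c * t))) has_real_derivative velocity M \<gamma> 0 f * c) (at 0)"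
        by (rule DERIV_chain2[where f = "\<lambda>t. f (\<gamma> t)"])
           (auto intro!: derivative_eq_intros simp: velocity_has_derivative[OF M \<gamma> True])
      with velocity_has_derivative[OF M s] True show ?thesis
        using DERIV_unique by (fastforce simp: scale_def)
    qed (simp add: velocity_def scale_def)
  qed
qed

context lie_grp
begin

lemma tangent_real_line: "velocity euclid (\<lambda>t. t) 0 \<in> tangent_space (euclid :: (real, real) manifold) 0"
  using velocity_in_tangent_space[of euclid "\<lambda>t::real. t"] smooth_at_ident[OF smooth_manifold_euclid, of "0::real"] by simp

lemma velocity_as_tangent_real_line:
  assumes \<gamma>: "smooth_at euclid M 0 \<gamma>" and f: "smooth_near M (\<gamma> 0) f"
  shows "velocity M \<gamma> 0 f = velocity euclid (\<lambda>t::real. t) 0 (\<lambda>t. f (\<gamma> t))"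
proof (rule DERIV_unique[OF velocity_has_derivative[OF manifold_M \<gamma> f]])
  have "smooth_near euclid 0 (\<lambda>t. f (\<gamma> t))" by (rule smooth_near_comp[OF smooth_manifold_euclid \<gamma> f refl])
  then show "((\<lambda>t. f (\<gamma> t)) has_real_derivative velocity euclid (\<lambda>t::real. t) 0 (\<lambda>t. f (\<gamma> t))) (at 0)"
    using velocity_has_derivative[OF smooth_manifold_euclid smooth_at_ident[OF smooth_manifold_euclid], of 0 "\<lambda>t. f (\<gamma> t)"] by simp
qed

lemma velocity_mul:
  assumes \<gamma>: "smooth_at euclid M 0 \<gamma>" "\<gamma> 0 = e\<^sub>G" and \<delta>: "smooth_at euclid M 0 \<delta>" "\<delta> 0 = e\<^sub>G"
  shows "velocity M (\<lambda>t. \<gamma> t \<cdot> \<delta> t) 0 = velocity M \<gamma> 0 + velocity M \<delta> 0"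
proof
  fix f
  have s: "smooth_at euclid M 0 (\<lambda>t. \<gamma> t \<cdot> \<delta> t)" by (rule smooth_at_mul[OF smooth_manifold_euclid \<gamma>(1) \<delta>(1)])
  show "velocity M (\<lambda>t. \<gamma> t \<cdot> \<delta> t) 0 f = (velocity M \<gamma> 0 + velocity M \<delta> 0) f"
  proof (cases "smooth_near M e\<^sub>G f")
    case True
    then have "smooth_near M (\<gamma> 0 \<cdot> \<delta> 0) f" "smooth_near M (\<gamma> 0) f" "smooth_near M (\<delta> 0) f" by (simp_all add: \<gamma>(2) \<delta>(2))
    then show ?thesis
      using product_rule[OF smooth_manifold_euclid tangent_real_line \<gamma>(1) \<delta>(1), of f]
      by (simp add: velocity_as_tangent_real_line[OF s] velocity_as_tangent_real_line[OF \<gamma>(1)]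
          velocity_as_tangent_real_line[OF \<delta>(1)] \<gamma>(2) \<delta>(2))
  qed (simp add: velocity_def \<gamma>(2) \<delta>(2))
qed

lemma velocity_const: "velocity M (\<lambda>t. g) 0 = 0"
  by (rule ext) (simp add: velocity_def)

lemma velocity_inv:
  assumes \<gamma>: "smooth_at euclid M 0 \<gamma>" "\<gamma> 0 = e\<^sub>G"
  shows "velocity M (\<lambda>t. (\<gamma> t)\<^sup>-) 0 = scale (- 1) (velocity M \<gamma> 0)"
proof -
  have "velocity M (\<lambda>t. \<gamma> t \<cdot> (\<gamma> t)\<^sup>-) 0 = velocity M \<gamma> 0 + velocity M (\<lambda>t. (\<gamma> t)\<^sup>-) 0"
    by (rule velocity_mul[OF \<gamma> smooth_at_inv[OF smooth_manifold_euclid \<gamma>(1)]]) (simp add: \<gamma>(2))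
  then have "velocity M \<gamma> 0 + velocity M (\<lambda>t. (\<gamma> t)\<^sup>-) 0 = 0" by (simp add: velocity_const)
  then show ?thesis by (auto simp: fun_eq_iff scale_def eq_neg_iff_add_eq_0 add.commute)
qed

subsection \<open>Squaring in a chart at the identity\<close>

definition sq where "sq g = g \<cdot> g"

lemma smooth_sq: "smooth_map_on M M UNIV sq"
  by (rule smooth_map_on_at[OF manifold_M manifold_M open_UNIV])
     (simp add: sq_def[abs_def] smooth_at_mul smooth_at_ident manifold_M)

context
  fixes V \<phi>
  assumes c: "(V, \<phi>) \<in> atlas M" and eV: "e\<^sub>G \<in> V"
begin

abbreviation P where "P \<equiv> proj (model M)"
definition \<sigma> where "\<sigma> y = par M V \<phi> (\<phi> e\<^sub>G + P y)"

definition sqW where "sqW = {y. \<phi> e\<^sub>G + P y \<in> chart_dom M V \<phi> \<and> sq (\<sigma> y) \<in> V}"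

text \<open>The last summand extends squaring from the model space to the ambient Euclidean space in such a
  way that its derivative at the origin is twice the identity there.\<close>

definition sqF where "sqF y = \<phi> (sq (\<sigma> y)) - \<phi> e\<^sub>G + 2 *\<^sub>R (y - P y)"

lemma subspace_model: "subspace (model M)" by (rule smooth_manifold_subspace[OF manifold_M])
lemma bounded_linear_P: "bounded_linear P" by (rule bounded_linear_proj[OF subspace_model])
lemma P_0: "P 0 = 0" using linear_0[OF linear_proj[OF subspace_model]] .
lemma \<sigma>0: "\<sigma> 0 = e\<^sub>G" by (simp add: \<sigma>_def P_0 par_chart[OF manifold_M c eV])

lemma smooth_\<sigma>: "smooth_map_on euclid M {y. \<phi> e\<^sub>G + P y \<in> chart_dom M V \<phi>} \<sigma>"
proof -
  have "smooth_on UNIV UNIV (\<lambda>y. \<phi> e\<^sub>G + P y)"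
    by (intro smooth_on_add smooth_on_const smooth_on_linear[OF bounded_linear_P])
  then have t: "smooth_map_on euclid euclid UNIV (\<lambda>y. \<phi> e\<^sub>G + P y)" by (simp add: smooth_map_on_euclid_euclid)
  have "{y. \<phi> e\<^sub>G + P y \<in> chart_dom M V \<phi>} = UNIV \<inter> (\<lambda>y. \<phi> e\<^sub>G + P y) -` chart_dom M V \<phi>" by auto
  then have "smooth_map_on euclid euclid {y. \<phi> e\<^sub>G + P y \<in> chart_dom M V \<phi>} (\<lambda>y. \<phi> e\<^sub>G + P y)"
    using smooth_map_on_restrict[OF t open_chart_dom[OF manifold_M c]] by simp
  from smooth_map_on_comp[OF smooth_manifold_euclid smooth_manifold_euclid manifold_M this smooth_map_on_par[OF manifold_M c]]
  show ?thesis unfolding \<sigma>_def[abs_def] by blast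
qed

lemma smooth_sq\<sigma>: "smooth_map_on euclid M {y. \<phi> e\<^sub>G + P y \<in> chart_dom M V \<phi>} (\<lambda>y. sq (\<sigma> y))"
  by (rule smooth_map_on_comp[OF smooth_manifold_euclid manifold_M manifold_M smooth_\<sigma> smooth_sq]) simp

lemma sqW: "open sqW" "0 \<in> sqW"
proof -
  have "sqW = {y. \<phi> e\<^sub>G + P y \<in> chart_dom M V \<phi>} \<inter> (\<lambda>y. sq (\<sigma> y)) -` V" by (auto simp: sqW_def)
  then show "open sqW"
    using smooth_map_on_open[OF smooth_map_on_restrict[OF smooth_sq\<sigma> chart_open[OF manifold_M c]]] by simp
  show "0 \<in> sqW" by (simp add: sqW_def P_0 \<sigma>0 sq_def eV chart_in_chart_dom[OF manifold_M c eV])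
qed

lemma smooth_sqF: "smooth_on UNIV sqW sqF"
proof -
  have "smooth_map_on euclid M sqW (\<lambda>y. sq (\<sigma> y))"
    by (rule smooth_map_on_subset[OF smooth_sq\<sigma> sqW(1)]) (auto simp: sqW_def)
  from smooth_map_on_comp[OF smooth_manifold_euclid manifold_M smooth_manifold_euclid this smooth_map_on_chart[OF manifold_M c]]
  have "smooth_on UNIV sqW (\<lambda>y. \<phi> (sq (\<sigma> y)))" by (auto simp: smooth_map_on_euclid_euclid sqW_def)
  then show ?thesis unfolding sqF_def
    by (intro smooth_on_add smooth_on_diff smooth_on_const smooth_on_bounded_linear[OF bounded_linear_scaleR_right]
        smooth_on_ident smooth_on_linear[OF bounded_linear_P])
qed

lemma sqF0: "sqF 0 = 0" by (simp add: sqF_def \<sigma>0 sq_def P_0)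

text \<open>
  For \<open>X\<close> tangent at the identity, the product rule gives \<open>X(f(g g)) = X(f(g e)) + X(f(e g)) = 2 X(f)\<close>.
\<close>

lemma sqF_derivative: "(sqF has_derivative (\<lambda>u. 2 *\<^sub>R u)) (at 0)"
proof -
  have comp: "((\<lambda>y. \<phi> (sq (\<sigma> y)) \<bullet> b) has_derivative (\<lambda>v. (2 *\<^sub>R P v) \<bullet> b)) (at 0)" for b
  proof -
    let ?f = "\<lambda>g. \<phi> (sq g) \<bullet> b"
    have \<phi>b: "smooth_near M e\<^sub>G (\<lambda>q. \<phi> q \<bullet> b)" by (rule smooth_near_chart_component[OF manifold_M c eV])
    have sqs: "smooth_at M M e\<^sub>G sq" using smooth_atI[OF smooth_sq] by simp
    have f: "smooth_near M e\<^sub>G ?f"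
      by (rule smooth_near_comp[OF manifold_M sqs \<phi>b]) (simp add: sq_def)
    have tw: "frechet_derivative (\<lambda>y. ?f (par M V \<phi> y)) (at (\<phi> e\<^sub>G)) w = 2 * (w \<bullet> b)" if w: "w \<in> model M" for w
    proof -
      let ?X = "coord_vector M (V, \<phi>) w e\<^sub>G"
      have X: "?X \<in> tangent_space M e\<^sub>G" by (rule coord_vector_in_tangent_space[OF manifold_M c eV w])
      have "frechet_derivative (\<lambda>y. ?f (par M V \<phi> y)) (at (\<phi> e\<^sub>G)) w = ?X ?f"
        by (rule coord_vector_apply[OF manifold_M c eV w f, symmetric])
      also have "\<dots> = ?X (\<lambda>r. \<phi> (r \<cdot> e\<^sub>G) \<bullet> b) + ?X (\<lambda>r. \<phi> (e\<^sub>G \<cdot> r) \<bullet> b)"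
        unfolding sq_def
        by (rule product_rule[OF manifold_M X smooth_at_ident[OF manifold_M] smooth_at_ident[OF manifold_M], where f = "\<lambda>q. \<phi> q \<bullet> b"])
           (simp add: \<phi>b)
      also have "\<dots> = 2 * ?X (\<lambda>r. \<phi> r \<bullet> b)" by simp
      also have "?X (\<lambda>r. \<phi> r \<bullet> b) = w \<bullet> b"
      proof -
        have "((\<lambda>y. \<phi> (par M V \<phi> y) \<bullet> b) has_derivative (\<lambda>v. P v \<bullet> b)) (at (\<phi> e\<^sub>G))"
          by (rule has_derivative_transform_within_open[OF _ open_chart_dom[OF manifold_M c] chart_in_chart_dom[OF manifold_M c eV],
                where f = "\<lambda>y. P y \<bullet> b"])
             (auto intro!: bounded_linear_imp_has_derivative bounded_linear_inner_left_comp bounded_linear_P simp: chart_par[OF manifold_M c])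
        from fun_cong[OF frechet_derivative_at[OF this], of w]
        have "frechet_derivative (\<lambda>y. \<phi> (par M V \<phi> y) \<bullet> b) (at (\<phi> e\<^sub>G)) w = w \<bullet> b"
          by (simp add: proj_id[OF subspace_model w])
        then show ?thesis by (simp add: coord_vector_apply[OF manifold_M c eV w \<phi>b])
      qed
      finally show ?thesis .
    qed
    have d: "((\<lambda>y. ?f (par M V \<phi> y)) has_derivative frechet_derivative (\<lambda>y. ?f (par M V \<phi> y)) (at (\<phi> e\<^sub>G))) (at (\<phi> e\<^sub>G + P 0))"
      using smooth_at_euclid_has_derivative[OF smooth_at_comp_par[OF manifold_M c eV f]] by (simp add: P_0)
    have "((\<lambda>y. \<phi> e\<^sub>G + P y) has_derivative P) (at 0)"
      using has_derivative_add[OF has_derivative_const bounded_linear_imp_has_derivative[OF bounded_linear_P]] by simp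
    from has_derivative_compose[OF this d]
    have "((\<lambda>y. ?f (\<sigma> y)) has_derivative (\<lambda>v. frechet_derivative (\<lambda>y. ?f (par M V \<phi> y)) (at (\<phi> e\<^sub>G)) (P v))) (at 0)"
      by (simp add: \<sigma>_def)
    then show ?thesis by (simp add: tw proj_in[OF subspace_model])
  qed
  have "((\<lambda>y. \<phi> (sq (\<sigma> y))) has_derivative (\<lambda>v. 2 *\<^sub>R P v)) (at 0)"
    using has_derivative_componentwise_within[of "\<lambda>y. \<phi> (sq (\<sigma> y))" "\<lambda>v. 2 *\<^sub>R P v" 0 UNIV] comp by simp
  then have "((\<lambda>y. \<phi> (sq (\<sigma> y)) - \<phi> e\<^sub>G + 2 *\<^sub>R (y - P y)) has_derivative (\<lambda>v. 2 *\<^sub>R P v - 0 + 2 *\<^sub>R (v - P v))) (at 0)"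
    by (intro has_derivative_add has_derivative_diff has_derivative_const has_derivative_scaleR_right
        has_derivative_ident bounded_linear_imp_has_derivative[OF bounded_linear_P])
  then show ?thesis unfolding sqF_def[abs_def] by (simp add: scaleR_diff_right)
qed

lemma \<sigma>_sqF: "y \<in> sqW \<Longrightarrow> \<sigma> (sqF y) = sq (\<sigma> y)"
proof -
  assume y: "y \<in> sqW"
  then have V: "sq (\<sigma> y) \<in> V" by (simp add: sqW_def)
  have "P (sqF y) = P (\<phi> (sq (\<sigma> y))) - P (\<phi> e\<^sub>G) + 2 *\<^sub>R (P y - P (P y))"
    unfolding sqF_def using linear_proj[OF subspace_model] by (simp add: linear_add linear_diff linear_cmul)
  also have "\<dots> = \<phi> (sq (\<sigma> y)) - \<phi> e\<^sub>G"
    by (simp add: proj_chart[OF manifold_M c V] proj_chart[OF manifold_M c eV] proj_id[OF subspace_model proj_in[OF subspace_model]])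
  finally show ?thesis using V by (simp add: \<sigma>_def par_chart[OF manifold_M c])
qed

subsection \<open>Curves doubled by squaring\<close>

text \<open>
  In the chart the curves satisfy the hypotheses of \<open>doubling_curve_unique\<close>, hence agree near \<open>0\<close>. Since
  \<open>\<gamma>(t)\<close> is the \<open>n\<close>-fold iterated square of \<open>\<gamma>(t/2\<^sup>n)\<close>, they agree everywhere.
\<close>

lemma squaring_curves_eq:
  fixes \<gamma> \<delta> :: "real \<Rightarrow> 'g"
  assumes \<gamma>: "smooth_map_on euclid M UNIV \<gamma>" "\<gamma> 0 = e\<^sub>G" "\<And>t. \<gamma> (2 * t) = sq (\<gamma> t)"
    and \<delta>: "smooth_map_on euclid M UNIV \<delta>" "\<delta> 0 = e\<^sub>G" "\<And>t. \<delta> (2 * t) = sq (\<delta> t)"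
    and eq: "velocity M \<gamma> 0 = velocity M \<delta> 0"
  shows "\<gamma> = \<delta>"
proof -
  have sm: "smooth_at euclid M 0 \<gamma>" "smooth_at euclid M 0 \<delta>" using \<gamma>(1) \<delta>(1) smooth_atI by blast+
  have evV: "\<forall>\<^sub>F t in nhds 0. \<zeta> t \<in> V \<and> \<zeta> (t / 2) \<in> V"
    if "smooth_map_on euclid M UNIV \<zeta>" "\<zeta> 0 = e\<^sub>G" for \<zeta> :: "real \<Rightarrow> 'g"
  proof -
    have o: "open (\<zeta> -` V)" using smooth_map_on_open[OF smooth_map_on_restrict[OF that(1) chart_open[OF manifold_M c]]] by simp
    have "open ((\<lambda>t. t / 2) -` (\<zeta> -` V))" by (rule open_vimage[OF o]) (intro continuous_intros, simp)
    then show ?thesis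
      using o eventually_nhds_in_open[of "\<zeta> -` V" 0] eventually_nhds_in_open[of "(\<lambda>t. t / 2) -` (\<zeta> -` V)" 0] that(2) eV
      by (simp add: eventually_conj_iff)
  qed
  have step: "\<phi> (\<zeta> t) - \<phi> e\<^sub>G = sqF (\<phi> (\<zeta> (t / 2)) - \<phi> e\<^sub>G)"
    if "\<forall>t. \<zeta> (2 * t) = sq (\<zeta> t)" "\<zeta> (t / 2) \<in> V" for \<zeta> :: "real \<Rightarrow> 'g" and t
  proof -
    have "\<phi> (\<zeta> (t / 2)) - \<phi> e\<^sub>G \<in> model M"
      using chart_in_model[OF manifold_M c] that(2) eV by (intro subspace_diff[OF subspace_model])
    then have "P (\<phi> (\<zeta> (t / 2)) - \<phi> e\<^sub>G) = \<phi> (\<zeta> (t / 2)) - \<phi> e\<^sub>G" by (rule proj_id[OF subspace_model])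
    then show ?thesis using spec[OF that(1), of "t / 2"] by (simp add: sqF_def \<sigma>_def par_chart[OF manifold_M c that(2)])
  qed
  have "\<forall>\<^sub>F t in nhds 0. \<phi> (\<gamma> t) - \<phi> e\<^sub>G = \<phi> (\<delta> t) - \<phi> e\<^sub>G"
  proof (rule doubling_curve_unique[OF sqW smooth_sqF sqF0 sqF_derivative])
    have "((\<lambda>t. \<phi> (\<gamma> t) - \<phi> e\<^sub>G) has_vector_derivative coords \<phi> (velocity M \<gamma> 0) - 0) (at 0)"
      by (intro has_vector_derivative_diff chart_curve_derivative[OF manifold_M c _ sm(1)] has_vector_derivative_const)
         (simp add: \<gamma>(2) eV)
    then show "((\<lambda>t. \<phi> (\<gamma> t) - \<phi> e\<^sub>G) has_vector_derivative coords \<phi> (velocity M \<gamma> 0)) (at 0)" by simp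
    have "((\<lambda>t. \<phi> (\<delta> t) - \<phi> e\<^sub>G) has_vector_derivative coords \<phi> (velocity M \<delta> 0) - 0) (at 0)"
      by (intro has_vector_derivative_diff chart_curve_derivative[OF manifold_M c _ sm(2)] has_vector_derivative_const)
         (simp add: \<delta>(2) eV)
    then show "((\<lambda>t. \<phi> (\<delta> t) - \<phi> e\<^sub>G) has_vector_derivative coords \<phi> (velocity M \<gamma> 0)) (at 0)" by (simp add: eq)
    show "\<forall>\<^sub>F t in nhds 0. \<phi> (\<gamma> t) - \<phi> e\<^sub>G = sqF (\<phi> (\<gamma> (t / 2)) - \<phi> e\<^sub>G) \<and>
        \<phi> (\<delta> t) - \<phi> e\<^sub>G = sqF (\<phi> (\<delta> (t / 2)) - \<phi> e\<^sub>G)"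
      using evV[OF \<gamma>(1,2)] evV[OF \<delta>(1,2)]
    proof eventually_elim
      case (elim t)
      then show ?case using step[of \<gamma> t] step[of \<delta> t] \<gamma>(3) \<delta>(3) by blast
    qed
  qed (simp_all add: \<gamma>(2) \<delta>(2))
  then have "\<forall>\<^sub>F t in nhds 0. \<gamma> t = \<delta> t"
    using evV[OF \<gamma>(1,2)] evV[OF \<delta>(1,2)]
  proof eventually_elim
    case (elim t)
    then show ?case using chart_inj[OF manifold_M c] by (auto dest: inj_onD)
  qed
  then obtain d where d: "d > 0" "\<And>t. dist t 0 < d \<Longrightarrow> \<gamma> t = \<delta> t"
    unfolding eventually_nhds_metric by blast
  have iter: "\<zeta> (2 ^ n * t) = (sq ^^ n) (\<zeta> t)" if "\<forall>t. \<zeta> (2 * t) = sq (\<zeta> t)" for \<zeta> :: "real \<Rightarrow> 'g" and n t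
  proof (induction n)
    case (Suc n)
    have "\<zeta> (2 ^ Suc n * t) = \<zeta> (2 * (2 ^ n * t))" by (simp add: mult.assoc)
    also have "\<dots> = sq (\<zeta> (2 ^ n * t))" using that by blast
    finally show ?case using Suc by simp
  qed simp
  show ?thesis
  proof
    fix t
    obtain n where "\<bar>t\<bar> / d < 2 ^ n" using real_arch_pow[of 2 "\<bar>t\<bar> / d"] by auto
    then have "dist (t / 2 ^ n) 0 < d" using d(1) by (simp add: field_simps)
    then have "(sq ^^ n) (\<gamma> (t / 2 ^ n)) = (sq ^^ n) (\<delta> (t / 2 ^ n))" using d(2) by simp
    then show "\<gamma> t = \<delta> t" using iter[of \<gamma> n "t / 2 ^ n"] iter[of \<delta> n "t / 2 ^ n"] \<gamma>(3) \<delta>(3) by simp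
  qed
qed

subsection \<open>A smooth map that intertwines doubling and squaring\<close>

text \<open>
  Repeated squaring extends the local linearisation: \<open>Exp(x)\<close> is the \<open>n\<close>-fold iterated square of
  \<open>\<sigma>(h(x/2\<^sup>n))\<close>, for any \<open>n\<close> such that \<open>x/2\<^sup>n\<close> lies in the domain of \<open>h\<close>. Locally one \<open>n\<close> serves all
  points, so \<open>Exp\<close> is smooth.
\<close>

lemma expo_exists:
  "\<exists>Exp. smooth_map_on euclid M UNIV Exp \<and> Exp 0 = e\<^sub>G \<and> (\<forall>x. Exp (2 *\<^sub>R x) = sq (Exp x)) \<and>
     (\<forall>w\<in>model M. velocity M (\<lambda>t. Exp (t *\<^sub>R w)) 0 = coord_vector M (V, \<phi>) w e\<^sub>G)"
proof -
  obtain r h where r: "r > 0" and h: "smooth_on UNIV (ball 0 r) h" "h 0 = 0" "(h has_derivative (\<lambda>u. u)) (at 0)"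
    and hW: "\<And>x. x \<in> ball 0 r \<Longrightarrow> h x \<in> sqW" and heq: "\<And>x. x \<in> ball 0 r \<Longrightarrow> h x = sqF (h (x /\<^sub>R 2))"
    using doubling_map_linearisation[OF sqW smooth_sqF sqF0 sqF_derivative] by metis
  have sm0: "smooth_map_on euclid M (ball 0 r) (\<lambda>x. \<sigma> (h x))"
    by (rule smooth_map_on_comp[OF smooth_manifold_euclid smooth_manifold_euclid manifold_M _ smooth_\<sigma>])
       (use h(1) hW in \<open>auto simp: smooth_map_on_euclid_euclid sqW_def\<close>)
  have half: "\<sigma> (h x) = sq (\<sigma> (h (x /\<^sub>R 2)))" if "x \<in> ball 0 r" for x
    using heq[OF that] \<sigma>_sqF[OF hW[OF half_in_ball[OF that]]] by simp
  have in_ball: "x /\<^sub>R 2 ^ n \<in> ball 0 r \<longleftrightarrow> norm x < r * 2 ^ n" for x :: 'e and n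
    by (simp add: field_simps)
  define Exp where "Exp x = (let n = (SOME n. norm x < r * 2 ^ n) in (sq ^^ n) (\<sigma> (h (x /\<^sub>R 2 ^ n))))" for x
  have up: "(sq ^^ n) (\<sigma> (h (x /\<^sub>R 2 ^ n))) = (sq ^^ (n + k)) (\<sigma> (h (x /\<^sub>R 2 ^ (n + k))))"
    if "norm x < r * 2 ^ n" for x n k
  proof (induction k)
    case (Suc k)
    have "r * 2 ^ n \<le> r * 2 ^ (n + k)" using r by (intro mult_left_mono power_increasing) auto
    then have "x /\<^sub>R 2 ^ (n + k) \<in> ball 0 r" using in_ball that by (meson less_le_trans)
    from half[OF this] have "\<sigma> (h (x /\<^sub>R 2 ^ (n + k))) = sq (\<sigma> (h (x /\<^sub>R 2 ^ (n + Suc k))))"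
      by (simp add: mult.commute)
    then show ?case using Suc by (simp add: funpow_swap1)
  qed simp
  have ExpI: "Exp x = (sq ^^ n) (\<sigma> (h (x /\<^sub>R 2 ^ n)))" if n: "norm x < r * 2 ^ n" for x n
  proof -
    define m where "m = (SOME n. norm x < r * 2 ^ n)"
    have m: "norm x < r * 2 ^ m" unfolding m_def using n by (rule someI)
    have "Exp x = (sq ^^ m) (\<sigma> (h (x /\<^sub>R 2 ^ m)))" by (simp add: Exp_def m_def Let_def)
    then show ?thesis using up[OF m, of n] up[OF n, of m] by (simp add: add.commute)
  qed
  have ex: "\<exists>n. norm x < r * 2 ^ n" for x :: 'e
  proof -
    obtain n where "norm x / r < 2 ^ n" using real_arch_pow[of 2 "norm x / r"] by auto
    then show ?thesis using r by (intro exI[of _ n]) (simp add: field_simps)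
  qed
  have sqn: "smooth_map_on M M UNIV (sq ^^ n)" for n
  proof (induction n)
    case 0
    then show ?case using smooth_map_on_ident[OF manifold_M] by (simp add: id_def)
  next
    case (Suc n)
    from smooth_map_on_comp[OF manifold_M manifold_M manifold_M Suc smooth_sq] show ?case by (simp add: comp_def)
  qed
  have smooth: "smooth_map_on euclid M UNIV Exp"
  proof (rule smooth_map_on_local[OF smooth_manifold_euclid manifold_M open_UNIV])
    fix x :: 'e
    obtain n where n: "norm x < r * 2 ^ n" using ex by blast
    let ?U = "ball (0::'e) (r * 2 ^ n)"
    have "smooth_map_on euclid euclid ?U (\<lambda>x. x /\<^sub>R 2 ^ n)"
      by (simp add: smooth_map_on_euclid_euclid smooth_on_linear bounded_linear_scaleR_right)
    moreover have "(\<lambda>x. x /\<^sub>R 2 ^ n) ` ?U \<subseteq> ball 0 r"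
    proof (rule image_subsetI)
      fix x assume "x \<in> ?U"
      then show "x /\<^sub>R 2 ^ n \<in> ball 0 r" by (intro iffD2[OF in_ball]) simp
    qed
    ultimately have "smooth_map_on euclid M ?U (\<lambda>x. \<sigma> (h (x /\<^sub>R 2 ^ n)))"
      by (rule smooth_map_on_comp[OF smooth_manifold_euclid smooth_manifold_euclid manifold_M _ sm0])
    from smooth_map_on_comp[OF smooth_manifold_euclid manifold_M manifold_M this sqn[of n]]
    have "smooth_map_on euclid M ?U (\<lambda>x. (sq ^^ n) (\<sigma> (h (x /\<^sub>R 2 ^ n))))" by simp
    then have "smooth_map_on euclid M ?U Exp"
      by (rule smooth_map_on_cong[OF smooth_manifold_euclid]) (simp add: ExpI)
    then show "\<exists>U'. x \<in> U' \<and> smooth_map_on euclid M U' Exp" using n by (intro exI[of _ ?U]) simp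
  qed
  have small: "Exp x = \<sigma> (h x)" if "x \<in> ball 0 r" for x
    using ExpI[of x 0] that by simp
  have dbl: "Exp (2 *\<^sub>R x) = sq (Exp x)" for x
  proof -
    obtain n where n: "norm x < r * 2 ^ n" using ex by blast
    have "Exp (2 *\<^sub>R x) = (sq ^^ Suc n) (\<sigma> (h ((2 *\<^sub>R x) /\<^sub>R 2 ^ Suc n)))" by (rule ExpI) (use n in simp)
    then show ?thesis by (simp add: ExpI[OF n])
  qed
  have vel: "velocity M (\<lambda>t. Exp (t *\<^sub>R w)) 0 = coord_vector M (V, \<phi>) w e\<^sub>G" if w: "w \<in> model M" for w
  proof (rule tangent_space_of_coords[OF manifold_M c eV w])
    have E0: "Exp (0 *\<^sub>R w) = e\<^sub>G" using small[of 0] r by (simp add: h(2) \<sigma>0)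
    fix f
    show "\<not> smooth_near M e\<^sub>G f \<Longrightarrow> velocity M (\<lambda>t. Exp (t *\<^sub>R w)) 0 f = 0" by (simp only: velocity_def E0 if_False)
    assume f: "smooth_near M e\<^sub>G f"
    have "smooth_map_on euclid euclid UNIV (\<lambda>t. t *\<^sub>R w)"
      by (simp add: smooth_map_on_euclid_euclid smooth_on_linear bounded_linear_scaleR_left)
    from smooth_map_on_comp[OF smooth_manifold_euclid smooth_manifold_euclid manifold_M this smooth]
    have sE: "smooth_at euclid M 0 (\<lambda>t. Exp (t *\<^sub>R w))" by (intro smooth_atI) auto
    have d0: "((\<lambda>t. t *\<^sub>R w) has_derivative (\<lambda>t. t *\<^sub>R w)) (at 0)"
      by (rule bounded_linear_imp_has_derivative[OF bounded_linear_scaleR_left])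
    have "(h has_derivative (\<lambda>u. u)) (at (0 *\<^sub>R w))" using h(3) by simp
    from has_derivative_compose[OF d0 this] have "((\<lambda>t. h (t *\<^sub>R w)) has_derivative (\<lambda>t. t *\<^sub>R w)) (at 0)" .
    from has_derivative_add[OF has_derivative_const bounded_linear.has_derivative[OF bounded_linear_P this]]
    have "((\<lambda>t. \<phi> e\<^sub>G + P (h (t *\<^sub>R w))) has_vector_derivative w) (at 0)"
      by (simp add: has_vector_derivative_def linear_cmul[OF linear_proj[OF subspace_model]] proj_id[OF subspace_model w])
    from smooth_at_euclid_curve_derivative[OF _ this, of "\<lambda>y. f (par M V \<phi> y)"] smooth_at_comp_par[OF manifold_M c eV f]
    have "((\<lambda>t. f (\<sigma> (h (t *\<^sub>R w)))) has_real_derivative frechet_derivative (\<lambda>y. f (par M V \<phi> y)) (at (\<phi> e\<^sub>G)) w) (at 0)"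
      by (simp add: h(2) P_0 \<sigma>_def)
    moreover have "open ((\<lambda>t. t *\<^sub>R w) -` ball 0 r)" by (intro open_vimage continuous_intros) auto
    ultimately have "((\<lambda>t. f (Exp (t *\<^sub>R w))) has_real_derivative frechet_derivative (\<lambda>y. f (par M V \<phi> y)) (at (\<phi> e\<^sub>G)) w) (at 0)"
      by (rule has_field_derivative_transform_within_open) (use r small in auto)
    then show "velocity M (\<lambda>t. Exp (t *\<^sub>R w)) 0 f = frechet_derivative (\<lambda>y. f (par M V \<phi> y)) (at (\<phi> e\<^sub>G)) w"
      using velocity_has_derivative[OF manifold_M sE] f E0 DERIV_unique by fastforce
  qed
  have "Exp 0 = e\<^sub>G" using small[of 0] r by (simp add: h(2) \<sigma>0)
  with smooth dbl vel show ?thesis by blast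
qed

subsection \<open>One-parameter subgroups\<close>

text \<open>
  For an integer \<open>k\<close>, the curves \<open>\<beta>(kt)\<close> and \<open>\<beta>(t)\<^sup>k\<close> are both doubled by squaring and have velocity \<open>k\<close>
  times that of \<open>\<beta>\<close>; so they coincide. Hence \<open>\<beta>\<close> is additive on dyadic rationals with a common
  denominator, and by continuity on \<open>\<real>\<close>.
\<close>

lemma squaring_curve_is_hom:
  fixes \<beta> :: "real \<Rightarrow> 'g"
  assumes \<beta>: "smooth_map_on euclid M UNIV \<beta>" "\<beta> 0 = e\<^sub>G" "\<And>t. \<beta> (2 * t) = sq (\<beta> t)"
  shows "\<beta> (s + t) = \<beta> s \<cdot> \<beta> t"
proof -
  note E = smooth_manifold_euclid
  have s0: "smooth_at euclid M 0 \<beta>" using \<beta>(1) by (rule smooth_atI) simp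
  have lin: "smooth_map_on euclid M UNIV (\<lambda>t. \<beta> (c * t))" for c
  proof -
    have "smooth_map_on euclid euclid UNIV (\<lambda>t::real. c * t)"
      by (simp add: smooth_map_on_euclid_euclid smooth_on_linear bounded_linear_mult_right)
    from smooth_map_on_comp[OF E E manifold_M this \<beta>(1)] show ?thesis by simp
  qed
  have pow: "smooth_map_on euclid M UNIV (\<lambda>t. \<beta> t [^]\<^bsub>G\<^esub> (k::nat)) \<and>
      velocity M (\<lambda>t. \<beta> t [^]\<^bsub>G\<^esub> k) 0 = scale (real k) (velocity M \<beta> 0)" for k
  proof (induction k)
    case 0
    show ?case using smooth_map_on_const[of euclid M "e\<^sub>G"]
      by (simp add: velocity_const) (auto simp: scale_def fun_eq_iff)
  next
    case (Suc k)
    have sk: "smooth_at euclid M t (\<lambda>t. \<beta> t [^]\<^bsub>G\<^esub> k)" "smooth_at euclid M t \<beta>" for t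
      using Suc \<beta>(1) smooth_atI by blast+
    have "smooth_map_on euclid M UNIV (\<lambda>t. \<beta> t [^]\<^bsub>G\<^esub> k \<cdot> \<beta> t)"
      by (rule smooth_map_on_at[OF E manifold_M open_UNIV]) (rule smooth_at_mul[OF E sk])
    moreover have "velocity M (\<lambda>t. \<beta> t [^]\<^bsub>G\<^esub> k \<cdot> \<beta> t) 0 = scale (real k) (velocity M \<beta> 0) + velocity M \<beta> 0"
      using velocity_mul[OF sk(1) _ sk(2) \<beta>(2)] Suc by (simp add: \<beta>(2))
    moreover have "scale (real k) (velocity M \<beta> 0) + velocity M \<beta> 0 = scale (real (Suc k)) (velocity M \<beta> 0)"
      by (auto simp: scale_def fun_eq_iff algebra_simps)
    ultimately show ?case by simp
  qed
  have nat: "\<beta> (real k * t) = \<beta> t [^]\<^bsub>G\<^esub> k" for k t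
  proof -
    have "(\<lambda>t. \<beta> (real k * t)) = (\<lambda>t. \<beta> t [^]\<^bsub>G\<^esub> k)"
    proof (rule squaring_curves_eq[OF lin])
      show "\<beta> (real k * (2 * t)) = sq (\<beta> (real k * t))" for t using \<beta>(3)[of "real k * t"] by (simp add: mult_ac)
      show "\<beta> (2 * t) [^]\<^bsub>G\<^esub> k = sq (\<beta> t [^]\<^bsub>G\<^esub> k)" for t
        by (simp add: \<beta>(3) sq_def pow_mult_distrib)
      show "velocity M (\<lambda>t. \<beta> (real k * t)) 0 = velocity M (\<lambda>t. \<beta> t [^]\<^bsub>G\<^esub> k) 0"
        using velocity_rescale[OF manifold_M s0] pow by simp
    qed (use pow in \<open>simp_all add: \<beta>(2)\<close>)
    then show ?thesis by (rule fun_cong)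
  qed
  have neg: "\<beta> (- t) = (\<beta> t)\<^sup>-" for t
  proof -
    have sb: "smooth_at euclid M t \<beta>" for t using \<beta>(1) by (rule smooth_atI) simp
    have "(\<lambda>t. \<beta> ((- 1) * t)) = (\<lambda>t. (\<beta> t)\<^sup>-)"
    proof (rule squaring_curves_eq[OF lin])
      show "smooth_map_on euclid M UNIV (\<lambda>t. (\<beta> t)\<^sup>-)"
        by (rule smooth_map_on_at[OF E manifold_M open_UNIV]) (rule smooth_at_inv[OF E sb])
      show "\<beta> ((- 1) * (2 * t)) = sq (\<beta> ((- 1) * t))" for t using \<beta>(3)[of "- t"] by simp
      show "(\<beta> (2 * t))\<^sup>- = sq ((\<beta> t)\<^sup>-)" for t by (simp add: \<beta>(3) sq_def inv_mult_group)
      show "velocity M (\<lambda>t. \<beta> ((- 1) * t)) 0 = velocity M (\<lambda>t. (\<beta> t)\<^sup>-) 0"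
        using velocity_rescale[OF manifold_M s0, of "- 1"] velocity_inv[OF s0 \<beta>(2)] by simp
    qed (simp_all add: \<beta>(2))
    from fun_cong[OF this, of t] show ?thesis by simp
  qed
  have int: "\<beta> (real_of_int i * t) = \<beta> t [^]\<^bsub>G\<^esub> i" for i t
  proof (cases "i \<ge> 0")
    case True
    then obtain k where "i = int k" using nonneg_int_cases by blast
    then show ?thesis using nat[of k t] by (simp add: int_pow_int)
  next
    case False
    then obtain k where k: "i = - int k" using int_cases4 by (metis neg_0_le_iff_le nle_le nonpos_int_cases)
    then show ?thesis using nat[of k t] neg[of "real k * t"] by (simp add: int_pow_neg int_pow_int)
  qed
  have dyadic: "\<beta> (real_of_int i / 2 ^ n + real_of_int j / 2 ^ n) = \<beta> (real_of_int i / 2 ^ n) \<cdot> \<beta> (real_of_int j / 2 ^ n)" for i j n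
    using int[of "i + j" "1 / 2 ^ n"] int[of i "1 / 2 ^ n"] int[of j "1 / 2 ^ n"]
    by (simp add: int_pow_mult add_divide_distrib)
  define a where "a u n = real_of_int \<lfloor>u * 2 ^ n\<rfloor> / 2 ^ n" for u :: real and n
  have a: "(\<lambda>n. a u n) \<longlonglongrightarrow> u" for u
  proof -
    have bnd: "norm (a u n - u) \<le> (1/2) ^ n" for n
    proof -
      have "\<bar>real_of_int \<lfloor>u * 2 ^ n\<rfloor> - u * 2 ^ n\<bar> \<le> 1" by linarith
      then have "\<bar>real_of_int \<lfloor>u * 2 ^ n\<rfloor> - u * 2 ^ n\<bar> / 2 ^ n \<le> 1 / 2 ^ n" by (rule divide_right_mono) simp
      moreover have "a u n - u = (real_of_int \<lfloor>u * 2 ^ n\<rfloor> - u * 2 ^ n) / 2 ^ n" by (simp add: a_def diff_divide_distrib)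
      ultimately show ?thesis by (simp add: power_divide)
    qed
    have "(\<lambda>n. (1/2) ^ n :: real) \<longlonglongrightarrow> 0" by (rule LIMSEQ_power_zero) simp
    then have "(\<lambda>n. a u n - u) \<longlonglongrightarrow> 0"
      by (rule Lim_null_comparison[OF always_eventually[OF allI[OF bnd]]])
    then show ?thesis by (simp add: LIM_zero_iff)
  qed
  have cont: "continuous_on UNIV \<beta>" by (rule smooth_map_on_continuous[OF \<beta>(1)])
  have cmul: "continuous_on UNIV (\<lambda>z. fst z \<cdot> snd z)"
    by (rule smooth_map_on_continuous[OF smooth_map_on_at[OF smooth_manifold_prod[OF manifold_M manifold_M] manifold_M open_UNIV smooth_mul]])
  have "continuous_on UNIV (\<lambda>z::real \<times> real. \<beta> (fst z) \<cdot> \<beta> (snd z))"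
    using continuous_on_compose2[OF cmul continuous_on_Pair[OF continuous_on_compose2[OF cont continuous_on_fst[OF continuous_on_id]]
          continuous_on_compose2[OF cont continuous_on_snd[OF continuous_on_id]]]] by simp
  then have "((\<lambda>n. (\<lambda>z. \<beta> (fst z) \<cdot> \<beta> (snd z)) (a s n, a t n)) \<longlongrightarrow> (\<lambda>z. \<beta> (fst z) \<cdot> \<beta> (snd z)) (s, t)) sequentially"
    by (rule continuous_on_tendsto_compose) (auto intro!: tendsto_Pair a)
  then have 1: "(\<lambda>n. \<beta> (a s n) \<cdot> \<beta> (a t n)) \<longlonglongrightarrow> \<beta> s \<cdot> \<beta> t" by simp
  have "(\<lambda>n. \<beta> (a s n + a t n)) \<longlonglongrightarrow> \<beta> (s + t)"
    by (rule continuous_on_tendsto_compose[OF cont]) (auto intro!: tendsto_add a)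
  moreover have "\<beta> (a s n + a t n) = \<beta> (a s n) \<cdot> \<beta> (a t n)" for n unfolding a_def by (rule dyadic)
  ultimately have 2: "(\<lambda>n. \<beta> (a s n) \<cdot> \<beta> (a t n)) \<longlonglongrightarrow> \<beta> (s + t)" by simp
  from LIMSEQ_unique[OF 2 1] show ?thesis .
qed

text \<open>
  The definite description in the definition of \<open>lie_exp\<close> is well-defined: a one-parameter group
  satisfies \<open>\<gamma>(2t) = \<gamma>(t)\<^sup>2\<close>, so \<open>squaring_curves_eq\<close> gives its uniqueness.
\<close>

lemma lie_exp_in_chart:
  "\<exists>Exp. smooth_map_on euclid M UNIV Exp \<and> (\<forall>x\<in>\<gg>. lie_exp G M x = Exp (coords \<phi> x)) \<and>
     (\<forall>w\<in>model M. \<forall>s t. Exp ((s + t) *\<^sub>R w) = Exp (s *\<^sub>R w) \<cdot> Exp (t *\<^sub>R w)) \<and>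
     (\<forall>w\<in>model M. velocity M (\<lambda>t. Exp (t *\<^sub>R w)) 0 = coord_vector M (V, \<phi>) w e\<^sub>G)"
proof -
  note E = smooth_manifold_euclid
  obtain Exp where Exp: "smooth_map_on euclid M UNIV Exp" "Exp 0 = e\<^sub>G" "\<And>x. Exp (2 *\<^sub>R x) = sq (Exp x)"
    and vel: "\<And>w. w \<in> model M \<Longrightarrow> velocity M (\<lambda>t. Exp (t *\<^sub>R w)) 0 = coord_vector M (V, \<phi>) w e\<^sub>G"
    using expo_exists by blast
  have ray: "smooth_map_on euclid M UNIV (\<lambda>t. Exp (t *\<^sub>R w))" for w
  proof -
    have "smooth_map_on euclid euclid UNIV (\<lambda>t. t *\<^sub>R w)"
      by (simp add: smooth_map_on_euclid_euclid smooth_on_linear bounded_linear_scaleR_left)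
    from smooth_map_on_comp[OF E E manifold_M this Exp(1)] show ?thesis by simp
  qed
  have ray2: "Exp ((2 * t) *\<^sub>R w) = sq (Exp (t *\<^sub>R w))" for t w
    using Exp(3)[of "t *\<^sub>R w"] by simp
  have hom: "Exp ((s + t) *\<^sub>R w) = Exp (s *\<^sub>R w) \<cdot> Exp (t *\<^sub>R w)" for s t w
    by (rule squaring_curve_is_hom[OF ray]) (simp_all add: Exp(2) ray2)
  have "lie_exp G M x = Exp (coords \<phi> x)" if x: "x \<in> \<gg>" for x
  proof -
    let ?w = "coords \<phi> x"
    have w: "?w \<in> model M" using coords_in_model[OF manifold_M c eV] x by (simp add: lie_alg_def)
    have vx: "velocity M (\<lambda>t. Exp (t *\<^sub>R ?w)) 0 = x"
      using vel[OF w] coord_vector_coords[OF manifold_M c eV] x by (simp add: lie_alg_def)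
    have "(THE \<gamma>. \<gamma> \<in> smooth_maps real_line M \<and> (\<forall>s t. \<gamma> (s + t) = \<gamma> s \<cdot> \<gamma> t) \<and> velocity M \<gamma> 0 = x) = (\<lambda>t. Exp (t *\<^sub>R ?w))"
    proof (rule the_equality)
      show "(\<lambda>t. Exp (t *\<^sub>R ?w)) \<in> smooth_maps real_line M \<and>
          (\<forall>s t. Exp ((s + t) *\<^sub>R ?w) = Exp (s *\<^sub>R ?w) \<cdot> Exp (t *\<^sub>R ?w)) \<and> velocity M (\<lambda>t. Exp (t *\<^sub>R ?w)) 0 = x"
        using ray hom vx by (simp add: smooth_maps_def real_line_eq_euclid)
      fix \<gamma> assume g: "\<gamma> \<in> smooth_maps real_line M \<and> (\<forall>s t. \<gamma> (s + t) = \<gamma> s \<cdot> \<gamma> t) \<and> velocity M \<gamma> 0 = x"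
      then have hom\<gamma>: "\<gamma> (s + t) = \<gamma> s \<cdot> \<gamma> t" for s t by blast
      have "(\<gamma> 0)\<^sup>- \<cdot> (\<gamma> 0 \<cdot> \<gamma> 0) = (\<gamma> 0)\<^sup>- \<cdot> \<gamma> 0" using hom\<gamma>[of 0 0] by simp
      then have \<gamma>0: "\<gamma> 0 = e\<^sub>G" unfolding mul_inv_cancel by simp
      show "\<gamma> = (\<lambda>t. Exp (t *\<^sub>R ?w))"
      proof (rule squaring_curves_eq)
        show "smooth_map_on euclid M UNIV \<gamma>" using g by (simp add: smooth_maps_def real_line_eq_euclid)
        show "\<gamma> (2 * t) = sq (\<gamma> t)" for t using hom\<gamma>[of t t] by (simp add: sq_def)
        show "velocity M \<gamma> 0 = velocity M (\<lambda>t. Exp (t *\<^sub>R ?w)) 0" using g vx by simp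
      qed (simp_all add: ray ray2 \<gamma>0 Exp(2))
    qed
    then show ?thesis by (simp add: lie_exp_def)
  qed
  with Exp(1) hom vel show ?thesis by blast
qed

end

end

section \<open>Currents\<close>

lemma smooth_map_on_diff:
  fixes f g :: "'a::{t2_space,second_countable_topology} \<Rightarrow> 'f::euclidean_space"
  assumes M: "smooth_manifold M" and f: "smooth_map_on M euclid U f" and g: "smooth_map_on M euclid U g"
  shows "smooth_map_on M euclid U (\<lambda>q. f q - g q)"
  using smooth_map_on_add[OF M f smooth_map_on_bounded_linear[OF M g bounded_linear_minus[OF bounded_linear_ident]]] by simp

lemma smooth_map_on_coord_vector:
  fixes S :: "('s::{t2_space,second_countable_topology}, 'd::euclidean_space) manifold"
  assumes S: "smooth_manifold S" and c: "(V, \<psi>) \<in> atlas S" and w: "w \<in> model S"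
    and h: "smooth_map_on S euclid UNIV h"
  shows "smooth_map_on S euclid V (\<lambda>q. coord_vector S (V, \<psi>) w q h)"
proof (rule smooth_map_on_coord_derivative[OF S S c w, where \<Psi> = "\<lambda>q. h" and W = UNIV and \<kappa> = "\<lambda>q. q"])
  show "smooth_map_on (prod_manifold S S) euclid UNIV (\<lambda>z. h (snd z))"
    by (rule smooth_map_on_comp[OF smooth_manifold_prod[OF S S] S smooth_manifold_euclid smooth_map_on_snd[OF S S] h]) simp
  show "smooth_map_on S S V (\<lambda>q. q)"
    by (rule smooth_map_on_subset[OF smooth_map_on_ident[OF S] chart_open[OF S c]]) simp
qed auto

context lie_grp
begin

lemma unit_chart:
  obtains V \<phi> where "(V, \<phi>) \<in> atlas M" "e\<^sub>G \<in> V"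
  using chart_at[OF manifold_M] .

context
  fixes S :: "('s::{t2_space,second_countable_topology}, 'd::euclidean_space) manifold"
  assumes S: "smooth_manifold S"
begin

abbreviation currents where "currents \<equiv> current_alg S G M"

lemma current_in: "u \<in> currents \<Longrightarrow> u q \<in> \<gg>"
  by (simp add: current_alg_def)

lemma current_smooth: "u \<in> currents \<Longrightarrow> linear_functional \<gg> \<beta> \<Longrightarrow> smooth_map_on S euclid UNIV (\<lambda>q. \<beta> (u q))"
  by (simp add: current_alg_def smooth_maps_def real_line_eq_euclid)

lemma currentI:
  "(\<And>q. u q \<in> \<gg>) \<Longrightarrow> (\<And>\<beta>. linear_functional \<gg> \<beta> \<Longrightarrow> smooth_map_on S euclid UNIV (\<lambda>q. \<beta> (u q))) \<Longrightarrow> u \<in> currents"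
  by (simp add: current_alg_def smooth_maps_def real_line_eq_euclid)

lemma current_smooth_near: "u \<in> currents \<Longrightarrow> linear_functional \<gg> \<beta> \<Longrightarrow> smooth_near S q (\<lambda>q. \<beta> (u q))"
  unfolding smooth_near_eq by (rule smooth_atI[OF current_smooth[of u \<beta>]]) simp_all

lemma current_not_smooth: "u \<in> currents \<Longrightarrow> \<not> smooth_near M e\<^sub>G f \<Longrightarrow> u q f = 0"
  using tangent_not_smooth[of "u q" M "e\<^sub>G" f] current_in[of u q] by (simp add: lie_alg_def)

subsection \<open>Differentials of currents\<close>

text \<open>
  For a curve \<open>\<gamma>\<close> with velocity \<open>X\<close>, \<open>alg_diff u X\<close> is the derivative of \<open>u \<circ> \<gamma>\<close>, a curve in the Lie
  algebra.
\<close>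

lemma alg_diff_in:
  assumes u: "u \<in> currents" and X: "X \<in> tangent_space S q"
  shows "alg_diff u X \<in> \<gg>"
proof -
  obtain \<gamma> where \<gamma>: "\<gamma> 0 = q"
    "\<And>f. smooth_near S q f \<Longrightarrow> ((\<lambda>s. f (\<gamma> s)) has_real_derivative X f) (at 0)"
    using tangent_curve[OF S X] by blast
  have y: "u (\<gamma> t) \<in> tangent_space M e\<^sub>G" for t using current_in[OF u] by (simp add: lie_alg_def)
  have d: "((\<lambda>t. u (\<gamma> t) f) has_real_derivative alg_diff u X f) (at 0)" for f
    unfolding alg_diff_def by (rule \<gamma>(2)[OF current_smooth_near[OF u evaluation_linear]])
  have Z: "alg_diff u X f = 0" if "\<not> smooth_near M e\<^sub>G f" for f
    using current_not_smooth[OF u that] tangent_const[OF S X] by (simp add: alg_diff_def)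
  show "alg_diff u X \<in> \<gg>" unfolding lie_alg_def by (rule tangent_curve_derivative_in[OF manifold_M y d Z])
qed

lemma smooth_bilinear:
  assumes c: "(V, \<phi>) \<in> atlas M" "e\<^sub>G \<in> V" and B: "bilinear_form \<gg> B"
    and y: "\<And>q. q \<in> U \<Longrightarrow> y q \<in> \<gg>" "smooth_map_on S euclid U (\<lambda>q. coords \<phi> (y q))"
    and z: "\<And>q. q \<in> U \<Longrightarrow> z q \<in> \<gg>" "smooth_map_on S euclid U (\<lambda>q. coords \<phi> (z q))"
  shows "smooth_map_on S euclid U (\<lambda>q. B (y q) (z q))"
proof (rule smooth_map_on_cong[OF S smooth_map_on_bounded_bilinear[OF S y(2) z(2) bilinear_form_in_chart[OF manifold_M c B[unfolded lie_alg_def]]]])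
  fix q assume "q \<in> U"
  then show "B (y q) (z q) = B (coord_vector M (V, \<phi>) (proj (model M) (coords \<phi> (y q))) e\<^sub>G)
      (coord_vector M (V, \<phi>) (proj (model M) (coords \<phi> (z q))) e\<^sub>G)"
    using y(1) z(1) by (simp add: lie_alg_def coord_vector_proj_coords[OF manifold_M c])
qed

lemma smooth_coordsI:
  assumes U: "open U" and y: "\<And>b. smooth_map_on S euclid U (\<lambda>q. y q (\<lambda>g. \<phi> g \<bullet> b))"
  shows "smooth_map_on S euclid U (\<lambda>q. coords \<phi> (y q))"
  unfolding coords_def
  by (intro smooth_map_on_sum[OF S U] smooth_map_on_bounded_linear[OF S y bounded_linear_scaleR_left])

lemma current_coords: "u \<in> currents \<Longrightarrow> smooth_map_on S euclid UNIV (\<lambda>q. coords \<phi> (u q))"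
  by (rule smooth_coordsI[OF open_UNIV]) (rule current_smooth[where u = u, OF _ evaluation_linear])

lemma current_bilinear_smooth:
  assumes B: "bilinear_form \<gg> B" and u: "u \<in> currents" and v: "v \<in> currents"
  shows "smooth_map_on S euclid UNIV (\<lambda>q. B (u q) (v q))"
proof -
  obtain V \<phi> where c: "(V, \<phi>) \<in> atlas M" "e\<^sub>G \<in> V" by (rule unit_chart)
  show ?thesis by (rule smooth_bilinear[OF c B current_in[OF u] current_coords[OF u] current_in[OF v] current_coords[OF v]])
qed

lemma current_bilinear_diff:
  assumes B: "bilinear_form \<gg> B" and u: "u \<in> currents" and v: "v \<in> currents" and X: "X \<in> tangent_space S q"
  shows "X (\<lambda>q. B (u q) (v q)) = B (u q) (alg_diff v X) + B (alg_diff u X) (v q)"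
proof -
  obtain \<gamma> where \<gamma>: "\<gamma> 0 = q"
    "\<And>f. smooth_near S q f \<Longrightarrow> ((\<lambda>s. f (\<gamma> s)) has_real_derivative X f) (at 0)"
    using tangent_curve[OF S X] by blast
  have y: "u (\<gamma> t) \<in> tangent_space M e\<^sub>G" if "u \<in> currents" for t u using current_in[OF that] by (simp add: lie_alg_def)
  have d: "((\<lambda>t. u (\<gamma> t) f) has_real_derivative alg_diff u X f) (at 0)" if "u \<in> currents" for f u
    unfolding alg_diff_def by (rule \<gamma>(2)[OF current_smooth_near[OF that evaluation_linear]])
  have Z: "alg_diff u X f = 0" if "u \<in> currents" "\<not> smooth_near M e\<^sub>G f" for f u
    using current_not_smooth[OF that] tangent_const[OF S X] by (simp add: alg_diff_def)
  have "smooth_near S q (\<lambda>q. B (u q) (v q))"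
    unfolding smooth_near_eq by (rule smooth_atI[OF current_bilinear_smooth[OF B u v]]) simp
  from DERIV_unique[OF \<gamma>(2)[OF this] tangent_curve_bilinear[OF manifold_M B[unfolded lie_alg_def] y[OF u] d[OF u] Z[OF u] y[OF v] d[OF v] Z[OF v]]]
  show ?thesis by (simp add: \<gamma>(1))
qed

lemma current_add:
  assumes u: "u \<in> currents" and v: "v \<in> currents"
  shows "u + v \<in> currents"
proof (rule currentI)
  show "(u + v) q \<in> \<gg>" for q using lie_alg_add current_in[OF u] current_in[OF v] by simp
  fix \<beta> assume \<beta>: "linear_functional \<gg> \<beta>"
  then have "\<beta> ((u + v) q) = \<beta> (u q) + \<beta> (v q)" for q
    using current_in[OF u] current_in[OF v] by (simp add: linear_functional_def)
  then show "smooth_map_on S euclid UNIV (\<lambda>q. \<beta> ((u + v) q))"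
    using smooth_map_on_add[OF S current_smooth[OF u \<beta>] current_smooth[OF v \<beta>]] by simp
qed

lemma current_scale:
  assumes u: "u \<in> currents"
  shows "(\<lambda>q. scale r (u q)) \<in> currents"
proof (rule currentI)
  show "scale r (u q) \<in> \<gg>" for q using lie_alg_scale current_in[OF u] by simp
  fix \<beta> assume \<beta>: "linear_functional \<gg> \<beta>"
  then have "\<beta> (scale r (u q)) = r * \<beta> (u q)" for q
    using current_in[OF u] by (simp add: linear_functional_def)
  then show "smooth_map_on S euclid UNIV (\<lambda>q. \<beta> (scale r (u q)))"
    using smooth_map_on_bounded_linear[OF S current_smooth[OF u \<beta>] bounded_linear_mult_right] by simp
qed

lemma current_bracket_in:
  assumes u: "u \<in> currents" and v: "v \<in> currents"
  shows "current_bracket G M u v \<in> currents"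
proof (rule currentI)
  show "current_bracket G M u v q \<in> \<gg>" for q
    using bracket_in current_in[OF u] current_in[OF v] by (simp add: current_bracket_def)
  show "smooth_map_on S euclid UNIV (\<lambda>q. \<beta> (current_bracket G M u v q))" if "linear_functional \<gg> \<beta>" for \<beta>
    unfolding current_bracket_def by (rule current_bilinear_smooth[OF bracket_bilinear[OF that] u v])
qed

lemma alg_diff_add:
  assumes u: "u \<in> currents" and v: "v \<in> currents" and X: "X \<in> tangent_space S q"
  shows "alg_diff (u + v) X = alg_diff u X + alg_diff v X"
  using tangent_add[OF S X current_smooth_near[OF u evaluation_linear] current_smooth_near[OF v evaluation_linear]]
  by (auto simp: alg_diff_def fun_eq_iff)

lemma alg_diff_scale:
  assumes u: "u \<in> currents" and X: "X \<in> tangent_space S q"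
  shows "alg_diff (\<lambda>q. scale r (u q)) X = scale r (alg_diff u X)"
  using tangent_cmul[OF S X current_smooth_near[OF u evaluation_linear]]
  by (auto simp: alg_diff_def fun_eq_iff scale_def)

lemma alg_diff_bracket:
  assumes u: "u \<in> currents" and v: "v \<in> currents" and X: "X \<in> tangent_space S q"
  shows "alg_diff (current_bracket G M u v) X = lie_bracket G M (u q) (alg_diff v X) + lie_bracket G M (alg_diff u X) (v q)"
proof
  fix f
  show "alg_diff (current_bracket G M u v) X f = (lie_bracket G M (u q) (alg_diff v X) + lie_bracket G M (alg_diff u X) (v q)) f"
    using current_bilinear_diff[OF bracket_bilinear[OF evaluation_linear] u v X, of f]
    by (simp add: alg_diff_def current_bracket_def)
qed

lemma alg_diff_vector_add: "alg_diff u (X + Y) = alg_diff u X + alg_diff u Y"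
  and alg_diff_vector_scale: "alg_diff u (scale r X) = scale r (alg_diff u X)"
  by (auto simp: alg_diff_def scale_def)

lemma alg_diff_coords_smooth:
  assumes u: "u \<in> currents" and c: "(V, \<psi>) \<in> atlas S" and w: "w \<in> model S"
  shows "smooth_map_on S euclid V (\<lambda>q. coords \<phi> (alg_diff u (coord_vector S (V, \<psi>) w q)))"
  by (rule smooth_coordsI[OF chart_open[OF S c]], unfold alg_diff_def)
     (rule smooth_map_on_coord_vector[OF S c w current_smooth[OF u evaluation_linear]])

lemma one_formsI:
  assumes "\<And>q. linear_functional (tangent_space S q) (\<beta> q)"
    and "\<And>q X. X \<notin> tangent_space S q \<Longrightarrow> \<beta> q X = 0"
    and "\<And>V \<psi> w. (V, \<psi>) \<in> atlas S \<Longrightarrow> w \<in> model S \<Longrightarrow>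
      smooth_map_on S euclid V (\<lambda>q. \<beta> q (coord_vector S (V, \<psi>) w q))"
  shows "\<beta> \<in> one_forms S"
  using assms unfolding one_forms_def real_line_eq_euclid by blast

subsection \<open>The Lie algebra cocycle\<close>

context
  fixes \<alpha> p \<omega> :: "'g tvec \<Rightarrow> 'g tvec \<Rightarrow> real"
  assumes \<alpha>: "lie_one_cocycle G M \<alpha>"
    and p: "\<And>x y. x \<in> \<gg> \<Longrightarrow> y \<in> \<gg> \<Longrightarrow> p x y = p y x"
    and \<omega>: "\<And>x y. x \<in> \<gg> \<Longrightarrow> y \<in> \<gg> \<Longrightarrow> \<omega> x y = - \<omega> y x"
    and p\<omega>: "\<And>x y. x \<in> \<gg> \<Longrightarrow> y \<in> \<gg> \<Longrightarrow> \<alpha> x y = p x y + \<omega> x y"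
begin

lemma \<alpha>_bilinear: "bilinear_form \<gg> \<alpha>"
  using \<alpha> by (simp add: lie_one_cocycle_def bilinear_form_def)

lemma \<alpha>_cocycle: "x \<in> \<gg> \<Longrightarrow> y \<in> \<gg> \<Longrightarrow> z \<in> \<gg> \<Longrightarrow>
    \<alpha> (lie_bracket G M x y) z = \<alpha> x (lie_bracket G M y z) - \<alpha> y (lie_bracket G M x z)"
  using \<alpha> by (simp add: lie_one_cocycle_def)

lemma \<alpha>_linear:
  "x \<in> \<gg> \<Longrightarrow> y \<in> \<gg> \<Longrightarrow> z \<in> \<gg> \<Longrightarrow> \<alpha> (x + y) z = \<alpha> x z + \<alpha> y z"
  "x \<in> \<gg> \<Longrightarrow> y \<in> \<gg> \<Longrightarrow> z \<in> \<gg> \<Longrightarrow> \<alpha> z (x + y) = \<alpha> z x + \<alpha> z y"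
  "x \<in> \<gg> \<Longrightarrow> z \<in> \<gg> \<Longrightarrow> \<alpha> (scale r x) z = r * \<alpha> x z"
  "x \<in> \<gg> \<Longrightarrow> z \<in> \<gg> \<Longrightarrow> \<alpha> z (scale r x) = r * \<alpha> z x"
  using \<alpha>_bilinear by (simp_all add: bilinear_form_def linear_functional_def)

lemma \<omega>_eq: "x \<in> \<gg> \<Longrightarrow> y \<in> \<gg> \<Longrightarrow> \<omega> x y = (\<alpha> x y - \<alpha> y x) / 2"
  and p_eq: "x \<in> \<gg> \<Longrightarrow> y \<in> \<gg> \<Longrightarrow> p x y = (\<alpha> x y + \<alpha> y x) / 2"
  using p[of x y] \<omega>[of x y] p\<omega>[of x y] p\<omega>[of y x] by simp_all

lemma \<omega>_bilinear: "bilinear_form \<gg> \<omega>"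
  unfolding bilinear_form_def linear_functional_def
  by (simp add: \<omega>_eq lie_alg_add lie_alg_scale \<alpha>_linear field_simps)

text \<open>
  Expand \<open>d(\<omega>(u, v))\<close> by the product rule and express \<open>p\<close> and \<open>\<omega>\<close> by \<open>\<alpha>\<close>.
\<close>

lemma sigma_N_eq:
  assumes u: "u \<in> currents" and v: "v \<in> currents" and X: "X \<in> tangent_space S q"
  shows "sigma_N S p \<omega> u v q X = \<alpha> (u q) (alg_diff v X) - \<alpha> (v q) (alg_diff u X)"
  using X current_bilinear_diff[OF \<omega>_bilinear u v X]
  by (simp add: sigma_N_def p_eq \<omega>_eq current_in[OF u] current_in[OF v] alg_diff_in[OF u X] alg_diff_in[OF v X] field_simps)

lemma sigma_N_outside: "X \<notin> tangent_space S q \<Longrightarrow> sigma_N S p \<omega> u v q X = 0"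
  by (simp add: sigma_N_def)

lemma sigma_N_form:
  assumes u: "u \<in> currents" and v: "v \<in> currents"
  shows "sigma_N S p \<omega> u v \<in> one_forms S"
proof (rule one_formsI)
  fix q
  have T: "X + Y \<in> tangent_space S q" "scale r X \<in> tangent_space S q"
    if "X \<in> tangent_space S q" "Y \<in> tangent_space S q" for X Y r
    using that tangent_space_add[OF S] tangent_space_scale[OF S] by blast+
  show "linear_functional (tangent_space S q) (sigma_N S p \<omega> u v q)"
    unfolding linear_functional_def
    by (simp add: sigma_N_eq[OF u v] T alg_diff_vector_add alg_diff_vector_scale \<alpha>_linear
        current_in[OF u] current_in[OF v] alg_diff_in[OF u] alg_diff_in[OF v] algebra_simps)
  show "X \<notin> tangent_space S q \<Longrightarrow> sigma_N S p \<omega> u v q X = 0" for X by (rule sigma_N_outside)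
next
  fix V \<psi> w assume c: "(V, \<psi>) \<in> atlas S" and w: "w \<in> model S"
  obtain U \<phi> where U: "(U, \<phi>) \<in> atlas M" "e\<^sub>G \<in> U" by (rule unit_chart)
  let ?X = "\<lambda>q. coord_vector S (V, \<psi>) w q"
  have X: "?X q \<in> tangent_space S q" if "q \<in> V" for q by (rule coord_vector_in_tangent_space[OF S c that w])
  have sm: "smooth_map_on S euclid V (\<lambda>q. \<alpha> (u q) (alg_diff v (?X q)))" if u: "u \<in> currents" and v: "v \<in> currents" for u v
    by (rule smooth_bilinear[OF U \<alpha>_bilinear current_in[OF u] smooth_map_on_subset[OF current_coords[OF u] chart_open[OF S c]]
          alg_diff_in[OF v X] alg_diff_coords_smooth[OF v c w]]) simp_all
  show "smooth_map_on S euclid V (\<lambda>q. sigma_N S p \<omega> u v q (?X q))"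
    by (rule smooth_map_on_cong[OF S smooth_map_on_diff[OF S sm[OF u v] sm[OF v u]]]) (simp add: sigma_N_eq[OF u v] X)
qed

lemma form_eqI:
  assumes "\<And>q X. X \<in> tangent_space S q \<Longrightarrow> \<beta> q X = \<beta>' q X" "\<And>q X. X \<notin> tangent_space S q \<Longrightarrow> \<beta> q X = \<beta>' q X"
  shows "\<beta> = \<beta>'"
  using assms by (intro ext) blast

lemma sigma_N_two_cocycle: "lie_two_cocycle currents (current_bracket G M) (one_forms S) (sigma_N S p \<omega>)"
  unfolding lie_two_cocycle_def
proof (intro conjI ballI allI)
  fix u v assume u: "u \<in> currents" and v: "v \<in> currents"
  show "sigma_N S p \<omega> u v \<in> one_forms S" by (rule sigma_N_form[OF u v])
next
  fix u v w assume u: "u \<in> currents" and v: "v \<in> currents" and w: "w \<in> currents"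
  note simps = sigma_N_outside alg_diff_add alg_diff_in current_in \<alpha>_linear
  show "sigma_N S p \<omega> (u + v) w = sigma_N S p \<omega> u w + sigma_N S p \<omega> v w"
    by (rule form_eqI) (simp_all add: sigma_N_eq[OF current_add[OF u v] w] sigma_N_eq[OF u w] sigma_N_eq[OF v w] simps u v w)
  show "sigma_N S p \<omega> w (u + v) = sigma_N S p \<omega> w u + sigma_N S p \<omega> w v"
    by (rule form_eqI) (simp_all add: sigma_N_eq[OF w current_add[OF u v]] sigma_N_eq[OF w u] sigma_N_eq[OF w v] simps u v w)
next
  fix r u v assume u: "u \<in> currents" and v: "v \<in> currents"
  note simps = sigma_N_outside alg_diff_scale alg_diff_in current_in \<alpha>_linear scale_def[of r "sigma_N S p \<omega> u v _"] right_diff_distrib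
  show "sigma_N S p \<omega> (\<lambda>q. scale r (u q)) v = (\<lambda>q. scale r (sigma_N S p \<omega> u v q))"
    by (rule form_eqI) (simp_all add: sigma_N_eq[OF current_scale[OF u] v] sigma_N_eq[OF u v] simps u v)
  show "sigma_N S p \<omega> u (\<lambda>q. scale r (v q)) = (\<lambda>q. scale r (sigma_N S p \<omega> u v q))"
    by (rule form_eqI) (simp_all add: sigma_N_eq[OF u current_scale[OF v]] sigma_N_eq[OF u v] simps u v)
next
  fix u assume u: "u \<in> currents"
  show "sigma_N S p \<omega> u u = 0"
    by (rule form_eqI) (simp_all add: sigma_N_eq[OF u u] sigma_N_outside)
next
  fix u v w assume u: "u \<in> currents" and v: "v \<in> currents" and w: "w \<in> currents"
  \<comment> \<open>Both occurrences of the bracket are expanded; in the cyclic sum the terms \<open>\<alpha>(u)[v, dw]\<close> and \<open>\<alpha>(u)[w, dv]\<close> cancel in pairs.\<close>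
  have *: "sigma_N S p \<omega> (current_bracket G M u v) w q X =
      \<alpha> (u q) (lie_bracket G M (v q) (alg_diff w X)) - \<alpha> (v q) (lie_bracket G M (u q) (alg_diff w X))
      - \<alpha> (w q) (lie_bracket G M (u q) (alg_diff v X)) + \<alpha> (w q) (lie_bracket G M (v q) (alg_diff u X))"
    if u: "u \<in> currents" and v: "v \<in> currents" and w: "w \<in> currents" and X: "X \<in> tangent_space S q" for u v w q X
  proof -
    note ins = current_in[OF u, of q] current_in[OF v, of q] current_in[OF w, of q] alg_diff_in[OF u X] alg_diff_in[OF v X] alg_diff_in[OF w X]
    have "\<alpha> (w q) (lie_bracket G M (alg_diff u X) (v q)) = - \<alpha> (w q) (lie_bracket G M (v q) (alg_diff u X))"
      unfolding bracket_swap[of "v q" "alg_diff u X"] using ins by (simp add: \<alpha>_linear bracket_in)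
    then show ?thesis
      unfolding sigma_N_eq[OF current_bracket_in[OF u v] w X] alg_diff_bracket[OF u v X]
      by (simp add: current_bracket_def \<alpha>_cocycle \<alpha>_linear bracket_in ins)
  qed
  show "sigma_N S p \<omega> (current_bracket G M u v) w + sigma_N S p \<omega> (current_bracket G M v w) u
      + sigma_N S p \<omega> (current_bracket G M w u) v = 0"
    by (rule form_eqI) (simp_all add: *[OF u v w] *[OF v w u] *[OF w u v] sigma_N_outside)
qed

subsection \<open>The current group and its cocycle\<close>

lemma group_current_group: "group (current_group S G M)"
proof (rule groupI)
  have mul: "smooth_map_on S M UNIV (\<lambda>q. g q \<cdot> h q)" if "smooth_map_on S M UNIV g" "smooth_map_on S M UNIV h" for g h
    by (rule smooth_map_on_at[OF S manifold_M open_UNIV], rule smooth_at_mul[OF S])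
       (rule smooth_atI[OF that(1)], simp, rule smooth_atI[OF that(2)], simp)
  have inv: "smooth_map_on S M UNIV (\<lambda>q. (g q)\<^sup>-)" if "smooth_map_on S M UNIV g" for g
    by (rule smooth_map_on_at[OF S manifold_M open_UNIV], rule smooth_at_inv[OF S])
       (rule smooth_atI[OF that(1)], simp)
  fix x y assume x: "x \<in> carrier (current_group S G M)" and y: "y \<in> carrier (current_group S G M)"
  then show "x \<otimes>\<^bsub>current_group S G M\<^esub> y \<in> carrier (current_group S G M)"
    using mul by (simp add: current_group_def smooth_maps_def)
  show "\<exists>y\<in>carrier (current_group S G M). y \<otimes>\<^bsub>current_group S G M\<^esub> x = \<one>\<^bsub>current_group S G M\<^esub>"
    using inv x by (intro bexI[of _ "\<lambda>q. (x q)\<^sup>-"]) (simp_all add: current_group_def smooth_maps_def)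
qed (simp_all add: current_group_def smooth_maps_def smooth_map_on_const m_assoc)

context
  fixes a :: "'g \<Rightarrow> 'g tvec \<Rightarrow> real"
  assumes a: "group_one_cocycle G M a" and a\<alpha>: "integrates_one_cocycle G M a \<alpha>"
begin

lemma a_linear: "linear_functional \<gg> (a h)"
  and a_smooth: "x \<in> \<gg> \<Longrightarrow> smooth_map_on M euclid UNIV (\<lambda>h. a h x)"
  and a_cocycle: "x \<in> \<gg> \<Longrightarrow> a (g \<cdot> h) x = a h x + a g (Ad G M h x)"
  using a by (simp_all add: group_one_cocycle_def smooth_maps_def real_line_eq_euclid)

lemma a_add: "x \<in> \<gg> \<Longrightarrow> y \<in> \<gg> \<Longrightarrow> a h (x + y) = a h x + a h y"
  and a_scale: "x \<in> \<gg> \<Longrightarrow> a h (scale r x) = r * a h x"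
  using a_linear[of h] by (simp_all add: linear_functional_def)

text \<open>
  This separates the dependence of \<open>a(h)(x)\<close> on \<open>h\<close> and on \<open>x\<close>, so that it is smooth if both vary
  smoothly.
\<close>

lemma a_in_chart:
  assumes c: "(V, \<phi>) \<in> atlas M" "e\<^sub>G \<in> V" and x: "x \<in> \<gg>"
  shows "a h x = (\<Sum>b\<in>Basis. x (\<lambda>g. \<phi> g \<bullet> b) * a h (coord_vector M (V, \<phi>) (proj (model M) b) e\<^sub>G))"
proof -
  define L where "L v = a h (coord_vector M (V, \<phi>) (proj (model M) v) e\<^sub>G)" for v
  have "linear L"
    using linear_functional_in_chart[OF manifold_M c a_linear[unfolded lie_alg_def]] bounded_linear.linear
    unfolding L_def by blast
  then have "L (coords \<phi> x) = (\<Sum>b\<in>Basis. x (\<lambda>g. \<phi> g \<bullet> b) *\<^sub>R L b)"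
    unfolding coords_def by (simp add: linear_sum linear_cmul)
  moreover have "a h x = L (coords \<phi> x)"
    unfolding L_def using coord_vector_proj_coords[OF manifold_M c] x by (simp add: lie_alg_def)
  ultimately show ?thesis by (simp add: L_def)
qed

lemma rld_component_smooth:
  assumes c: "(V, \<phi>) \<in> atlas M" "e\<^sub>G \<in> V" and g: "smooth_map_on S M UNIV g"
    and C: "(C, \<psi>) \<in> atlas S" and w: "w \<in> model S"
  shows "smooth_map_on S euclid C (\<lambda>q. right_log_deriv G M g q (coord_vector S (C, \<psi>) w q) (\<lambda>g. \<phi> g \<bullet> b))"
proof -
  note SS = smooth_manifold_prod[OF S S]
  let ?q = "\<lambda>z. g (snd z) \<cdot> (g (fst z))\<^sup>-"
  have gs: "smooth_at S M q g" for q using g by (rule smooth_atI) simp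
  have q: "smooth_map_on (prod_manifold S S) M UNIV ?q"
    by (rule smooth_map_on_at[OF SS manifold_M open_UNIV])
       (rule smooth_at_mul[OF SS smooth_at_comp[OF SS S manifold_M smooth_at_snd[OF S S] gs]
          smooth_at_inv[OF SS smooth_at_comp[OF SS S manifold_M smooth_at_fst[OF S S] gs]]])
  have "smooth_map_on (prod_manifold S S) euclid (UNIV \<inter> ?q -` V) (\<lambda>z. \<phi> (?q z) \<bullet> b)"
    by (rule smooth_map_on_bounded_linear[OF SS smooth_map_on_comp[OF SS manifold_M smooth_manifold_euclid
          smooth_map_on_restrict[OF q chart_open[OF manifold_M c(1)]] smooth_map_on_chart[OF manifold_M c(1)]] bounded_linear_inner_left]) auto
  from smooth_map_on_coord_derivative[OF S S C w this[folded case_prod_beta] smooth_map_on_subset[OF smooth_map_on_ident[OF S] chart_open[OF S C]]]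
  have "smooth_map_on S euclid C (\<lambda>q. coord_vector S (C, \<psi>) w q (\<lambda>r. \<phi> (g r \<cdot> (g q)\<^sup>-) \<bullet> b))"
    using c(2) by simp
  then show ?thesis
    by (simp add: rld_apply[OF S smooth_near_chart_component[OF manifold_M c]])
qed

lemma current_cocycle_form:
  assumes g: "smooth_map_on S M UNIV g" and h: "smooth_map_on S M UNIV h"
  shows "current_cocycle S G M a g h \<in> one_forms S"
proof (rule one_formsI)
  have hs: "smooth_at S M q h" for q using h by (rule smooth_atI) simp
  fix q
  have T: "X + Y \<in> tangent_space S q" "scale r X \<in> tangent_space S q"
    if "X \<in> tangent_space S q" "Y \<in> tangent_space S q" for X Y r
    using that tangent_space_add[OF S] tangent_space_scale[OF S] by blast+
  show "linear_functional (tangent_space S q) (current_cocycle S G M a g h q)"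
    unfolding linear_functional_def
    by (simp add: current_cocycle_def T rld_add[OF S] rld_scale[OF S] a_add a_scale rld_in[OF S hs])
  show "X \<notin> tangent_space S q \<Longrightarrow> current_cocycle S G M a g h q X = 0" for X by (simp add: current_cocycle_def)
next
  have hs: "smooth_at S M q h" for q using h by (rule smooth_atI) simp
  fix C \<psi> w assume C: "(C, \<psi>) \<in> atlas S" and w: "w \<in> model S"
  obtain V \<phi> where c: "(V, \<phi>) \<in> atlas M" "e\<^sub>G \<in> V" by (rule unit_chart)
  let ?X = "\<lambda>q. coord_vector S (C, \<psi>) w q"
  let ?e = "\<lambda>b. coord_vector M (V, \<phi>) (proj (model M) b) e\<^sub>G"
  have e: "?e b \<in> \<gg>" for b
    unfolding lie_alg_def by (rule coord_vector_in_tangent_space[OF manifold_M c proj_in[OF smooth_manifold_subspace[OF manifold_M]]])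
  have ag: "smooth_map_on S euclid C (\<lambda>q. a (g q) (?e b))" for b
    by (rule smooth_map_on_comp[OF S manifold_M smooth_manifold_euclid smooth_map_on_subset[OF g chart_open[OF S C]] a_smooth[OF e]]) auto
  have "smooth_map_on S euclid C (\<lambda>q. \<Sum>b\<in>Basis. right_log_deriv G M h q (?X q) (\<lambda>g. \<phi> g \<bullet> b) * a (g q) (?e b))"
    by (intro smooth_map_on_sum[OF S chart_open[OF S C]]
        smooth_map_on_bounded_bilinear[OF S rld_component_smooth[OF c h C w] ag bounded_bilinear_mult])
  then show "smooth_map_on S euclid C (\<lambda>q. current_cocycle S G M a g h q (?X q))"
  proof (rule smooth_map_on_cong[OF S])
    fix q assume "q \<in> C"
    then have X: "?X q \<in> tangent_space S q" by (rule coord_vector_in_tangent_space[OF S C _ w])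
    show "current_cocycle S G M a g h q (?X q)
        = (\<Sum>b\<in>Basis. right_log_deriv G M h q (?X q) (\<lambda>g. \<phi> g \<bullet> b) * a (g q) (?e b))"
      unfolding current_cocycle_def using X a_in_chart[OF c rld_in[OF S hs X]] by simp
  qed
qed

lemma current_cocycle_two_cocycle: "group_two_cocycle (current_group S G M) (one_forms S) (current_cocycle S G M a)"
  unfolding group_two_cocycle_def
proof (intro conjI ballI)
  show "group (current_group S G M)" by (rule group_current_group)
  fix g h assume "g \<in> carrier (current_group S G M)" "h \<in> carrier (current_group S G M)"
  then show "current_cocycle S G M a g h \<in> one_forms S"
    by (intro current_cocycle_form) (simp_all add: current_group_def smooth_maps_def)
next
  fix g1 g2 g3
  assume g: "g1 \<in> carrier (current_group S G M)" "g2 \<in> carrier (current_group S G M)" "g3 \<in> carrier (current_group S G M)"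
  have gs: "smooth_at S M q g2" "smooth_at S M q g3" for q
    using g by (auto simp: current_group_def smooth_maps_def intro: smooth_atI)
  show "current_cocycle S G M a g1 g2 + current_cocycle S G M a (g1 \<otimes>\<^bsub>current_group S G M\<^esub> g2) g3 =
      current_cocycle S G M a g2 g3 + current_cocycle S G M a g1 (g2 \<otimes>\<^bsub>current_group S G M\<^esub> g3)"
  proof (rule form_eqI)
    fix q X assume X: "X \<in> tangent_space S q"
    show "(current_cocycle S G M a g1 g2 + current_cocycle S G M a (g1 \<otimes>\<^bsub>current_group S G M\<^esub> g2) g3) q X =
      (current_cocycle S G M a g2 g3 + current_cocycle S G M a g1 (g2 \<otimes>\<^bsub>current_group S G M\<^esub> g3)) q X"
      using X by (simp add: current_cocycle_def current_group_def rld_mult[OF S gs X] rld_in[OF S gs(1) X] rld_in[OF S gs(2) X]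
          Ad_in a_add a_cocycle)
  qed (simp add: current_cocycle_def)
qed

subsection \<open>Differentiating the group cocycle\<close>

abbreviation expc where "expc t u \<equiv> \<lambda>q. lie_exp G M (scale t (u q))"

lemma
  assumes u: "u \<in> currents"
  shows expc_smooth: "smooth_at S M q (expc t u)"
    and expc_joint_smooth: "smooth_at (prod_manifold S euclid) M (q, s) (\<lambda>z. expc (snd z) u (fst z))"
    and expc_curve_smooth: "smooth_at euclid M s (\<lambda>t. expc t u q)"
    and expc_0: "expc 0 u q = e\<^sub>G"
    and expc_velocity: "velocity M (\<lambda>t. expc t u q) 0 = u q"
proof -
  note E = smooth_manifold_euclid
  note SE = smooth_manifold_prod[OF S E]
  obtain V \<phi> where c: "(V, \<phi>) \<in> atlas M" "e\<^sub>G \<in> V" by (rule unit_chart)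
  obtain Exp where Exp: "smooth_map_on euclid M UNIV Exp" "\<And>x. x \<in> \<gg> \<Longrightarrow> lie_exp G M x = Exp (coords \<phi> x)"
    "\<And>w s t. w \<in> model M \<Longrightarrow> Exp ((s + t) *\<^sub>R w) = Exp (s *\<^sub>R w) \<cdot> Exp (t *\<^sub>R w)"
    "\<And>w. w \<in> model M \<Longrightarrow> velocity M (\<lambda>t. Exp (t *\<^sub>R w)) 0 = coord_vector M (V, \<phi>) w e\<^sub>G"
    using lie_exp_in_chart[OF c] by blast
  let ?U = "\<lambda>q. coords \<phi> (u q)"
  have w: "?U q \<in> model M" for q
    using coords_in_model[OF manifold_M c] current_in[OF u] by (simp add: lie_alg_def)
  have eq: "expc t u q = Exp (t *\<^sub>R ?U q)" for t q
    using Exp(2)[OF lie_alg_scale[OF current_in[OF u]]] by (simp add: coords_scale)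
  have sE: "smooth_at euclid M y Exp" for y using Exp(1) by (rule smooth_atI) simp
  have sU: "smooth_at S euclid q ?U" for q using current_coords[OF u] by (rule smooth_atI) simp
  have "smooth_at (prod_manifold S euclid) euclid (q, s) (\<lambda>z. snd z *\<^sub>R ?U (fst z))"
    by (rule smooth_at_bounded_bilinear[OF SE smooth_at_snd[OF S E] smooth_at_comp[OF SE S E smooth_at_fst[OF S E] sU] bounded_bilinear_scaleR])
  from smooth_at_comp[OF SE E manifold_M this sE]
  show joint: "smooth_at (prod_manifold S euclid) M (q, s) (\<lambda>z. expc (snd z) u (fst z))" unfolding eq .
  show "smooth_at S M q (expc t u)"
    unfolding eq by (rule smooth_at_comp[OF S E manifold_M smooth_at_bounded_linear[OF S sU bounded_linear_scaleR_right] sE])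
  show "smooth_at euclid M s (\<lambda>t. expc t u q)"
    unfolding eq by (rule smooth_at_comp[OF E E manifold_M smooth_at_bounded_linear[OF E smooth_at_ident[OF E] bounded_linear_scaleR_left] sE])
  have "Exp (0 *\<^sub>R ?U q) = Exp (0 *\<^sub>R ?U q) \<cdot> Exp (0 *\<^sub>R ?U q)" using Exp(3)[OF w, of 0 0] by simp
  then have "(Exp 0)\<^sup>- \<cdot> Exp 0 = (Exp 0)\<^sup>- \<cdot> (Exp 0 \<cdot> Exp 0)" by simp
  then have "Exp 0 = e\<^sub>G" unfolding mul_inv_cancel by simp
  then show "expc 0 u q = e\<^sub>G" unfolding eq by simp
  show "velocity M (\<lambda>t. expc t u q) 0 = u q"
    unfolding eq using Exp(4)[OF w] coord_vector_coords[OF manifold_M c] current_in[OF u] by (simp add: lie_alg_def)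
qed

text \<open>
  Only the velocity of \<open>e\<^bsup>tu\<^esup>\<close> matters, and \<open>\<alpha>\<close> is the derivative of \<open>a\<close> at the identity.
\<close>

lemma a_expc_derivative:
  assumes u: "u \<in> currents" and y: "y \<in> \<gg>"
  shows "((\<lambda>t. a (expc t u q) y) has_real_derivative \<alpha> (u q) y) (at 0)"
proof -
  have "smooth_near M (expc 0 u q) (\<lambda>h. a h y)"
    unfolding smooth_near_eq by (rule smooth_atI[OF a_smooth[OF y]]) simp
  from velocity_has_derivative[OF manifold_M expc_curve_smooth[OF u] this]
  show ?thesis using a\<alpha> current_in[OF u] y by (simp add: expc_velocity[OF u] integrates_one_cocycle_def)
qed

text \<open>
  Exchange the derivative in \<open>s\<close> with \<open>X\<close>. At \<open>s = 0\<close> the curve \<open>e\<^bsup>su(r)\<^esup> (e\<^bsup>su(q)\<^esup>)\<^sup>-\<^sup>1\<close> has velocity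
  \<open>u(r) - u(q)\<close>, and the derivative of this along \<open>X\<close> is \<open>du(X)\<close>.
\<close>

lemma rld_expc_derivative:
  assumes u: "u \<in> currents" and X: "X \<in> tangent_space S q" and \<beta>: "linear_functional \<gg> \<beta>"
  shows "((\<lambda>s. \<beta> (right_log_deriv G M (expc s u) q X)) has_real_derivative \<beta> (alg_diff u X)) (at 0)"
proof (rule tangent_curve_linear[OF manifold_M _ _ _ \<beta>[unfolded lie_alg_def]])
  note E = smooth_manifold_euclid
  note SE = smooth_manifold_prod[OF S E]
  show "right_log_deriv G M (expc t u) q X \<in> tangent_space M e\<^sub>G" for t
    using rld_in[OF S expc_smooth[OF u] X] by (simp add: lie_alg_def)
  fix f
  show "alg_diff u X f = 0" if "\<not> smooth_near M e\<^sub>G f"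
    using current_not_smooth[OF u that] tangent_const[OF S X] by (simp add: alg_diff_def)
  assume f: "smooth_near M e\<^sub>G f"
  let ?\<Psi> = "\<lambda>r s. f (expc s u r \<cdot> (expc s u q)\<^sup>-)"
  let ?Y = "velocity euclid (\<lambda>t::real. t) 0"
  have k: "smooth_at (prod_manifold S euclid) M (q, 0) (\<lambda>z. expc (snd z) u (fst z) \<cdot> (expc (snd z) u q)\<^sup>-)"
    by (rule smooth_at_mul[OF SE expc_joint_smooth[OF u]
          smooth_at_inv[OF SE smooth_at_comp[OF SE E manifold_M smooth_at_snd[OF S E] expc_curve_smooth[OF u]]]])
  from smooth_near_comp[OF SE this f] have \<Psi>: "smooth_at (prod_manifold S euclid) euclid (q, 0) (\<lambda>z. ?\<Psi> (fst z) (snd z))"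
    by (simp add: smooth_near_eq expc_0[OF u])
  have "smooth_at euclid euclid 0 (\<lambda>s. X (\<lambda>r. ?\<Psi> r s))"
    by (rule smooth_at_tangent_derivative[OF E S X]) (rule smooth_at_swap[OF S E E \<Psi>])
  then have "((\<lambda>s. X (\<lambda>r. ?\<Psi> r s)) has_real_derivative ?Y (\<lambda>s. X (\<lambda>r. ?\<Psi> r s))) (at 0)"
    using velocity_has_derivative[OF E smooth_at_ident[OF E], of "0::real"] by (simp add: smooth_near_eq)
  also have "?Y (\<lambda>s. X (\<lambda>r. ?\<Psi> r s)) = X (\<lambda>r. ?Y (\<lambda>s. ?\<Psi> r s))"
    by (rule tangent_commute[OF S E X tangent_real_line \<Psi>, symmetric])
  also have "(\<lambda>r. ?Y (\<lambda>s. ?\<Psi> r s)) = (\<lambda>r. u r f - u q f)"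
  proof
    fix r
    note cs = expc_curve_smooth[OF u] and c0 = expc_0[OF u]
    note ci = smooth_at_inv[OF E cs]
    have "?Y (\<lambda>s. ?\<Psi> r s) = velocity M (\<lambda>s. expc s u r \<cdot> (expc s u q)\<^sup>-) 0 f"
      by (rule velocity_as_tangent_real_line[OF smooth_at_mul[OF E cs ci], symmetric]) (simp add: c0 f)
    also have "\<dots> = (u r + scale (- 1) (u q)) f"
      by (subst velocity_mul[OF cs c0 ci]) (simp_all add: c0 velocity_inv[OF cs c0] expc_velocity[OF u])
    finally show "?Y (\<lambda>s. ?\<Psi> r s) = u r f - u q f" by (simp add: scale_def)
  qed
  also have "X (\<lambda>r. u r f - u q f) = alg_diff u X f"
  proof -
    have "smooth_near S q (\<lambda>r. u q f)" unfolding smooth_near_eq by (rule smooth_at_const)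
    from tangent_diff[OF S X current_smooth_near[OF u evaluation_linear] this] show ?thesis
      using tangent_const[OF S X] by (simp add: alg_diff_def)
  qed
  finally show "((\<lambda>t. right_log_deriv G M (expc t u) q X f) has_real_derivative alg_diff u X f) (at 0)"
    by (simp add: rld_apply[OF S f])
qed

lemma current_cocycle_integrates: "integrates_two_cocycle S G M (current_cocycle S G M a) (sigma_N S p \<omega>)"
  unfolding integrates_two_cocycle_def Let_def
proof (intro ballI allI)
  fix u v q X assume u: "u \<in> currents" and v: "v \<in> currents" and X: "X \<in> tangent_space S q"
  let ?R = "\<lambda>t u. right_log_deriv G M (expc t u) q X"
  have R: "?R t u \<in> \<gg>" if "u \<in> currents" for t u by (rule rld_in[OF S expc_smooth[OF that] X])
  let ?D = "\<lambda>t. a (expc t u q) (alg_diff v X) - \<alpha> (v q) (?R t u)"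
  have "((\<lambda>s. a (expc t u q) (?R s v) - a (expc s v q) (?R t u)) has_real_derivative ?D t) (at 0)" for t
    by (rule DERIV_diff[OF rld_expc_derivative[OF v X a_linear] a_expc_derivative[OF v R[OF u]]])
  moreover have "linear_functional \<gg> (\<alpha> (v q))"
    using \<alpha>_bilinear current_in[OF v] by (simp add: bilinear_form_def)
  from DERIV_diff[OF a_expc_derivative[OF u alg_diff_in[OF v X]] rld_expc_derivative[OF u X this]]
  have "(?D has_real_derivative sigma_N S p \<omega> u v q X) (at 0)"
    by (simp add: sigma_N_eq[OF u v X])
  ultimately show "has_mixed_derivative (\<lambda>t s. current_cocycle S G M a (expc t u) (expc s v) q X -
      current_cocycle S G M a (expc s v) (expc t u) q X) (sigma_N S p \<omega> u v q X)"
    unfolding has_mixed_derivative_def current_cocycle_def using X by (intro exI[of _ ?D]) simp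
qed

end

end

end

end

theorem proposition2p4:
  fixes S :: "('s::{t2_space,second_countable_topology}, 'd::euclidean_space) manifold"
    and G :: "'g::{t2_space,second_countable_topology} monoid"
    and M :: "('g, 'e::euclidean_space) manifold"
    and \<alpha> p \<omega> :: "'g tvec \<Rightarrow> 'g tvec \<Rightarrow> real"
    and a :: "'g \<Rightarrow> 'g tvec \<Rightarrow> real"
  assumes "smooth_manifold S"
    and "lie_group G M"
    and "lie_one_cocycle G M \<alpha>"
    and "\<And>x y. x \<in> lie_alg G M \<Longrightarrow> y \<in> lie_alg G M \<Longrightarrow> p x y = p y x"
    and "\<And>x y. x \<in> lie_alg G M \<Longrightarrow> y \<in> lie_alg G M \<Longrightarrow> \<omega> x y = - \<omega> y x"
    and "\<And>x y. x \<in> lie_alg G M \<Longrightarrow> y \<in> lie_alg G M \<Longrightarrow> \<alpha> x y = p x y + \<omega> x y"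
    and "group_one_cocycle G M a"
    and "integrates_one_cocycle G M a \<alpha>"
  shows "group_two_cocycle (current_group S G M) (one_forms S) (current_cocycle S G M a) \<and>
    lie_two_cocycle (current_alg S G M) (current_bracket G M) (one_forms S) (sigma_N S p \<omega>) \<and>
    integrates_two_cocycle S G M (current_cocycle S G M a) (sigma_N S p \<omega>)"
proof -
  interpret lie_grp G M by (unfold_locales) (rule assms(2))
  show ?thesis
    using current_cocycle_two_cocycle[OF assms(1,3-8)] sigma_N_two_cocycle[OF assms(1,3-6)]
      current_cocycle_integrates[OF assms(1,3-8)] by blast
qed

end
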